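(* Let $\nu$ be a probability measure on the unit circle, invariant under complex conjugation and equivalent to (normalized) Lebesgue measure $\lambda$, with density $f=\frac{d\nu}{d\lambda}$. Then the unilateral shifts $T_\nu$ and $T_\lambda$ are isomorphic if and only if $Se(X_0,T_\nu)$ is finite, or equivalently if and only if $\log f$ is Lebesgue integrable.
   Context: For a conjugation-invariant probability measure $\nu$ on the circle, let $(X_n)_{n\ge0}$ be the real stationary centered Gaussian process with $E[X_mX_n]=\hat\nu(m-n)$, realized as the coordinate process on $\mathbb R^{\mathbb N}$ ($\mathbb N=\{0,1,\dots\}$) with the corresponding Gaussian measure; $T_\nu$ is the endomorphism $(T_\nu x)_n=x_{n+1}$ of this probability space. Isomorphic means measure-theoretically isomorphic as (non-invertible) measure-preserving transformations. With $\rho_n$ the density of the law of $(X_0,\dots,X_{n-1})$ with respect to Lebesgue measure on $\mathbb R^n$, the Shannon entropy is $Se(X_0,T_\nu)=\lim_n\frac1n\left(-\int_{\mathbb R^n}\rho_n\log\rho_n\,dl^n\right)\in[-\infty,\infty)$. *)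

theory Defs
  imports "HOL-Probability.Probability"
begin

definition circle_borel :: "complex measure" where
  "circle_borel = restrict_space borel (sphere 0 1)"

definition circle_lebesgue :: "complex measure" where
  "circle_lebesgue = distr (uniform_measure lborel {0..<2 * pi}) circle_borel cis"

definition fourier_coeff :: "complex measure \<Rightarrow> int \<Rightarrow> complex" where
  "fourier_coeff \<nu> k = (\<integral>z. z powi (- k) \<partial>\<nu>)"

text \<open>The point mass at 0 is the centered Gaussian law of variance 0.\<close>

definition centered_gaussian_law :: "real measure \<Rightarrow> bool" where
  "centered_gaussian_law P \<longleftrightarrow>
     P = return borel 0 \<or> (\<exists>\<sigma>>0. P = density lborel (\<lambda>x. ennreal (normal_density 0 \<sigma> x)))"

text \<open>\<open>M\<close> is the Gaussian measure on the sequence space under which the coordinates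
  \<open>X\<^sub>n x = x n\<close> form a centered Gaussian process (all finite linear combinations are
  centered Gaussian) with \<open>E[X\<^sub>m X\<^sub>n]\<close> equal to the Fourier coefficient of \<open>\<nu>\<close> at \<open>m - n\<close>.
  These conditions determine \<open>M\<close> uniquely from \<open>\<nu>\<close>.\<close>

definition is_gaussian_measure :: "complex measure \<Rightarrow> (nat \<Rightarrow> real) measure \<Rightarrow> bool" where
  "is_gaussian_measure \<nu> M \<longleftrightarrow>
     prob_space M \<and>
     sets M = sets (\<Pi>\<^sub>M i\<in>(UNIV :: nat set). (borel :: real measure)) \<and>
     (\<forall>(n::nat) (c :: nat \<Rightarrow> real).
        centered_gaussian_law (distr M borel (\<lambda>x. \<Sum>i<n. c i * x i))) \<and>
     (\<forall>m n :: nat. complex_of_real (\<integral>x. x m * x n \<partial>M) = fourier_coeff \<nu> (int m - int n))"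

definition unilateral_shift :: "(nat \<Rightarrow> real) \<Rightarrow> (nat \<Rightarrow> real)" where
  "unilateral_shift x = (\<lambda>n. x (Suc n))"

text \<open>Isomorphism modulo null sets: a bimeasurable, measure-preserving, equivariant bijection
  between forward-invariant measurable sets of full measure. The transformations
  need not be invertible.\<close>

definition mpt_isomorphic ::
  "'a measure \<Rightarrow> ('a \<Rightarrow> 'a) \<Rightarrow> 'b measure \<Rightarrow> ('b \<Rightarrow> 'b) \<Rightarrow> bool" where
  "mpt_isomorphic M T N S \<longleftrightarrow>
     (\<exists>A B \<phi> \<psi>.
        A \<in> sets M \<and> space M - A \<in> null_sets M \<and> T ` A \<subseteq> A \<and>
        B \<in> sets N \<and> space N - B \<in> null_sets N \<and> S ` B \<subseteq> B \<and>
        \<phi> \<in> measurable (restrict_space M A) (restrict_space N B) \<and>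
        \<psi> \<in> measurable (restrict_space N B) (restrict_space M A) \<and>
        (\<forall>x\<in>A. \<psi> (\<phi> x) = x) \<and> (\<forall>y\<in>B. \<phi> (\<psi> y) = y) \<and>
        distr (restrict_space M A) (restrict_space N B) \<phi> = restrict_space N B \<and>
        (\<forall>x\<in>A. \<phi> (T x) = S (\<phi> x)))"

definition marginal_law :: "(nat \<Rightarrow> real) measure \<Rightarrow> nat \<Rightarrow> (nat \<Rightarrow> real) measure" where
  "marginal_law M n = distr M (\<Pi>\<^sub>M i\<in>{..<n}. borel) (\<lambda>x. restrict x {..<n})"

definition marginal_density :: "(nat \<Rightarrow> real) measure \<Rightarrow> nat \<Rightarrow> (nat \<Rightarrow> real) \<Rightarrow> real" where
  "marginal_density M n = (\<lambda>x. enn2real (RN_deriv (\<Pi>\<^sub>M i\<in>{..<n}. lborel) (marginal_law M n) x))"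

text \<open>The limit is taken in the extended reals, so that the value \<open>-\<infinity>\<close> is possible.\<close>

definition shannon_entropy :: "(nat \<Rightarrow> real) measure \<Rightarrow> ereal" where
  "shannon_entropy M =
     lim (\<lambda>n. ereal (1 / real n *
       (- (\<integral>x. marginal_density M n x * ln (marginal_density M n x) \<partial>(\<Pi>\<^sub>M i\<in>{..<n}. lborel)))))"

end

theory Submission
  imports Defs "HOL-Computational_Algebra.Fundamental_Theorem_Algebra"
begin

text \<open>
  Let \<open>\<delta>\<close> be the infimum of \<open>\<integral>|p|\<^sup>2 d\<nu>\<close> over real polynomials with \<open>p(0) = 1\<close>, that is, the variance of
  the error in predicting \<open>X\<^sub>0\<close> from \<open>X\<^sub>1, X\<^sub>2, \<dots>\<close>. All three conditions are equivalent to \<open>\<delta> > 0\<close>.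

  If \<open>\<delta> > 0\<close>, a minimizing sequence converges in \<open>L\<^sup>2(\<nu>)\<close> to the innovation \<open>\<phi>\<close>. Orthogonality of \<open>\<phi>\<close> to
  \<open>z, z\<^sup>2, \<dots>\<close> says that \<open>|\<phi>|\<^sup>2 f\<close> has the Fourier coefficients of a constant, so \<open>|\<phi>|\<^sup>2 f = c\<close>. Hence \<open>\<phi>\<close>
  vanishes almost nowhere, the functions \<open>z\<^sup>n \<phi>\<close> span the polynomials, and the normalized innovations
  form an i.i.d. sequence that generates the same sigma algebra as the coordinates: this is the
  isomorphism. If \<open>\<delta> = 0\<close>, then \<open>X\<^sub>0\<close> is a function of \<open>X\<^sub>1, X\<^sub>2, \<dots>\<close>, so the shift is invertible
  modulo null sets, unlike the shift of an i.i.d. sequence.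

  Szego's criterion follows from Jensen's inequality \<open>ln |p(0)| \<le> \<integral> ln |p| d\<lambda>\<close> for polynomials, applied
  to prediction polynomials in one direction and to polynomials approximating \<open>1/\<phi>\<close> in the other. The
  entropy is a Cesaro limit of \<open>(ln (2 \<pi> s\<^sub>k) + 1) / 2\<close>, where the finite-step prediction errors \<open>s\<^sub>k\<close>
  decrease to \<open>\<delta>\<close>.
\<close>

section \<open>Square-integrable functions and almost minimizers in a linear range\<close>

subsection \<open>Square-integrable functions\<close>

text \<open>Prediction runs from the future because a one-sided sequence has no past to offer: a map
  commuting with the shift can build its k-th coordinate only from \<open>X_k, X_(k+1), ...\<close>,
  which on the circle means polynomials in \<open>z\<close> without negative powers. Both the
  innovation and its inverse must respect this. The equation \<open>|\<phi>|^2 f = c\<close> alone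
  does not give invertibility, since it survives multiplication of \<open>\<phi>\<close> by any
  unimodular function. For the residual \<open>l\<close> of 1 modulo the multiples
  \<open>q \<phi>\<close>, half of the Fourier coefficients of \<open>l cnj(\<phi>) f\<close> vanish
  because \<open>l\<close> is a residual; the other half vanish because \<open>\<phi>\<close> is
  orthogonal to \<open>z, z^2, ...\<close>. The entropy looks in the opposite direction: the density
  of \<open>(X_0, ..., X_(n-1))\<close> factors through predictions of \<open>X_k\<close> from
  \<open>X_0, ..., X_(k-1)\<close>. Reversing the coefficients of a polynomial preserves its norm on
  the circle and identifies the two kinds of prediction error. Jensen's inequality is established
  for polynomials without zeros on the circle, so polynomials are evaluated on slightly smaller
  circles before it is applied.\<close>

lemma quadratic_nonneg_imp:
  fixes a b t :: real
  assumes "0 \<le> a" and nonneg: "\<And>s. 0 \<le> a * s\<^sup>2 - 2 * t * s + b"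
  shows "t\<^sup>2 \<le> a * b"
proof (cases "a = 0")
  case True
  have "t = 0"
  proof (rule ccontr)
    assume "t \<noteq> 0"
    then show False using nonneg[of "(b + 1) / (2 * t)"] True by simp
  qed
  then show ?thesis using True by simp
next
  case False
  then have "a > 0" using assms by simp
  then show ?thesis using nonneg[of "t / a"]
    by (simp add: power2_eq_square field_simps)
qed

text \<open>One predicate serves both Hilbert spaces, complex functions on the circle and real
  functionals on the sequence space. Functions are kept instead of classes, since the isomorphism is
  built from pointwise limits.\<close>

definition sq_integrable :: "'a measure \<Rightarrow> ('a \<Rightarrow> 'b::euclidean_space) \<Rightarrow> bool" where
  "sq_integrable M h \<longleftrightarrow> h \<in> borel_measurable M \<and> integrable M (\<lambda>x. (norm (h x))\<^sup>2)"

lemma sq_integrable_measurable [measurable_dest]: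
  "sq_integrable M h \<Longrightarrow> h \<in> borel_measurable M"
  by (simp add: sq_integrable_def)

lemma sq_integrable_integrable:
  "sq_integrable M h \<Longrightarrow> integrable M (\<lambda>x. (norm (h x))\<^sup>2)"
  by (simp add: sq_integrable_def)

lemma norm_add_sq_le:
  fixes a b :: "'b::real_normed_vector"
  shows "(norm (a + b))\<^sup>2 \<le> 2 * (norm a)\<^sup>2 + 2 * (norm b)\<^sup>2"
proof -
  have "(norm (a + b))\<^sup>2 \<le> (norm a + norm b)\<^sup>2"
    by (intro power_mono norm_triangle_ineq) auto
  also have "\<dots> \<le> 2 * (norm a)\<^sup>2 + 2 * (norm b)\<^sup>2"
    using sum_squares_bound[of "norm a" "norm b"] by (simp add: power2_sum)
  finally show ?thesis .
qed

lemma sq_integrable_add: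
  assumes u: "sq_integrable M u" and v: "sq_integrable M v"
  shows "sq_integrable M (\<lambda>x. u x + v x)"
  unfolding sq_integrable_def
proof
  note [measurable] = u v
  show "(\<lambda>x. u x + v x) \<in> borel_measurable M"
    using u v by measurable
  have I: "integrable M (\<lambda>x. 2 * (norm (u x))\<^sup>2 + 2 * (norm (v x))\<^sup>2)"
    using u v by (auto simp: sq_integrable_def)
  show "integrable M (\<lambda>x. (norm (u x + v x))\<^sup>2)"
    by (rule Bochner_Integration.integrable_bound[OF I]) (use u v norm_add_sq_le in \<open>auto\<close>)
qed

lemma sq_integrable_scaleR:
  "sq_integrable M u \<Longrightarrow> sq_integrable M (\<lambda>x. c *\<^sub>R u x)"
  by (auto simp: sq_integrable_def power_mult_distrib)

lemma sq_integrable_diff: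
  assumes "sq_integrable M u" "sq_integrable M v"
  shows "sq_integrable M (\<lambda>x. u x - v x)"
  using sq_integrable_add[OF assms(1) sq_integrable_scaleR[OF assms(2), of "-1"]] by simp

lemma sq_integrable_cmult:
  fixes u :: "'a \<Rightarrow> complex"
  assumes u: "sq_integrable M u" and g: "g \<in> borel_measurable M" and le: "AE x in M. norm (g x) \<le> C"
  shows "sq_integrable M (\<lambda>x. g x * u x)"
  unfolding sq_integrable_def
proof
  show "(\<lambda>x. g x * u x) \<in> borel_measurable M" using u g by measurable
  have "integrable M (\<lambda>x. C\<^sup>2 * (norm (u x))\<^sup>2)"
    using u by (auto simp: sq_integrable_def)
  then show "integrable M (\<lambda>x. (norm (g x * u x))\<^sup>2)"
  proof (rule Bochner_Integration.integrable_bound)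
    show "AE x in M. norm ((norm (g x * u x))\<^sup>2) \<le> norm (C\<^sup>2 * (norm (u x))\<^sup>2)"
      using le by eventually_elim (auto simp: norm_mult power_mult_distrib intro!: mult_right_mono power_mono)
  qed (use u g in measurable)
qed

lemma integrable_norm_mult:
  assumes u: "sq_integrable M u" and v: "sq_integrable M v"
  shows "integrable M (\<lambda>x. norm (u x) * norm (v x))"
proof -
  have I: "integrable M (\<lambda>x. (norm (u x))\<^sup>2 + (norm (v x))\<^sup>2)"
    using u v by (auto simp: sq_integrable_def)
  have *: "norm (u x) * norm (v x) \<le> (norm (u x))\<^sup>2 + (norm (v x))\<^sup>2" for x
    using sum_squares_bound[of "norm (u x)" "norm (v x)"] mult_nonneg_nonneg[OF norm_ge_zero[of "u x"] norm_ge_zero[of "v x"]] by linarith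
  show ?thesis
    by (rule Bochner_Integration.integrable_bound[OF I]) (use u v * in \<open>auto simp: abs_mult\<close>)
qed

lemma integrable_mult_cnj:
  fixes u v :: "'a \<Rightarrow> complex"
  assumes u: "sq_integrable M u" and v: "sq_integrable M v"
  shows "integrable M (\<lambda>x. u x * cnj (v x))"
proof (rule Bochner_Integration.integrable_bound[OF integrable_norm_mult[OF u v]])
  have [measurable]: "cnj \<in> borel_measurable borel"
    by (intro borel_measurable_continuous_onI continuous_intros)
  show "(\<lambda>x. u x * cnj (v x)) \<in> borel_measurable M" using u v by measurable
qed (auto simp: norm_mult)

lemma Cauchy_Schwarz_sq:
  assumes u: "sq_integrable M u" and v: "sq_integrable M v"
  shows "(\<integral>x. norm (u x) * norm (v x) \<partial>M)\<^sup>2 \<le> (\<integral>x. (norm (u x))\<^sup>2 \<partial>M) * (\<integral>x. (norm (v x))\<^sup>2 \<partial>M)"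
proof (rule quadratic_nonneg_imp)
  show "0 \<le> (\<integral>x. (norm (u x))\<^sup>2 \<partial>M)" by simp
  fix s
  note [simp] = u[THEN sq_integrable_integrable] v[THEN sq_integrable_integrable] integrable_norm_mult[OF u v]
  have "0 \<le> (\<integral>x. (s * norm (u x) - norm (v x))\<^sup>2 \<partial>M)" by simp
  also have "\<dots> = (\<integral>x. s\<^sup>2 * (norm (u x))\<^sup>2 - (2 * s) * (norm (u x) * norm (v x)) + (norm (v x))\<^sup>2 \<partial>M)"
    by (intro Bochner_Integration.integral_cong) (auto simp: power2_eq_square algebra_simps)
  also have "\<dots> = (\<integral>x. (norm (u x))\<^sup>2 \<partial>M) * s\<^sup>2 - 2 * (\<integral>x. norm (u x) * norm (v x) \<partial>M) * s + (\<integral>x. (norm (v x))\<^sup>2 \<partial>M)"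
    by (subst Bochner_Integration.integral_add Bochner_Integration.integral_diff, simp, simp)+ simp
  finally show "0 \<le> \<dots>" .
qed

lemma norm_integral_mult_cnj_le:
  fixes u v :: "'a \<Rightarrow> complex"
  assumes u: "sq_integrable M u" and v: "sq_integrable M v"
  shows "(norm (\<integral>x. u x * cnj (v x) \<partial>M))\<^sup>2 \<le> (\<integral>x. (norm (u x))\<^sup>2 \<partial>M) * (\<integral>x. (norm (v x))\<^sup>2 \<partial>M)"
proof -
  have "norm (\<integral>x. u x * cnj (v x) \<partial>M) \<le> (\<integral>x. norm (u x * cnj (v x)) \<partial>M)"
    by (rule integral_norm_bound)
  also have "\<dots> = (\<integral>x. norm (u x) * norm (v x) \<partial>M)" by (simp add: norm_mult)
  finally have "(norm (\<integral>x. u x * cnj (v x) \<partial>M))\<^sup>2 \<le> (\<integral>x. norm (u x) * norm (v x) \<partial>M)\<^sup>2"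
    by (intro power_mono) auto
  then show ?thesis using Cauchy_Schwarz_sq[OF u v] by linarith
qed

text \<open>The difference of the inner products splits into one term with both errors and two terms
  with a single error, and Cauchy-Schwarz bounds each. Identities known for polynomials pass to the
  innovation through this lemma.\<close>

lemma tendsto_integral_mult_cnj:
  fixes u v :: "'a \<Rightarrow> complex"
  assumes un: "\<And>n. sq_integrable M (un n)" and vn: "\<And>n. sq_integrable M (vn n)"
    and u: "sq_integrable M u" and v: "sq_integrable M v"
    and lim_u: "(\<lambda>n. \<integral>x. (norm (un n x - u x))\<^sup>2 \<partial>M) \<longlonglongrightarrow> 0"
    and lim_v: "(\<lambda>n. \<integral>x. (norm (vn n x - v x))\<^sup>2 \<partial>M) \<longlonglongrightarrow> 0"
  shows "(\<lambda>n. \<integral>x. un n x * cnj (vn n x) \<partial>M) \<longlonglongrightarrow> (\<integral>x. u x * cnj (v x) \<partial>M)"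
proof -
  let ?N = "\<lambda>h. \<integral>x. (norm (h x))\<^sup>2 \<partial>M"
  define a where "a n = (\<integral>x. (un n x - u x) * cnj (vn n x - v x) \<partial>M)" for n
  define b where "b n = (\<integral>x. (un n x - u x) * cnj (v x) \<partial>M)" for n
  define c where "c n = (\<integral>x. u x * cnj (vn n x - v x) \<partial>M)" for n
  note D = sq_integrable_diff[OF un u] sq_integrable_diff[OF vn v]
  have sq0: "z \<longlonglongrightarrow> 0" if le: "\<And>n. (norm (z n))\<^sup>2 \<le> w n" and "w \<longlonglongrightarrow> 0" for z :: "nat \<Rightarrow> complex" and w :: "nat \<Rightarrow> real"
  proof -
    have "(\<lambda>n. (norm (z n))\<^sup>2) \<longlonglongrightarrow> 0"
      by (rule tendsto_sandwich[OF _ _ tendsto_const \<open>w \<longlonglongrightarrow> 0\<close>]) (use le in auto)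
    then have "(\<lambda>n. sqrt ((norm (z n))\<^sup>2)) \<longlonglongrightarrow> sqrt 0"
      by (rule tendsto_real_sqrt)
    then show ?thesis by (simp add: tendsto_norm_zero_iff)
  qed
  have "a \<longlonglongrightarrow> 0"
    by (rule sq0[of _ "\<lambda>n. ?N (\<lambda>x. un n x - u x) * ?N (\<lambda>x. vn n x - v x)"])
       (use norm_integral_mult_cnj_le[OF D] tendsto_mult[OF lim_u lim_v] in \<open>auto simp: a_def\<close>)
  moreover have "b \<longlonglongrightarrow> 0"
    by (rule sq0[of _ "\<lambda>n. ?N (\<lambda>x. un n x - u x) * ?N v"])
       (use norm_integral_mult_cnj_le[OF D(1) v] tendsto_mult[OF lim_u tendsto_const] in \<open>auto simp: b_def\<close>)
  moreover have "c \<longlonglongrightarrow> 0"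
    by (rule sq0[of _ "\<lambda>n. ?N u * ?N (\<lambda>x. vn n x - v x)"])
       (use norm_integral_mult_cnj_le[OF u D(2)] tendsto_mult[OF tendsto_const lim_v] in \<open>auto simp: c_def\<close>)
  ultimately have "(\<lambda>n. a n + b n + c n + (\<integral>x. u x * cnj (v x) \<partial>M)) \<longlonglongrightarrow> 0 + 0 + 0 + (\<integral>x. u x * cnj (v x) \<partial>M)"
    by (intro tendsto_intros)
  moreover have "a n + b n + c n + (\<integral>x. u x * cnj (v x) \<partial>M) = (\<integral>x. un n x * cnj (vn n x) \<partial>M)" for n
  proof -
    note I = integrable_mult_cnj[OF D(1) D(2)] integrable_mult_cnj[OF D(1) v]
       integrable_mult_cnj[OF u D(2)] integrable_mult_cnj[OF u v]
    show ?thesis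
      unfolding a_def b_def c_def
      apply (subst Bochner_Integration.integral_add[symmetric], intro I Bochner_Integration.integrable_add, rule I)
      apply (subst Bochner_Integration.integral_add[symmetric], intro I Bochner_Integration.integrable_add, intro I Bochner_Integration.integrable_add)
      apply (subst Bochner_Integration.integral_add[symmetric], intro I Bochner_Integration.integrable_add, intro I Bochner_Integration.integrable_add)
      apply (intro Bochner_Integration.integral_cong)
      apply (auto simp: algebra_simps)
      done
  qed
  ultimately show ?thesis by simp
qed

section \<open>Almost sure convergence from summable norms\<close>

lemma AE_summable_if_summable_integral:
  fixes h :: "nat \<Rightarrow> 'a \<Rightarrow> real"
  assumes int: "\<And>n. integrable M (h n)" and nonneg: "\<And>n x. 0 \<le> h n x"
    and sum: "summable (\<lambda>n. \<integral>x. h n x \<partial>M)"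
  shows "AE x in M. summable (\<lambda>n. h n x)"
proof -
  have [measurable]: "\<And>n. h n \<in> borel_measurable M" using int by auto
  have "(\<integral>\<^sup>+x. (\<Sum>n. ennreal (h n x)) \<partial>M) = (\<Sum>n. \<integral>\<^sup>+x. ennreal (h n x) \<partial>M)"
    by (rule nn_integral_suminf) auto
  also have "\<dots> = (\<Sum>n. ennreal (\<integral>x. h n x \<partial>M))"
    using nn_integral_eq_integral[OF int] nonneg by simp
  also have "\<dots> = ennreal (\<Sum>n. \<integral>x. h n x \<partial>M)"
    by (rule suminf_ennreal_eq) (use sum nonneg in \<open>auto simp: summable_sums\<close>)
  finally have "(\<integral>\<^sup>+x. (\<Sum>n. ennreal (h n x)) \<partial>M) \<noteq> \<infinity>" by simp
  then have "AE x in M. (\<Sum>n. ennreal (h n x)) \<noteq> \<infinity>"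
    by (intro nn_integral_PInf_AE) auto
  then show ?thesis
  proof eventually_elim
    case (elim x)
    then show ?case
      by (intro summable_suminf_not_top) (auto simp: nonneg)
  qed
qed

text \<open>The geometric rate replaces the usual passage to a subsequence.\<close>

lemma L2_Cauchy_AE_convergent:
  fixes h :: "nat \<Rightarrow> 'a \<Rightarrow> 'b::euclidean_space"
  assumes h: "\<And>n. sq_integrable M (h n)"
    and le: "\<And>n m. n \<le> m \<Longrightarrow> (\<integral>x. (norm (h m x - h n x))\<^sup>2 \<partial>M) \<le> C / 8 ^ n"
  shows "AE x in M. convergent (\<lambda>n. h n x)"
proof -
  let ?d = "\<lambda>n x. (norm (h (Suc n) x - h n x))\<^sup>2"
  \<comment> \<open>The weight \<open>2 ^ n\<close> spends part of the rate \<open>8 ^ n\<close>: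
    the weighted squares still have summable integrals, and
    \<open>a \<le> (1/2) ^ n + 2 ^ n * a\<^sup>2\<close> then makes the increments themselves
    summable.\<close>
  have int: "integrable M (\<lambda>x. 2 ^ n * ?d n x)" for n
    using sq_integrable_diff[OF h[of "Suc n"] h[of n]] by (auto simp: sq_integrable_def)
  have "AE x in M. summable (\<lambda>n. 2 ^ n * ?d n x)"
  proof (rule AE_summable_if_summable_integral[OF int])
    show "summable (\<lambda>n. \<integral>x. 2 ^ n * ?d n x \<partial>M)"
    proof (rule summable_comparison_test)
      show "summable (\<lambda>n. C * (1/4) ^ n)"
        by (intro summable_mult summable_geometric) auto
      have "norm (\<integral>x. 2 ^ n * ?d n x \<partial>M) \<le> C * (1/4) ^ n" for n
      proof -
        have "norm (\<integral>x. 2 ^ n * ?d n x \<partial>M) = 2 ^ n * (\<integral>x. ?d n x \<partial>M)" by simp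
        also have "\<dots> \<le> 2 ^ n * (C / 8 ^ n)" using le[of n "Suc n"] by (intro mult_left_mono) auto
        also have "(2::real) ^ n * (C / 8 ^ n) = C * (1 / 4) ^ n"
          using power_mult_distrib[of "2::real" 4 n] by (simp add: power_divide)
        finally show ?thesis by simp
      qed
      then show "\<exists>N. \<forall>n\<ge>N. norm (\<integral>x. 2 ^ n * ?d n x \<partial>M) \<le> C * (1/4) ^ n" by blast
    qed
  qed auto
  then show ?thesis
  proof eventually_elim
    case (elim x)
    have *: "norm (h (Suc n) x - h n x) \<le> (1/2) ^ n + 2 ^ n * ?d n x" for n
    proof -
      let ?a = "norm (h (Suc n) x - h n x)"
      have "2 ^ n * ?a \<le> 1 + (2 ^ n * ?a)\<^sup>2"
        using sum_squares_bound[of "2 ^ n * ?a" 1] by (simp add: power2_eq_square) (smt (verit, best) zero_le_mult_iff norm_ge_zero zero_le_power)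
      then show ?thesis by (simp add: power2_eq_square field_simps)
    qed
    have "summable (\<lambda>n. norm (h (Suc n) x - h n x))"
      by (rule summable_comparison_test[of _ "\<lambda>n. (1/2) ^ n + 2 ^ n * ?d n x"])
         (use * elim in \<open>auto intro!: summable_add summable_geometric\<close>)
    then have "summable (\<lambda>n. h (Suc n) x - h n x)" by (rule summable_norm_cancel)
    then show ?case
      using sum_lessThan_telescope[of "\<lambda>n. h n x"]
      by (simp add: summable_iff_convergent convergent_diff_const_right_iff)
  qed
qed

text \<open>The limit is the pointwise \<open>lim\<close>, a total and measurable function. Fatou's
  lemma turns the Cauchy estimate into the same estimate against the limit, with no loss in the
  rate.\<close>

lemma L2_Cauchy_limit:
  fixes h :: "nat \<Rightarrow> 'a \<Rightarrow> 'b::euclidean_space"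
  assumes h: "\<And>n. sq_integrable M (h n)"
    and le: "\<And>n m. n \<le> m \<Longrightarrow> (\<integral>x. (norm (h m x - h n x))\<^sup>2 \<partial>M) \<le> C / 8 ^ n"
  defines "l \<equiv> \<lambda>x. lim (\<lambda>n. h n x)"
  shows "AE x in M. (\<lambda>n. h n x) \<longlonglongrightarrow> l x"
    and "sq_integrable M l"
    and "\<And>n. (\<integral>x. (norm (h n x - l x))\<^sup>2 \<partial>M) \<le> C / 8 ^ n"
    and "(\<lambda>n. \<integral>x. (norm (h n x - l x))\<^sup>2 \<partial>M) \<longlonglongrightarrow> 0"
proof -
  have [measurable]: "h n \<in> borel_measurable M" for n using h by measurable
  have [measurable]: "l \<in> borel_measurable M" unfolding l_def by measurable
  show AE: "AE x in M. (\<lambda>n. h n x) \<longlonglongrightarrow> l x"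
  proof -
    have "AE x in M. convergent (\<lambda>n. h n x)"
      by (rule L2_Cauchy_AE_convergent[OF h]) (rule le)
    then show ?thesis by eventually_elim (simp add: l_def convergent_LIMSEQ_iff)
  qed
  have C: "0 \<le> C / 8 ^ n" for n using le[of n n] by simp
  have nn: "(\<integral>\<^sup>+x. ennreal ((norm (h n x - l x))\<^sup>2) \<partial>M) \<le> ennreal (C / 8 ^ n)" for n
  proof -
    have "(\<integral>\<^sup>+x. ennreal ((norm (h n x - l x))\<^sup>2) \<partial>M)
        = (\<integral>\<^sup>+x. liminf (\<lambda>m. ennreal ((norm (h n x - h m x))\<^sup>2)) \<partial>M)"
    proof (rule nn_integral_cong_AE)
      show "AE x in M. ennreal ((norm (h n x - l x))\<^sup>2) = liminf (\<lambda>m. ennreal ((norm (h n x - h m x))\<^sup>2))"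
        using AE
      proof eventually_elim
        case (elim x)
        have "(\<lambda>m. ennreal ((norm (h n x - h m x))\<^sup>2)) \<longlonglongrightarrow> ennreal ((norm (h n x - l x))\<^sup>2)"
          by (intro tendsto_ennrealI tendsto_intros elim)
        from lim_imp_Liminf[OF _ this] show ?case by simp
      qed
    qed
    also have "\<dots> \<le> liminf (\<lambda>m. \<integral>\<^sup>+x. ennreal ((norm (h n x - h m x))\<^sup>2) \<partial>M)"
      by (rule nn_integral_liminf) simp
    also have "\<dots> \<le> ennreal (C / 8 ^ n)"
    proof (rule Liminf_le)
      show "\<forall>\<^sub>F m in sequentially. (\<integral>\<^sup>+x. ennreal ((norm (h n x - h m x))\<^sup>2) \<partial>M) \<le> ennreal (C / 8 ^ n)"
        using eventually_ge_at_top[of n]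
      proof eventually_elim
        case (elim m)
        have "(\<integral>\<^sup>+x. ennreal ((norm (h n x - h m x))\<^sup>2) \<partial>M) = ennreal (\<integral>x. (norm (h n x - h m x))\<^sup>2 \<partial>M)"
          by (rule nn_integral_eq_integral) (use sq_integrable_diff[OF h[of n] h[of m]] in \<open>auto simp: sq_integrable_def\<close>)
        also have "\<dots> \<le> ennreal (C / 8 ^ n)"
          using le[OF elim] by (intro ennreal_leI) (simp add: norm_minus_commute)
        finally show ?case .
      qed
    qed simp
    finally show ?thesis .
  qed
  have D: "sq_integrable M (\<lambda>x. h n x - l x)" for n
    unfolding sq_integrable_def
    by (intro conjI integrableI_nonneg) (use nn[of n] in \<open>auto simp: less_top[symmetric] top_unique\<close>)
  show "sq_integrable M l"
    using sq_integrable_diff[OF h[of 0] D[of 0]] by simp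
  show *: "(\<integral>x. (norm (h n x - l x))\<^sup>2 \<partial>M) \<le> C / 8 ^ n" for n
    using nn[of n] nn_integral_eq_integral[OF sq_integrable_integrable[OF D[of n]]] C[of n]
    by (simp add: ennreal_le_iff)
  have "(\<lambda>n. C * (1/8) ^ n) \<longlonglongrightarrow> C * 0" by (intro tendsto_intros) auto
  then have lim: "(\<lambda>n. C / 8 ^ n) \<longlonglongrightarrow> 0" by (simp add: power_divide)
  show "(\<lambda>n. \<integral>x. (norm (h n x - l x))\<^sup>2 \<partial>M) \<longlonglongrightarrow> 0"
    by (rule tendsto_sandwich[OF _ _ tendsto_const lim]) (use * in auto)
qed

text \<open>The quantitative core of the projection onto the closure of the range of \<open>L\<close>: by the parallelogram
  law a minimizing sequence is Cauchy, and its residuals are almost orthogonal to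
  that range.\<close>

lemma almost_minimizing_sequence:
  fixes g :: "'a \<Rightarrow> 'b::euclidean_space" and L :: "'c \<Rightarrow> 'a \<Rightarrow> 'b"
  assumes g: "sq_integrable M g" and L: "\<And>p. sq_integrable M (L p)"
    and L_add: "\<And>p q. \<exists>r. L r = (\<lambda>x. L p x + L q x)"
    and L_scale: "\<And>c p. \<exists>r. L r = (\<lambda>x. c *\<^sub>R L p x)"
  obtains q where
    "\<And>n m. n \<le> m \<Longrightarrow> (\<integral>x. (norm (L (q m) x - L (q n) x))\<^sup>2 \<partial>M) \<le> 1 / 8 ^ n"
    "\<And>n p. (\<integral>x. (g x - L (q n) x) \<bullet> L p x \<partial>M)\<^sup>2 \<le> (\<integral>x. (norm (L p x))\<^sup>2 \<partial>M) / 8 ^ n"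
proof -
  define V where "V = range L"
  have V: "sq_integrable M v" if "v \<in> V" for v using that L by (auto simp: V_def)
  have "V \<noteq> {}" by (simp add: V_def)
  have LV: "L p \<in> V" for p by (simp add: V_def)
  have add: "(\<lambda>x. u x + v x) \<in> V" if uv: "u \<in> V" "v \<in> V" for u v
  proof -
    obtain p q where pq: "u = L p" "v = L q" using uv by (auto simp: V_def)
    obtain r where "L r = (\<lambda>x. L p x + L q x)" using L_add by blast
    then show ?thesis using LV[of r] pq by simp
  qed
  have scale: "(\<lambda>x. c *\<^sub>R v x) \<in> V" if v: "v \<in> V" for c v
  proof -
    obtain p where p: "v = L p" using v by (auto simp: V_def)
    obtain r where "L r = (\<lambda>x. c *\<^sub>R L p x)" using L_scale by blast
    then show ?thesis using LV[of r] p by simp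
  qed
  let ?N = "\<lambda>h. \<integral>x. (norm (h x))\<^sup>2 \<partial>M"
  define d where "d = (INF v\<in>V. ?N (\<lambda>x. g x - v x))"
  have bdd: "bdd_below ((\<lambda>v. ?N (\<lambda>x. g x - v x)) ` V)"
    by (rule bdd_belowI2[of _ 0]) simp
  have d_le: "d \<le> ?N (\<lambda>x. g x - v x)" if "v \<in> V" for v
    unfolding d_def by (rule cINF_lower[OF bdd that])
  \<comment> \<open>The two excesses enter the parallelogram law with factor 2 each, in total at
    most \<open>4 * e n\<close>; the division by 4 leaves exactly \<open>1 / 8 ^ n\<close>.\<close>
  define e :: "nat \<Rightarrow> real" where "e n = 1 / 8 ^ n / 4" for n
  have e: "e n > 0" for n by (simp add: e_def)
  have "\<exists>v\<in>V. ?N (\<lambda>x. g x - v x) < d + e n" for n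
    using cINF_less_iff[OF \<open>V \<noteq> {}\<close> bdd, of "d + e n"] e[of n] unfolding d_def by auto
  then obtain v where v: "\<And>n. v n \<in> V" and less: "\<And>n. ?N (\<lambda>x. g x - v n x) < d + e n"
    by metis
  have "(\<integral>x. (norm (v m x - v n x))\<^sup>2 \<partial>M) \<le> 1 / 8 ^ n" if "n \<le> m" for n m
  proof -
    let ?w = "\<lambda>x. (1/2) *\<^sub>R (v n x + v m x)"
    have w: "?w \<in> V" by (intro scale add v)
    note S = sq_integrable_diff[OF g V[OF v[of n]]] sq_integrable_diff[OF g V[OF v[of m]]]
      sq_integrable_diff[OF g V[OF w]]
    note I = S[THEN sq_integrable_integrable]
    \<comment> \<open>Parallelogram law with the midpoint \<open>?w\<close>: it too has squared
      distance at least \<open>d\<close> from \<open>g\<close>, which forces two near-minimizers to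
      be close.\<close>
    have par: "(norm (v m x - v n x))\<^sup>2 = 2 * (norm (g x - v n x))\<^sup>2 + 2 * (norm (g x - v m x))\<^sup>2 - 4 * (norm (g x - ?w x))\<^sup>2" for x
      unfolding power2_norm_eq_inner
      by (simp add: inner_diff_left inner_diff_right inner_add_left inner_add_right inner_commute algebra_simps)
    have "(\<integral>x. (norm (v m x - v n x))\<^sup>2 \<partial>M)
        = 2 * ?N (\<lambda>x. g x - v n x) + 2 * ?N (\<lambda>x. g x - v m x) - 4 * ?N (\<lambda>x. g x - ?w x)"
      unfolding par using I by simp
    also have "\<dots> \<le> 2 * (d + e n) + 2 * (d + e m) - 4 * d"
    proof -
      have "2 * a + 2 * b - 4 * c \<le> 2 * (d + x) + 2 * (d + y) - 4 * d"
        if "a < d + x" "b < d + y" "d \<le> c" for a b c x y :: real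
        using that by argo
      from this[OF less[of n] less[of m] d_le[OF w]] show ?thesis .
    qed
    also have "\<dots> \<le> 4 * e n"
    proof -
      have "e m \<le> e n" unfolding e_def using that by (simp add: frac_le power_increasing)
      then show ?thesis by simp
    qed
    finally show ?thesis by (simp add: e_def)
  qed
  moreover have "(\<integral>x. (g x - v n x) \<bullet> u x \<partial>M)\<^sup>2 \<le> ?N u / 8 ^ n" if u: "u \<in> V" for n u
  proof -
    have "(\<integral>x. (g x - v n x) \<bullet> u x \<partial>M)\<^sup>2 \<le> ?N u * e n"
    \<comment> \<open>Moving from \<open>v n\<close> by a multiple \<open>s\<close> of
      \<open>u\<close> stays in the range, so the squared distance remains at least
      \<open>d\<close>, while at \<open>s = 0\<close> it is below \<open>d + e n\<close>. The
      resulting quadratic in \<open>s\<close> is nonnegative, and its discriminant bounds the inner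
      product.\<close>
    proof (rule quadratic_nonneg_imp)
      fix s
      let ?w = "\<lambda>x. v n x + s *\<^sub>R u x"
      have w: "?w \<in> V" by (intro scale add v u)
      have S: "sq_integrable M (\<lambda>x. g x - v n x)" by (intro sq_integrable_diff g V v)
      have "integrable M (\<lambda>x. norm (g x - v n x) * norm (u x))"
        by (rule integrable_norm_mult[OF S V[OF u]])
      then have I: "integrable M (\<lambda>x. (g x - v n x) \<bullet> u x)"
        by (rule Bochner_Integration.integrable_bound)
           (use S V[OF u] Cauchy_Schwarz_ineq2 in \<open>auto simp: abs_mult\<close>)
      have "?N (\<lambda>x. g x - ?w x) = (\<integral>x. (norm (g x - v n x))\<^sup>2 - (2 * s) * ((g x - v n x) \<bullet> u x) + s\<^sup>2 * (norm (u x))\<^sup>2 \<partial>M)"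
        unfolding power2_norm_eq_inner
        by (intro Bochner_Integration.integral_cong)
           (auto simp: inner_diff_left inner_diff_right inner_add_left inner_add_right inner_commute algebra_simps power2_eq_square)
      also have "\<dots> = ?N (\<lambda>x. g x - v n x) - (2 * s) * (\<integral>x. (g x - v n x) \<bullet> u x \<partial>M) + s\<^sup>2 * ?N u"
        using I S[THEN sq_integrable_integrable] V[OF u, THEN sq_integrable_integrable] by simp
      finally show "0 \<le> ?N u * s\<^sup>2 - 2 * (\<integral>x. (g x - v n x) \<bullet> u x \<partial>M) * s + e n"
        using d_le[OF w] less[of n] by (simp add: algebra_simps)
    qed simp
    also have "?N u * e n \<le> ?N u / 8 ^ n"
    proof -
      have "0 \<le> ?N u" by simp
      then show ?thesis by (simp add: e_def field_simps)
    qed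
    finally show ?thesis .
  qed
  moreover obtain q where "\<And>n. v n = L (q n)"
  proof -
    have "\<forall>n. \<exists>p. v n = L p" using v by (auto simp: V_def)
    then show ?thesis using that by metis
  qed
  ultimately show ?thesis using LV by (intro that[of q]) auto
qed

lemma tendsto_0_of_sq_le:
  fixes x :: "nat \<Rightarrow> real"
  assumes "\<And>n. (x n)\<^sup>2 \<le> K / 8 ^ n"
  shows "x \<longlonglongrightarrow> 0"
proof -
  have "(\<lambda>n. K * (1/8) ^ n) \<longlonglongrightarrow> K * 0" by (intro tendsto_intros) auto
  then have lim: "(\<lambda>n. K / 8 ^ n) \<longlonglongrightarrow> 0" by (simp add: power_divide)
  have "(\<lambda>n. (x n)\<^sup>2) \<longlonglongrightarrow> 0"
    by (rule tendsto_sandwich[OF _ _ tendsto_const lim]) (use assms in auto)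
  from tendsto_real_sqrt[OF this] show ?thesis by (simp add: tendsto_rabs_zero_iff)
qed

abbreviation seq_borel :: "(nat \<Rightarrow> real) measure" where
  "seq_borel \<equiv> \<Pi>\<^sub>M i\<in>UNIV. borel"

subsection \<open>Characteristic functions and independence\<close>

context prob_space begin

lemma integrable_scaleR_iexp:
  assumes [measurable]: "w \<in> borel_measurable M" "f \<in> borel_measurable M"
    and bound: "\<And>x. \<bar>w x\<bar> \<le> (C::real)"
  shows "integrable M (\<lambda>x. w x *\<^sub>R iexp (f x))"
proof (rule integrable_const_bound[of _ C])
  show "(\<lambda>x. w x *\<^sub>R iexp (f x)) \<in> borel_measurable M"
    by measurable
qed (use bound in auto)

text \<open>Normalizing \<open>w\<close> to a probability density reduces the claim to Levy's
  uniqueness theorem for the law of \<open>U\<close> under that density. The value at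
  \<open>t = 0\<close> shows that \<open>K\<close> is the total mass of \<open>w\<close>; if it is
  0, then \<open>w\<close> vanishes almost everywhere.\<close>

lemma weighted_law_unique:
  fixes U w :: "'a \<Rightarrow> real" and K :: complex
  assumes \<mu>: "real_distribution \<mu>"
    and [measurable]: "U \<in> borel_measurable M" "w \<in> borel_measurable M" "B \<in> sets borel"
    and w: "\<And>x. 0 \<le> w x" "\<And>x. w x \<le> C"
    and char_eq: "\<And>t. (\<integral>x. w x *\<^sub>R iexp (t * U x) \<partial>M) = K * char \<mu> t"
  shows "complex_of_real (\<integral>x. w x * indicator B (U x) \<partial>M) = K * measure \<mu> B"
proof -
  interpret \<mu>: real_distribution \<mu> by fact
  have int: "integrable M w"
    by (rule integrable_const_bound[of _ C]) (use w in auto)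
  define k where "k = (\<integral>x. w x \<partial>M)"
  have "(\<integral>x. complex_of_real (w x) \<partial>M) = K"
    using char_eq[of 0] \<mu>.char_zero by (simp add: scaleR_conv_of_real)
  then have K: "K = complex_of_real k" by (simp add: k_def)
  have "0 \<le> k" unfolding k_def using w by (intro Bochner_Integration.integral_nonneg) auto
  show ?thesis
  proof (cases "k = 0")
    case True
    then have "AE x in M. w x = 0"
      using integral_nonneg_eq_0_iff_AE[OF int] w by (auto simp: k_def)
    then have "(\<integral>x. w x * indicator B (U x) \<partial>M) = (\<integral>x. 0 \<partial>M)"
      by (intro integral_cong_AE) (auto elim: eventually_mono)
    then show ?thesis using True K by simp
  next
    case False
    then have k: "k > 0" using \<open>0 \<le> k\<close> by simp
    let ?D = "density M (\<lambda>x. ennreal (w x / k))"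
    have D: "prob_space ?D"
    proof
      have "emeasure ?D (space ?D) = (\<integral>\<^sup>+x. ennreal (w x / k) \<partial>M)"
        by (simp add: emeasure_density cong: nn_integral_cong)
      also have "\<dots> = ennreal (\<integral>x. w x / k \<partial>M)"
        by (rule nn_integral_eq_integral) (use int k w in auto)
      also have "\<dots> = 1" using k by (simp add: k_def[symmetric])
      finally show "emeasure ?D (space ?D) = 1" .
    qed
    interpret D: prob_space ?D by fact
    have rd: "real_distribution (distr ?D borel U)"
      by (rule D.real_distribution_distr) simp
    have "char (distr ?D borel U) t = char \<mu> t" for t
    proof -
      have "char (distr ?D borel U) t = (\<integral>x. (w x / k) *\<^sub>R iexp (t * U x) \<partial>M)"
        unfolding char_def by (subst integral_distr) (use w k in \<open>auto simp: integral_density\<close>)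
      also have "\<dots> = (\<integral>x. w x *\<^sub>R iexp (t * U x) \<partial>M) / k"
        by (simp add: scaleR_conv_of_real)
      also have "\<dots> = char \<mu> t" using char_eq k K by simp
      finally show ?thesis .
    qed
    then have "distr ?D borel U = \<mu>"
      by (intro Levy_uniqueness rd \<mu>) auto
    then have "measure \<mu> B = measure (distr ?D borel U) B" by simp
    also have "\<dots> = (\<integral>x. indicator B x \<partial>distr ?D borel U)" by simp
    also have "\<dots> = (\<integral>x. (w x / k) * indicator B (U x) \<partial>M)"
      by (subst integral_distr) (use w k in \<open>auto simp: integral_density\<close>)
    also have "\<dots> = (\<integral>x. w x * indicator B (U x) \<partial>M) / k" by simp
    finally show ?thesis using k K by simp
  qed
qed

text \<open>Only the one-dimensional uniqueness theorem is available, so a coordinate is split off by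
  weighting the measure with the nonnegative functions \<open>1 + cos s\<close> and \<open>1 + sin s\<close>, where \<open>s\<close>
  is a linear combination of the remaining coordinates.\<close>

lemma char_product_imp_rectangles:
  fixes U :: "nat \<Rightarrow> 'a \<Rightarrow> real" and \<mu> :: "nat \<Rightarrow> real measure"
  assumes \<mu>: "\<And>k. real_distribution (\<mu> k)"
    and U [measurable]: "\<And>k. U k \<in> borel_measurable M"
    and B [measurable]: "\<And>k. B k \<in> sets borel"
    and [measurable]: "w \<in> borel_measurable M"
    and w: "\<And>x. 0 \<le> w x" "\<And>x. w x \<le> 1"
    and char_eq: "\<And>c. (\<integral>x. w x *\<^sub>R iexp (\<Sum>k<n. c k * U k x) \<partial>M) = m * (\<Prod>k<n. char (\<mu> k) (c k))"
  shows "complex_of_real (\<integral>x. w x * (\<Prod>k<n. indicator (B k) (U k x)) \<partial>M) = m * (\<Prod>k<n. measure (\<mu> k) (B k))"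
  using \<open>w \<in> _\<close> w char_eq
proof (induction n arbitrary: w m)
  case 0
  have "(\<integral>x. complex_of_real (w x) \<partial>M) = m"
    using "0.prems"(4)[of "\<lambda>_. 0"] by (simp add: scaleR_conv_of_real)
  then show ?case by simp
next
  case (Suc n)
  note [measurable] = Suc.prems(1)
  have abs_w: "\<bar>w x\<bar> \<le> 1" for x using Suc.prems(2,3)[of x] by simp
  define b where "b = measure (\<mu> n) (B n)"
  define \<psi> where "\<psi> c = (\<Prod>k<n. char (\<mu> k) (c k))" for c
  define S where "S c x = (\<Sum>k<n. c k * U k x)" for c x
  have [measurable]: "S c \<in> borel_measurable M" for c unfolding S_def by measurable
  have S_uminus: "S (\<lambda>k. - c k) x = - S c x" for c x by (simp add: S_def sum_negf)
  have E: "(\<integral>x. w x *\<^sub>R iexp (S c x + t * U n x) \<partial>M) = m * \<psi> c * char (\<mu> n) t" for c t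
    using Suc.prems(4)[of "c(n := t)"] by (simp add: \<psi>_def S_def)
  have E0: "(\<integral>x. w x *\<^sub>R iexp (t * U n x) \<partial>M) = m * char (\<mu> n) t" for t
    using E[of "\<lambda>_. 0" t] \<mu>[THEN real_distribution.char_zero] by (simp add: S_def \<psi>_def)
  have E': "(\<integral>x. w x *\<^sub>R iexp (- S c x + t * U n x) \<partial>M) = m * \<psi> (\<lambda>k. - c k) * char (\<mu> n) t" for c t
    using E[of "\<lambda>k. - c k" t] by (simp add: S_uminus)
  have I0: "integrable M (\<lambda>x. w x *\<^sub>R iexp (t * U n x))" for t
    by (rule integrable_scaleR_iexp[OF _ _ abs_w]) auto
  have I: "integrable M (\<lambda>x. w x *\<^sub>R iexp (S c x + t * U n x))" for c t
    by (rule integrable_scaleR_iexp[OF _ _ abs_w]) auto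
  have I': "integrable M (\<lambda>x. w x *\<^sub>R iexp (- S c x + t * U n x))" for c t
    by (rule integrable_scaleR_iexp[OF _ _ abs_w]) auto
  have lin3: "(\<integral>x. f x + (\<alpha> * g x + \<beta> * h x) \<partial>M) = (\<integral>x. f x \<partial>M) + (\<alpha> * (\<integral>x. g x \<partial>M) + \<beta> * (\<integral>x. h x \<partial>M))"
    if "integrable M f" "integrable M g" "integrable M h" for f g h :: "'a \<Rightarrow> complex" and \<alpha> \<beta>
    using that by simp
  have L0: "complex_of_real (\<integral>x. w x * indicator (B n) (U n x) \<partial>M) = m * b"
    unfolding b_def using Suc.prems(2,3) by (intro weighted_law_unique[OF \<mu>, where C = 1] E0) auto
  \<comment> \<open>The weight \<open>1 + cos s\<close> is nonnegative, bounded, and a combination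
    of 1, \<open>iexp s\<close> and \<open>iexp (- s)\<close>. Its transform in the last variable is
    therefore a constant multiple of \<open>char (\<mu> n)\<close>, which is what the
    one-dimensional uniqueness statement asks for. The sine is treated alike.\<close>
  have Lcos: "complex_of_real (\<integral>x. w x * (1 + cos (S c x)) * indicator (B n) (U n x) \<partial>M)
      = m * (1 + (\<psi> c + \<psi> (\<lambda>k. - c k)) / 2) * b" for c
    unfolding b_def
  proof (rule weighted_law_unique[OF \<mu>, where C = 2])
    fix t
    have "(w x * (1 + cos (S c x))) *\<^sub>R iexp (t * U n x) = w x *\<^sub>R iexp (t * U n x)
        + ((1/2) * (w x *\<^sub>R iexp (S c x + t * U n x)) + (1/2) * (w x *\<^sub>R iexp (- S c x + t * U n x)))" for x
      by (simp add: complex_eq_iff Re_exp Im_exp cos_add sin_add cos_diff sin_diff algebra_simps add_divide_distrib diff_divide_distrib)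
    then have "(\<integral>x. (w x * (1 + cos (S c x))) *\<^sub>R iexp (t * U n x) \<partial>M)
      = m * char (\<mu> n) t + ((1/2) * (m * \<psi> c * char (\<mu> n) t) + (1/2) * (m * \<psi> (\<lambda>k. - c k) * char (\<mu> n) t))"
      by (simp only: lin3[OF I0[of t] I[of c t] I'[of c t]] E0 E E')
    then show "(\<integral>x. (w x * (1 + cos (S c x))) *\<^sub>R iexp (t * U n x) \<partial>M)
       = m * (1 + (\<psi> c + \<psi> (\<lambda>k. - c k)) / 2) * char (\<mu> n) t"
      by (simp add: field_simps)
  next
    fix x
    show "0 \<le> w x * (1 + cos (S c x))" using Suc.prems(2)[of x] cos_ge_minus_one[of "S c x"] by (intro mult_nonneg_nonneg) linarith+
    have "w x * (1 + cos (S c x)) \<le> 1 * 2" using Suc.prems(2,3)[of x] cos_ge_minus_one[of "S c x"] cos_le_one[of "S c x"] by (intro mult_mono) linarith+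
    then show "w x * (1 + cos (S c x)) \<le> 2" by simp
  qed auto
  have Lsin: "complex_of_real (\<integral>x. w x * (1 + sin (S c x)) * indicator (B n) (U n x) \<partial>M)
      = m * (1 + (\<psi> c - \<psi> (\<lambda>k. - c k)) / (2 * \<i>)) * b" for c
    unfolding b_def
  proof (rule weighted_law_unique[OF \<mu>, where C = 2])
    fix t
    have "(w x * (1 + sin (S c x))) *\<^sub>R iexp (t * U n x) = w x *\<^sub>R iexp (t * U n x)
        + ((1 / (2 * \<i>)) * (w x *\<^sub>R iexp (S c x + t * U n x)) + (- 1 / (2 * \<i>)) * (w x *\<^sub>R iexp (- S c x + t * U n x)))" for x
      by (simp add: complex_eq_iff Re_exp Im_exp cos_add sin_add cos_diff sin_diff Re_divide Im_divide power2_eq_square algebra_simps add_divide_distrib diff_divide_distrib)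
    then have "(\<integral>x. (w x * (1 + sin (S c x))) *\<^sub>R iexp (t * U n x) \<partial>M)
      = m * char (\<mu> n) t + ((1 / (2 * \<i>)) * (m * \<psi> c * char (\<mu> n) t) + (- 1 / (2 * \<i>)) * (m * \<psi> (\<lambda>k. - c k) * char (\<mu> n) t))"
      by (simp only: lin3[OF I0[of t] I[of c t] I'[of c t]] E0 E E')
    then show "(\<integral>x. (w x * (1 + sin (S c x))) *\<^sub>R iexp (t * U n x) \<partial>M)
       = m * (1 + (\<psi> c - \<psi> (\<lambda>k. - c k)) / (2 * \<i>)) * char (\<mu> n) t"
      by (simp add: field_simps)
  next
    fix x
    show "0 \<le> w x * (1 + sin (S c x))" using Suc.prems(2)[of x] sin_ge_minus_one[of "S c x"] by (intro mult_nonneg_nonneg) linarith+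
    have "w x * (1 + sin (S c x)) \<le> 1 * 2" using Suc.prems(2,3)[of x] sin_ge_minus_one[of "S c x"] sin_le_one[of "S c x"] by (intro mult_mono) linarith+
    then show "w x * (1 + sin (S c x)) \<le> 2" by simp
  qed auto
  \<comment> \<open>The event that the last coordinate lies in \<open>B n\<close> is absorbed into
    the weight, so the induction hypothesis applies with \<open>m * b\<close> in place of
    \<open>m\<close>.\<close>
  let ?w = "\<lambda>x. w x * indicator (B n) (U n x)"
  have "complex_of_real (\<integral>x. ?w x * (\<Prod>k<n. indicator (B k) (U k x)) \<partial>M)
      = (m * b) * (\<Prod>k<n. measure (\<mu> k) (B k))"
  proof (rule Suc.IH)
    fix c
    have wI: "integrable M ?w" by (rule integrable_const_bound[of _ 1]) (use abs_w in \<open>auto split: split_indicator\<close>)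
    have bd: "\<bar>?w x\<bar> \<le> 1" for x using abs_w[of x] by (auto split: split_indicator)
    have bd2: "\<bar>w x * cos (S c x) * indicator (B n) (U n x)\<bar> \<le> 1" "\<bar>w x * sin (S c x) * indicator (B n) (U n x)\<bar> \<le> 1" for x
      using mult_mono[OF abs_w[of x] abs_cos_le_one[of "S c x"]] mult_mono[OF abs_w[of x] abs_sin_le_one[of "S c x"]]
      by (auto simp: abs_mult split: split_indicator)
    have cI: "integrable M (\<lambda>x. w x * cos (S c x) * indicator (B n) (U n x))"
      by (rule integrable_const_bound[of _ 1]) (use bd2 in auto)
    have sI: "integrable M (\<lambda>x. w x * sin (S c x) * indicator (B n) (U n x))"
      by (rule integrable_const_bound[of _ 1]) (use bd2 in auto)
    have c: "complex_of_real (\<integral>x. w x * cos (S c x) * indicator (B n) (U n x) \<partial>M) = m * ((\<psi> c + \<psi> (\<lambda>k. - c k)) / 2) * b"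
    proof -
      have "(\<integral>x. w x * (1 + cos (S c x)) * indicator (B n) (U n x) \<partial>M)
        = (\<integral>x. ?w x \<partial>M) + (\<integral>x. w x * cos (S c x) * indicator (B n) (U n x) \<partial>M)"
        using wI cI by (simp add: distrib_left distrib_right)
      then show ?thesis using Lcos[of c] L0 by (simp add: algebra_simps)
    qed
    have s: "complex_of_real (\<integral>x. w x * sin (S c x) * indicator (B n) (U n x) \<partial>M) = m * ((\<psi> c - \<psi> (\<lambda>k. - c k)) / (2 * \<i>)) * b"
    proof -
      have "(\<integral>x. w x * (1 + sin (S c x)) * indicator (B n) (U n x) \<partial>M)
        = (\<integral>x. ?w x \<partial>M) + (\<integral>x. w x * sin (S c x) * indicator (B n) (U n x) \<partial>M)"
        using wI sI by (simp add: distrib_left distrib_right)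
      then show ?thesis using Lsin[of c] L0 by (simp add: algebra_simps)
    qed
    \<comment> \<open>In the combination of the cosine and sine integrals the terms with
      \<open>\<psi> (\<lambda>k. - c k)\<close> cancel and \<open>\<psi> c\<close> remains.\<close>
    have "?w x *\<^sub>R iexp (S c x) = complex_of_real (w x * cos (S c x) * indicator (B n) (U n x))
       + \<i> * complex_of_real (w x * sin (S c x) * indicator (B n) (U n x))" for x
      by (simp add: complex_eq_iff Re_exp Im_exp)
    then have "(\<integral>x. ?w x *\<^sub>R iexp (S c x) \<partial>M) =
       complex_of_real (\<integral>x. w x * cos (S c x) * indicator (B n) (U n x) \<partial>M)
       + \<i> * complex_of_real (\<integral>x. w x * sin (S c x) * indicator (B n) (U n x) \<partial>M)"
      using cI sI by (simp del: of_real_mult)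
    also have "\<dots> = m * b * \<psi> c" unfolding c s by (simp add: field_simps)
    finally show "(\<integral>x. ?w x *\<^sub>R iexp (\<Sum>k<n. c k * U k x) \<partial>M) = (m * b) * (\<Prod>k<n. char (\<mu> k) (c k))"
      by (simp add: S_def \<psi>_def)
  qed (use Suc.prems(2,3) in \<open>auto split: split_indicator\<close>)
  then show ?case by (simp add: b_def mult_ac)
qed

text \<open>A product measure is determined by its finite cylinders. The hypothesis speaks of
  initial segments of coordinates, so a cylinder over \<open>J\<close> is padded with full lines up
  to a bound \<open>n\<close> of \<open>J\<close>.\<close>

lemma char_product_imp_distr_PiM:
  fixes U :: "nat \<Rightarrow> 'a \<Rightarrow> real" and \<mu> :: "nat \<Rightarrow> real measure"
  assumes \<mu>: "\<And>k. real_distribution (\<mu> k)"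
    and U [measurable]: "\<And>k. U k \<in> borel_measurable M"
    and char_eq: "\<And>n c. (\<integral>x. iexp (\<Sum>k<n. c k * U k x) \<partial>M) = (\<Prod>k<n. char (\<mu> k) (c k))"
  shows "distr M seq_borel (\<lambda>x k. U k x) = (\<Pi>\<^sub>M k\<in>UNIV. \<mu> k)"
proof -
  interpret \<mu>: real_distribution "\<mu> k" for k by fact
  interpret P: product_prob_space \<mu> UNIV by unfold_locales
  have sets_eq: "sets seq_borel = sets (\<Pi>\<^sub>M k\<in>UNIV. \<mu> k)"
    by (intro sets_PiM_cong) auto
  have [measurable]: "(\<lambda>x k. U k x) \<in> measurable M seq_borel"
    by (rule measurable_PiM_single') auto
  show ?thesis
  proof (rule P.PiM_eq)
    show "sets (distr M seq_borel (\<lambda>x k. U k x)) = sets (\<Pi>\<^sub>M k\<in>UNIV. \<mu> k)"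
      using sets_eq by simp
    fix J F assume J: "finite J" "J \<subseteq> (UNIV::nat set)" and F: "\<And>j. j \<in> J \<Longrightarrow> F j \<in> sets (\<mu> j)"
    define B where "B k = (if k \<in> J then F k else UNIV)" for k
    have B [measurable]: "B k \<in> sets borel" for k using F by (auto simp: B_def)
    obtain n where n: "J \<subseteq> {..<n}" using J(1) finite_nat_iff_bounded by blast
    let ?E = "prod_emb UNIV \<mu> J (Pi\<^sub>E J F)"
    have "?E \<in> sets (\<Pi>\<^sub>M k\<in>UNIV. \<mu> k)" using J F by (intro sets_PiM_I) auto
    then have E: "?E \<in> sets seq_borel" by (simp only: sets_eq)
    have vim: "(\<lambda>x k. U k x) -` ?E \<inter> space M = {x\<in>space M. \<forall>k<n. U k x \<in> B k}"
      using n by (auto simp: prod_emb_def PiE_iff B_def split: if_splits) blast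
    have "emeasure (distr M seq_borel (\<lambda>x k. U k x)) ?E = emeasure M {x\<in>space M. \<forall>k<n. U k x \<in> B k}"
      using E by (subst emeasure_distr) (auto simp: vim)
    also have "\<dots> = ennreal (measure M {x\<in>space M. \<forall>k<n. U k x \<in> B k})"
      by (rule emeasure_eq_measure)
    also have "measure M {x\<in>space M. \<forall>k<n. U k x \<in> B k} = (\<integral>x. indicator {x\<in>space M. \<forall>k<n. U k x \<in> B k} x \<partial>M)"
      by (simp add: Int_absorb1 subsetI)
    also have "\<dots> = (\<integral>x. 1 * (\<Prod>k<n. indicator (B k) (U k x)) \<partial>M)"
    proof (rule Bochner_Integration.integral_cong)
      fix x assume "x \<in> space M"
      have "(\<Prod>k<n. indicator (B k) (U k x)) = (if \<forall>k<n. U k x \<in> B k then 1 else (0::real))"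
        by (induction n) (auto simp: less_Suc_eq split: split_indicator)
      then show "indicator {x\<in>space M. \<forall>k<n. U k x \<in> B k} x = (1::real) * (\<Prod>k<n. indicator (B k) (U k x))"
        using \<open>x \<in> space M\<close> by simp
    qed simp
    also have "\<dots> = (\<Prod>k<n. measure (\<mu> k) (B k))"
    proof -
      have "complex_of_real (\<integral>x. 1 * (\<Prod>k<n. indicator (B k) (U k x)) \<partial>M) = 1 * complex_of_real (\<Prod>k<n. measure (\<mu> k) (B k))"
        using char_product_imp_rectangles[OF \<mu> U B, where w = "\<lambda>_. 1" and n = n and m = 1] char_eq by simp
      then show ?thesis by (simp only: mult_1 of_real_eq_iff)
    qed
    also have "\<dots> = (\<Prod>k\<in>J. measure (\<mu> k) (F k))"
      using n by (intro prod.mono_neutral_cong_right) (auto simp: B_def \<mu>.prob_space[simplified])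
    also have "ennreal \<dots> = (\<Prod>k\<in>J. emeasure (\<mu> k) (F k))"
      by (simp add: \<mu>.emeasure_eq_measure prod_ennreal)
    finally show "emeasure (distr M seq_borel (\<lambda>x k. U k x)) ?E = (\<Prod>k\<in>J. emeasure (\<mu> k) (F k))" .
  qed
qed

end

subsection \<open>Lebesgue measure on the circle\<close>

lemma space_circle_borel [simp]: "space circle_borel = sphere 0 1"
  by (simp add: circle_borel_def space_restrict_space)

lemma measurable_circleI:
  assumes "sets N = sets circle_borel" "f \<in> borel_measurable borel"
  shows "f \<in> borel_measurable N"
  using measurable_restrict_space1[OF assms(2), of "sphere 0 1"]
  by (subst measurable_cong_sets[OF assms(1) refl]) (simp add: circle_borel_def)

lemma space_circle:
  assumes "sets N = sets circle_borel" shows "space N = sphere 0 1"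
  using sets_eq_imp_space_eq[OF assms] by simp

lemma sets_circle_lebesgue [simp, measurable_cong]: "sets circle_lebesgue = sets circle_borel"
  by (simp add: circle_lebesgue_def)

lemma space_circle_lebesgue [simp]: "space circle_lebesgue = sphere 0 1"
  by (simp add: circle_lebesgue_def)

lemma measurable_cis [measurable]: "cis \<in> measurable borel circle_borel"
proof -
  have "cis \<in> borel_measurable borel"
    by (intro borel_measurable_continuous_onI continuous_intros)
  then show ?thesis unfolding circle_borel_def
    by (intro measurable_restrict_space2) (auto simp: dist_norm)
qed

interpretation circle: prob_space circle_lebesgue
  unfolding circle_lebesgue_def
  by (intro prob_space.prob_space_distr prob_space_uniform_measure) (auto simp: ennreal_eq_0_iff not_le)

lemma uniform_arc_density:
  "uniform_measure lborel {0..<2 * pi} = density lborel (\<lambda>t. ennreal (indicator {0..<2 * pi} t / (2 * pi)))"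
  unfolding uniform_measure_def
  by (intro density_cong) (auto simp: divide_ennreal[symmetric] ennreal_indicator split: split_indicator)

text \<open>The closed interval is the form that the fundamental theorem of calculus uses below; its
  right endpoint is a null set.\<close>

lemma integral_circle_lebesgue:
  fixes g :: "complex \<Rightarrow> 'b::{banach, second_countable_topology}"
  assumes [measurable]: "g \<in> borel_measurable circle_borel"
  shows "(\<integral>z. g z \<partial>circle_lebesgue) = (\<integral>t. (indicator {0..2 * pi} t / (2 * pi)) *\<^sub>R g (cis t) \<partial>lborel)"
proof -
  have "(\<integral>z. g z \<partial>circle_lebesgue) = (\<integral>t. (indicator {0..<2 * pi} t / (2 * pi)) *\<^sub>R g (cis t) \<partial>lborel)"
    unfolding circle_lebesgue_def
    by (subst integral_distr) (auto simp: uniform_arc_density integral_density)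
  also have "\<dots> = (\<integral>t. (indicator {0..2 * pi} t / (2 * pi)) *\<^sub>R g (cis t) \<partial>lborel)"
  proof (rule integral_cong_AE)
    show "AE t in lborel. (indicator {0..<2 * pi} t / (2 * pi)) *\<^sub>R g (cis t) = (indicator {0..2 * pi} t / (2 * pi)) *\<^sub>R g (cis t)"
      using AE_lborel_singleton[of "2 * pi"] by eventually_elim (auto split: split_indicator)
  qed measurable
  finally show ?thesis .
qed

lemma circle_integrableI:
  fixes g :: "complex \<Rightarrow> 'b::{banach, second_countable_topology}"
  assumes N: "finite_measure N" "sets N = sets circle_borel" and cont: "continuous_on (sphere 0 1) g"
  shows "integrable N g"
proof -
  interpret finite_measure N by fact
  have "compact (g ` sphere 0 1)" by (intro compact_continuous_image cont compact_sphere)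
  then obtain B where B: "\<And>z. z \<in> sphere 0 1 \<Longrightarrow> norm (g z) \<le> B"
    by (meson bounded_iff compact_imp_bounded imageI)
  have "g \<in> borel_measurable circle_borel"
    unfolding circle_borel_def by (intro borel_measurable_continuous_on_restrict cont)
  then have "g \<in> borel_measurable N" by (subst measurable_cong_sets[OF N(2) refl])
  then show ?thesis
    by (intro integrable_const_bound[of _ B]) (use B space_circle[OF N(2)] in auto)
qed

lemmas circle_lebesgue_integrableI =
  circle_integrableI[OF circle.finite_measure_axioms sets_circle_lebesgue]

lemma integral_circle_power:
  assumes "k > 0"
  shows "(\<integral>z. z ^ k \<partial>circle_lebesgue) = 0"
proof -
  let ?F = "\<lambda>t. cis (real k * t) / (\<i> * of_nat k)"
  have "(\<integral>z. z ^ k \<partial>circle_lebesgue) = (\<integral>t. (indicator {0..2 * pi} t / (2 * pi)) *\<^sub>R cis t ^ k \<partial>lborel)"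
    by (rule integral_circle_lebesgue) (rule measurable_circleI, simp, measurable)
  also have "\<dots> = (1 / (2 * pi)) *\<^sub>R (\<integral>t. indicator {0..2 * pi} t *\<^sub>R cis (real k * t) \<partial>lborel)"
    by (subst integral_scaleR_right[symmetric]) (simp_all add: Complex.DeMoivre)
  also have "(\<integral>t. indicator {0..2 * pi} t *\<^sub>R cis (real k * t) \<partial>lborel) = ?F (2 * pi) - ?F 0"
  proof (rule integral_FTC_Icc)
    fix t
    have "((\<lambda>t. cis (real k * t)) has_vector_derivative (real k *\<^sub>R (\<i> * cis (real k * t)))) (at t within {0..2 * pi})"
      by (auto intro!: derivative_eq_intros simp: has_vector_derivative_complex_iff)
    from has_vector_derivative_divide[OF this, of "\<i> * of_nat k"]
    show "(?F has_vector_derivative cis (real k * t)) (at t within {0..2 * pi})"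
      using assms by (simp add: scaleR_conv_of_real)
  qed (auto intro!: continuous_intros)
  also have "?F (2 * pi) - ?F 0 = 0"
    using Complex.DeMoivre[of "2 * pi" k] by (simp add: cis_2pi mult.commute[of pi 2])
  finally show ?thesis by simp
qed

subsection \<open>Uniqueness of Fourier coefficients\<close>

text \<open>Negative frequencies are written with \<open>cnj z\<close>, which is the inverse of
  \<open>z\<close> on the circle. In this form the class is closed under multiplication by
  \<open>z\<close> and by \<open>cnj z\<close>, hence by all polynomials that the Stone-Weierstrass
  theorem supplies.\<close>

definition fourier_null :: "(complex \<Rightarrow> complex) \<Rightarrow> bool" where
  "fourier_null g \<longleftrightarrow> integrable circle_lebesgue g \<and>
     (\<forall>k. (\<integral>z. z ^ k * g z \<partial>circle_lebesgue) = 0) \<and> (\<forall>k. (\<integral>z. cnj z ^ k * g z \<partial>circle_lebesgue) = 0)"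

lemma fourier_nullD:
  assumes "fourier_null g"
  shows "integrable circle_lebesgue g"
    and "(\<integral>z. z ^ k * g z \<partial>circle_lebesgue) = 0"
    and "(\<integral>z. cnj z ^ k * g z \<partial>circle_lebesgue) = 0"
  using assms by (auto simp: fourier_null_def)

lemma continuous_borel_measurable_circle:
  "continuous_on UNIV f \<Longrightarrow> f \<in> borel_measurable circle_lebesgue"
  by (rule measurable_circleI[OF sets_circle_lebesgue borel_measurable_continuous_onI])

lemma integrable_circle_bounded_mult:
  fixes u g :: "complex \<Rightarrow> complex"
  assumes "integrable circle_lebesgue g" "u \<in> borel_measurable circle_lebesgue"
    and "\<And>z. z \<in> sphere 0 1 \<Longrightarrow> norm (u z) \<le> B"
  shows "integrable circle_lebesgue (\<lambda>z. u z * g z)"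
proof -
  have "integrable circle_lebesgue (\<lambda>z. B * norm (g z))" using assms by simp
  then show ?thesis
  proof (rule Bochner_Integration.integrable_bound)
    show "AE z in circle_lebesgue. norm (u z * g z) \<le> norm (B * norm (g z))"
    proof (intro AE_I2)
      fix z assume "z \<in> space circle_lebesgue"
      then have "norm (u z) \<le> B" using assms(3) by simp
      then show "norm (u z * g z) \<le> norm (B * norm (g z))"
        using norm_ge_zero[of "u z"] by (simp add: norm_mult abs_mult mult_right_mono)
    qed
  qed (use assms in measurable)
qed

lemma integrable_circle_power_mult:
  fixes g :: "complex \<Rightarrow> complex"
  assumes "integrable circle_lebesgue g"
  shows "integrable circle_lebesgue (\<lambda>z. z ^ k * g z)" "integrable circle_lebesgue (\<lambda>z. cnj z ^ k * g z)"
  by (rule integrable_circle_bounded_mult[OF assms continuous_borel_measurable_circle, where B = 1];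
      simp add: norm_power continuous_on_power continuous_on_id continuous_on_cnj)+

lemma fourier_null_add:
  assumes g: "fourier_null g" and h: "fourier_null h" shows "fourier_null (\<lambda>z. g z + h z)"
proof -
  have "integrable circle_lebesgue g" "integrable circle_lebesgue h" using g h by (auto simp: fourier_null_def)
  note I = integrable_circle_power_mult[OF this(1)] integrable_circle_power_mult[OF this(2)] this
  show ?thesis
    unfolding fourier_null_def distrib_left
    using g h I by (simp add: fourier_null_def)
qed

lemma fourier_null_cmult:
  assumes "fourier_null g" shows "fourier_null (\<lambda>z. c * g z)"
proof -
  have *: "w * (c * g z) = c * (w * g z)" for w z by (rule mult.left_commute)
  show ?thesis using assms unfolding fourier_null_def * by simp
qed

lemma circle_mult_cnj: "z \<in> sphere 0 1 \<Longrightarrow> z * cnj z = 1" "z \<in> sphere 0 1 \<Longrightarrow> cnj z * z = 1"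
  using complex_norm_square[of z] by (simp_all add: mult.commute[of "cnj z"])

lemma fourier_null_mult_id:
  assumes g: "fourier_null g" shows "fourier_null (\<lambda>z. z * g z)"
proof -
  have "(\<integral>z. cnj z ^ k * (z * g z) \<partial>circle_lebesgue) = 0" for k
  proof (cases k)
    case 0
    then show ?thesis using fourier_nullD(2)[OF g, of 1] by simp
  next
    case (Suc j)
    have "(\<integral>z. cnj z ^ k * (z * g z) \<partial>circle_lebesgue) = (\<integral>z. cnj z ^ j * g z \<partial>circle_lebesgue)"
    proof (rule Bochner_Integration.integral_cong)
      fix z assume "z \<in> space circle_lebesgue"
      then have "cnj z * z = 1" using circle_mult_cnj by simp
      then show "cnj z ^ k * (z * g z) = cnj z ^ j * g z" using Suc by (simp add: algebra_simps)
    qed simp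
    then show ?thesis using g by (simp add: fourier_null_def)
  qed
  moreover have "(\<integral>z. z ^ k * (z * g z) \<partial>circle_lebesgue) = 0" for k
    using fourier_nullD(2)[OF g, of "Suc k"] by (simp add: mult_ac)
  ultimately show ?thesis
    using integrable_circle_power_mult[of g 1] fourier_nullD(1)[OF g] by (simp add: fourier_null_def)
qed

lemma fourier_null_mult_cnj:
  assumes g: "fourier_null g" shows "fourier_null (\<lambda>z. cnj z * g z)"
proof -
  have "(\<integral>z. z ^ k * (cnj z * g z) \<partial>circle_lebesgue) = 0" for k
  proof (cases k)
    case 0
    then show ?thesis using fourier_nullD(3)[OF g, of 1] by simp
  next
    case (Suc j)
    have "(\<integral>z. z ^ k * (cnj z * g z) \<partial>circle_lebesgue) = (\<integral>z. z ^ j * g z \<partial>circle_lebesgue)"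
    proof (rule Bochner_Integration.integral_cong)
      fix z assume "z \<in> space circle_lebesgue"
      then have "cnj z * z = 1" using circle_mult_cnj by simp
      then show "z ^ k * (cnj z * g z) = z ^ j * g z" using Suc by (simp add: algebra_simps)
    qed simp
    then show ?thesis using g by (simp add: fourier_null_def)
  qed
  moreover have "(\<integral>z. cnj z ^ k * (cnj z * g z) \<partial>circle_lebesgue) = 0" for k
    using fourier_nullD(3)[OF g, of "Suc k"] by (simp add: mult_ac)
  ultimately show ?thesis
    using integrable_circle_power_mult[of g 1] fourier_nullD(1)[OF g] by (simp add: fourier_null_def)
qed

text \<open>A real-linear form on the plane is a complex combination of \<open>z\<close> and
  \<open>cnj z\<close>, and multiplication by either only shifts the Fourier coefficients. Sums and
  products follow the generation of the polynomial functions.\<close>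

lemma fourier_null_mult_real_polynomial:
  assumes "real_polynomial_function u" "fourier_null g"
  shows "fourier_null (\<lambda>z. complex_of_real (u z) * g z)"
  using assms
proof (induction arbitrary: g)
  case (linear f)
  interpret f: bounded_linear f by fact
  have f: "f z = f 1 * Re z + f \<i> * Im z" for z
  proof -
    have "z = Re z *\<^sub>R 1 + Im z *\<^sub>R \<i>" by (simp add: complex_eq_iff)
    then have "f z = f (Re z *\<^sub>R 1 + Im z *\<^sub>R \<i>)" by (rule arg_cong)
    also have "\<dots> = f 1 * Re z + f \<i> * Im z" by (simp only: f.add f.scaleR) simp
    finally show ?thesis .
  qed
  let ?a = "(f 1 - \<i> * f \<i>) / 2" and ?b = "(f 1 + \<i> * f \<i>) / 2"
  have eq: "complex_of_real (f z) * g z = ?a * (z * g z) + ?b * (cnj z * g z)" for z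
  proof -
    have "complex_of_real (f z) = ?a * z + ?b * cnj z"
      unfolding f[of z] by (simp add: complex_eq_iff diff_divide_distrib add_divide_distrib)
    then show ?thesis by (simp only: distrib_right mult.assoc)
  qed
  have "fourier_null (\<lambda>z. ?a * (z * g z) + ?b * (cnj z * g z))"
    by (intro fourier_null_add fourier_null_cmult fourier_null_mult_id[OF linear(2)] fourier_null_mult_cnj[OF linear(2)])
  then show ?case unfolding eq .
next
  case (add f h)
  then show ?case using fourier_null_add[OF add.IH(1) add.IH(2)] by (simp add: distrib_right)
next
  case (mult f h)
  then show ?case using mult.IH(1)[OF mult.IH(2)] by (simp add: mult_ac)
qed (auto intro: fourier_null_cmult)

text \<open>Uniform approximation of \<open>u\<close> within \<open>e\<close> on the circle changes
  the integral by at most \<open>e\<close> times the integral of \<open>norm (g z)\<close>, and for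
  the approximating polynomial the integral vanishes.\<close>

lemma fourier_null_continuous_integral:
  assumes g: "fourier_null g" and u: "continuous_on UNIV u"
  shows "(\<integral>z. complex_of_real (u z) * g z \<partial>circle_lebesgue) = 0"
proof -
  let ?I = "\<lambda>u. \<integral>z. complex_of_real (u z) * g z \<partial>circle_lebesgue"
  have int: "integrable circle_lebesgue g" using g by (simp add: fourier_null_def)
  define C where "C = (\<integral>z. norm (g z) \<partial>circle_lebesgue)"
  have "0 \<le> C" by (simp add: C_def)
  have "norm (?I u) \<le> e * C" if "e > 0" for e
  proof -
    obtain v where v: "real_polynomial_function v" "\<And>z. z \<in> sphere 0 1 \<Longrightarrow> \<bar>u z - v z\<bar> < e"
      by (rule Stone_Weierstrass_real_polynomial_function[OF compact_sphere continuous_on_subset[OF u subset_UNIV] \<open>e > 0\<close>]) blast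
    have gv: "fourier_null (\<lambda>z. complex_of_real (v z) * g z)"
      by (rule fourier_null_mult_real_polynomial[OF v(1) g])
    have v0: "?I v = 0" and vI: "integrable circle_lebesgue (\<lambda>z. complex_of_real (v z) * g z)"
      using fourier_nullD(2)[OF gv, of 0] gv
      by (auto simp: fourier_null_def)
    have uI: "integrable circle_lebesgue (\<lambda>z. complex_of_real (u z) * g z)"
    proof -
      have "compact (u ` sphere 0 1)"
        by (intro compact_continuous_image compact_sphere continuous_on_subset[OF u]) auto
      then obtain B where B: "\<And>z. z \<in> sphere 0 1 \<Longrightarrow> norm (u z) \<le> B"
        by (meson bounded_iff compact_imp_bounded imageI)
      show ?thesis
        by (rule integrable_circle_bounded_mult[OF int, where B = B])
           (use B u in \<open>auto intro!: continuous_borel_measurable_circle continuous_intros\<close>)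
    qed
    have "norm (?I u) = norm (?I u - ?I v)" by (simp add: v0)
    also have "?I u - ?I v = (\<integral>z. complex_of_real (u z) * g z - complex_of_real (v z) * g z \<partial>circle_lebesgue)"
      using uI vI by simp
    also have "norm \<dots> \<le> (\<integral>z. norm (complex_of_real (u z) * g z - complex_of_real (v z) * g z) \<partial>circle_lebesgue)"
      by (rule integral_norm_bound)
    also have "\<dots> \<le> (\<integral>z. e * norm (g z) \<partial>circle_lebesgue)"
    proof (rule integral_mono)
      fix z assume "z \<in> space circle_lebesgue"
      then have "\<bar>u z - v z\<bar> \<le> e" using v(2)[of z] by simp
      then show "norm (complex_of_real (u z) * g z - complex_of_real (v z) * g z) \<le> e * norm (g z)"
        by (simp flip: left_diff_distrib of_real_diff add: norm_mult mult_right_mono)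
    qed (use uI vI int in auto)
    also have "\<dots> = e * C" by (simp add: C_def)
    finally show ?thesis .
  qed
  then have le: "norm (?I u) \<le> e * C" if "e > 0" for e using that by blast
  have "norm (?I u) \<le> 0"
  proof (rule field_le_epsilon)
    fix e :: real assume "e > 0"
    \<comment> \<open>Dividing by \<open>C + 1\<close> covers the case \<open>C = 0\<close>.\<close>
    have "norm (?I u) \<le> e / (C + 1) * C" using \<open>0 \<le> C\<close> \<open>e > 0\<close> by (intro le) simp
    also have "\<dots> \<le> e" using \<open>0 \<le> C\<close> \<open>e > 0\<close> by (simp add: field_simps)
    finally show "norm (?I u) \<le> 0 + e" by simp
  qed
  then show ?thesis by simp
qed

text \<open>The indicator of a closed set is the pointwise limit of the continuous cutoffs
  \<open>max 0 (1 - n * infdist z C)\<close>, all dominated by 1.\<close>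

lemma fourier_null_closed_integral:
  assumes g: "fourier_null g" and C: "closed C"
  shows "(\<integral>z. indicator C z * g z \<partial>circle_lebesgue) = 0"
proof (cases "C = {}")
  case False
  have int [measurable]: "integrable circle_lebesgue g" using g by (simp add: fourier_null_def)
  define u where "u n z = max 0 (1 - real n * infdist z C)" for n z
  have cont: "continuous_on UNIV (u n)" for n unfolding u_def by (intro continuous_intros)
  have "(\<lambda>n. \<integral>z. complex_of_real (u n z) * g z \<partial>circle_lebesgue) \<longlonglongrightarrow> (\<integral>z. indicator C z * g z \<partial>circle_lebesgue)"
  proof (rule integral_dominated_convergence[where w = "\<lambda>z. norm (g z)"])
    show "AE z in circle_lebesgue. (\<lambda>n. complex_of_real (u n z) * g z) \<longlonglongrightarrow> indicator C z * g z"
    proof (intro AE_I2 tendsto_mult tendsto_const)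
      fix z
      show "(\<lambda>n. complex_of_real (u n z)) \<longlonglongrightarrow> indicator C z"
      proof (cases "z \<in> C")
        case True
        then show ?thesis by (simp add: u_def)
      next
        case False
        then have pos: "infdist z C > 0"
          using C \<open>C \<noteq> {}\<close> in_closed_iff_infdist_zero infdist_nonneg by (metis less_eq_real_def)
        have "\<forall>\<^sub>F n in sequentially. u n z = 0"
          using eventually_ge_at_top[of "nat \<lceil>1 / infdist z C\<rceil>"]
        proof eventually_elim
          case (elim n)
          then have "1 / infdist z C \<le> real n" by linarith
          then show ?case using pos by (simp add: u_def field_simps)
        qed
        then have "(\<lambda>n. complex_of_real (u n z)) \<longlonglongrightarrow> 0"
          by (intro tendsto_eventually) (auto elim: eventually_mono)
        then show ?thesis using False by simp
      qed
    qed
    show "AE z in circle_lebesgue. norm (complex_of_real (u n z) * g z) \<le> norm (g z)" for n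
      by (intro AE_I2) (auto simp: norm_mult u_def infdist_nonneg intro!: mult_left_le_one_le)
    show "(\<lambda>z. complex_of_real (u n z) * g z) \<in> borel_measurable circle_lebesgue" for n
      using continuous_borel_measurable_circle[OF cont[of n]] int by measurable
    show "(\<lambda>z. indicator C z * g z) \<in> borel_measurable circle_lebesgue"
    proof -
      have "indicator C \<in> borel_measurable circle_lebesgue"
        by (rule measurable_circleI) (use C in auto)
      then show ?thesis using int by measurable
    qed
  qed (use int in auto)
  then show ?thesis
    unfolding fourier_null_continuous_integral[OF g cont] by (simp add: LIMSEQ_const_iff)
qed simp

text \<open>The sets over which \<open>g\<close> integrates to 0 contain the closed sets and are
  stable under complements and countable disjoint unions, so Dynkin's argument reaches every Borel
  set, and a function with vanishing integral over every measurable set is null.\<close>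

lemma fourier_null_AE_zero:
  assumes g: "fourier_null g"
  shows "AE z in circle_lebesgue. g z = 0"
proof (rule circle.density_zero)
  show int [measurable]: "integrable circle_lebesgue g" using g by (simp add: fourier_null_def)
  let ?I = "\<lambda>A. \<integral>z. indicator A z * g z \<partial>circle_lebesgue"
  have ind [measurable]: "indicator A \<in> borel_measurable circle_lebesgue" if "A \<in> sets borel" for A :: "complex set"
    by (rule measurable_circleI) (use that in auto)
  have indI: "integrable circle_lebesgue (\<lambda>z. indicator A z * g z)" if "A \<in> sets borel" for A :: "complex set"
    by (rule integrable_circle_bounded_mult[OF int, where B = 1]) (use ind[OF that] in \<open>auto split: split_indicator\<close>)
  have borel: "sets (borel :: complex measure) = sigma_sets UNIV (Collect closed)"
    by (simp add: borel_eq_closed)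
  have "Int_stable (Collect closed :: complex set set)" "Collect closed \<subseteq> Pow (UNIV :: complex set)"
    by (auto simp: Int_stable_def)
  then have "?I A = 0" if "A \<in> sigma_sets UNIV (Collect closed)" for A :: "complex set"
    using that
  proof (induction rule: sigma_sets_induct_disjoint)
    case (basic A)
    then show ?case using fourier_null_closed_integral[OF g] by simp
  next
    case (compl A)
    then have A: "A \<in> sets borel" using borel by simp
    have "indicator (UNIV - A) z * g z = g z - indicator A z * g z" for z
      by (simp split: split_indicator)
    then have "?I (UNIV - A) = (\<integral>z. g z \<partial>circle_lebesgue) - ?I A"
      using int indI[OF A] by simp
    then show ?case
      using compl fourier_nullD(2)[OF g, of 0] by simp
  next
    case (union A)
    then have A: "A i \<in> sets borel" for i using borel by auto
    have "(\<lambda>i. ?I (A i)) sums ?I (\<Union>i. A i)"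
    proof -
      have "(\<lambda>n. \<integral>z. indicator (\<Union>i<n. A i) z * g z \<partial>circle_lebesgue) \<longlonglongrightarrow> ?I (\<Union>i. A i)"
      proof (rule integral_dominated_convergence[where w = "\<lambda>z. norm (g z)"])
        show "AE z in circle_lebesgue. (\<lambda>n. indicator (\<Union>i<n. A i) z * g z) \<longlonglongrightarrow> indicator (\<Union>i. A i) z * g z"
          by (intro AE_I2 tendsto_mult tendsto_const LIMSEQ_indicator_UN)
        show "(\<lambda>z. indicator (\<Union>i. A i) z * g z) \<in> borel_measurable circle_lebesgue"
          using A by (intro borel_measurable_times ind borel_measurable_integrable[OF int]) auto
        show "(\<lambda>z. indicator (\<Union>i<n. A i) z * g z) \<in> borel_measurable circle_lebesgue" for n
          using A by (intro borel_measurable_times ind borel_measurable_integrable[OF int]) auto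
      qed (use int in \<open>auto split: split_indicator\<close>)
      moreover have "(\<integral>z. indicator (\<Union>i<n. A i) z * g z \<partial>circle_lebesgue) = (\<Sum>i<n. ?I (A i))" for n
      proof -
        have "indicator (\<Union>i<n. A i) z * g z = (\<Sum>i<n. indicator (A i) z * g z)" for z
          using \<open>disjoint_family A\<close>
          by (subst indicator_UN_disjoint) (auto simp: sum_distrib_right disjoint_family_on_def)
        then show ?thesis by (simp only:) (rule Bochner_Integration.integral_sum, rule indI[OF A])
      qed
      ultimately show ?thesis by (simp add: sums_def)
    qed
    then have "(\<lambda>i. 0) sums ?I (\<Union>i. A i)" using union.IH by simp
    then show ?case using sums_unique2 sums_zero by blast
  qed simp
  then have borel0: "?I A = 0" if "A \<in> sets borel" for A :: "complex set" using that borel by simp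
  fix A assume "A \<in> sets circle_lebesgue"
  then obtain A' where A': "A' \<in> sets borel" "A = sphere 0 1 \<inter> A'"
    by (auto simp: circle_borel_def sets_restrict_space)
  have "set_lebesgue_integral circle_lebesgue A g = ?I A'"
    unfolding set_lebesgue_integral_def
    by (intro Bochner_Integration.integral_cong) (auto simp: A' split: split_indicator)
  then show "set_lebesgue_integral circle_lebesgue A g = 0" using borel0[OF A'(1)] by simp
qed

subsection \<open>Jensen's inequality for polynomials\<close>

text \<open>For \<open>norm w < 1\<close> the power series of \<open>ln (1 - w * z)\<close> is
  dominated on the circle by a geometric series. It has no constant term and positive powers of
  \<open>z\<close> have mean 0; the claim is the real part.\<close>

lemma integral_circle_ln_one_minus:
  assumes "norm w < 1"
  shows "(\<integral>z. ln (norm (1 - w * z)) \<partial>circle_lebesgue) = 0"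
proof -
  let ?f = "\<lambda>n z. (w * z) ^ n / of_nat n"
  have sums: "(\<lambda>n. - ?f n z) sums ln (1 - w * z)" if "z \<in> sphere 0 1" for z
    using Ln_series'[of "- (w * z)"] assms that by (simp add: norm_mult)
  have int: "integrable circle_lebesgue (\<lambda>z. - ?f n z)" for n
    by (rule circle_lebesgue_integrableI) (cases "n = 0"; auto intro!: continuous_intros)
  have summ: "summable (\<lambda>n. norm w ^ n)" using assms by (simp add: summable_geometric)
  have nle: "norm (- ?f n z) \<le> norm w ^ n" if "z \<in> sphere 0 1" for n z
  proof (cases n)
    case (Suc m)
    have "norm w ^ n / real n \<le> norm w ^ n / 1" using Suc by (intro divide_left_mono) auto
    then show ?thesis using that by (simp add: norm_divide norm_power norm_mult)
  qed simp
  have zero: "(\<integral>z. - ?f n z \<partial>circle_lebesgue) = 0" for n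
  proof (cases "n = 0")
    case False
    have "(\<integral>z. - ?f n z \<partial>circle_lebesgue) = - (w ^ n / of_nat n) * (\<integral>z. z ^ n \<partial>circle_lebesgue)"
      by (subst integral_mult_right_zero[symmetric]) (simp add: power_mult_distrib)
    then show ?thesis using integral_circle_power False by simp
  qed simp
  have "(\<integral>z. ln (1 - w * z) \<partial>circle_lebesgue) = (\<integral>z. (\<Sum>n. - ?f n z) \<partial>circle_lebesgue)"
    by (intro Bochner_Integration.integral_cong sums_unique[OF sums]) auto
  also have "\<dots> = (\<Sum>n. \<integral>z. - ?f n z \<partial>circle_lebesgue)"
  proof (rule integral_suminf[OF int])
    show "AE z in circle_lebesgue. summable (\<lambda>n. norm (- ?f n z))"
      by (intro AE_I2 summable_comparison_test[OF _ summ]) (use nle in auto)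
    show "summable (\<lambda>n. \<integral>z. norm (- ?f n z) \<partial>circle_lebesgue)"
    proof (rule summable_comparison_test[OF _ summ], intro exI[of _ 0] allI impI)
      fix n :: nat
      have "(\<integral>z. norm (- ?f n z) \<partial>circle_lebesgue) \<le> (\<integral>z. norm w ^ n \<partial>circle_lebesgue)"
        by (intro integral_mono integrable_norm int) (use nle in auto)
      then show "norm (\<integral>z. norm (- ?f n z) \<partial>circle_lebesgue) \<le> norm w ^ n"
        using circle.prob_space by simp
    qed
  qed
  also have "\<dots> = 0" by (simp only: zero suminf_zero)
  finally have 0: "(\<integral>z. ln (1 - w * z) \<partial>circle_lebesgue) = 0" by simp
  \<comment> \<open>The values \<open>1 - w * z\<close> avoid the branch cut, so the principal
    logarithm is continuous along them.\<close>
  have nz: "1 - w * z \<notin> \<real>\<^sub>\<le>\<^sub>0" if "z \<in> sphere 0 1" for z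
  proof
    assume "1 - w * z \<in> \<real>\<^sub>\<le>\<^sub>0"
    then have "Re (w * z) \<ge> 1" by (auto simp: complex_nonpos_Reals_iff)
    moreover have "Re (w * z) \<le> norm (w * z)" by (rule complex_Re_le_cmod)
    ultimately show False using assms that by (simp add: norm_mult)
  qed
  have intLn: "integrable circle_lebesgue (\<lambda>z. ln (1 - w * z))"
    by (rule circle_lebesgue_integrableI) (use nz in \<open>auto intro!: continuous_intros\<close>)
  have "(\<integral>z. ln (norm (1 - w * z)) \<partial>circle_lebesgue) = (\<integral>z. Re (ln (1 - w * z)) \<partial>circle_lebesgue)"
  proof (intro Bochner_Integration.integral_cong refl)
    fix z assume "z \<in> space circle_lebesgue"
    then have "1 - w * z \<noteq> 0" using nz[of z] by auto
    then show "ln (norm (1 - w * z)) = Re (ln (1 - w * z))" by simp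
  qed
  also have "\<dots> = Re (\<integral>z. ln (1 - w * z) \<partial>circle_lebesgue)" using intLn by (rule integral_Re)
  finally show ?thesis using 0 by simp
qed

text \<open>For \<open>norm a < 1\<close> reflection in the circle gives
  \<open>norm (z - a) = norm (1 - cnj a * z)\<close>, so the integral is 0 while
  \<open>ln (norm a)\<close> is negative. For \<open>norm a > 1\<close> the factor \<open>a\<close>
  can be pulled out and both sides agree.\<close>

lemma integral_circle_ln_linear:
  assumes "norm a \<noteq> 1" "a \<noteq> 0"
  shows "ln (norm a) \<le> (\<integral>z. ln (norm (z - a)) \<partial>circle_lebesgue)"
proof (cases "norm a < 1")
  case True
  have "norm (z - a) = norm (1 - cnj a * z)" if "z \<in> sphere 0 1" for z
  proof -
    have "norm (1 - cnj a * z) = norm (cnj (1 - cnj a * z))" by (simp only: complex_mod_cnj)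
    also have "\<dots> = norm z * norm (1 - a * cnj z)" using that by simp
    also have "\<dots> = norm (z * (1 - a * cnj z))" by (simp only: norm_mult)
    also have "z * (1 - a * cnj z) = z - a * (z * cnj z)" by (simp add: algebra_simps)
    also have "\<dots> = z - a" using circle_mult_cnj[OF that] by simp
    finally show ?thesis by simp
  qed
  then have "(\<integral>z. ln (norm (z - a)) \<partial>circle_lebesgue) = (\<integral>z. ln (norm (1 - cnj a * z)) \<partial>circle_lebesgue)"
    by (intro Bochner_Integration.integral_cong) auto
  then show ?thesis using integral_circle_ln_one_minus[of "cnj a"] True assms by simp
next
  case False
  then have a: "norm a > 1" using assms by simp
  then have w: "norm (1 / a) < 1" using assms by (simp add: norm_divide field_simps)
  have ne: "1 - 1 / a * z \<noteq> 0" if "z \<in> sphere 0 1" for z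
  proof
    assume "1 - 1 / a * z = 0"
    then have "norm (1 / a * z) = 1" by simp
    then show False using w that by (simp add: norm_mult norm_divide)
  qed
  have "(\<integral>z. ln (norm (z - a)) \<partial>circle_lebesgue) = (\<integral>z. ln (norm a) + ln (norm (1 - 1 / a * z)) \<partial>circle_lebesgue)"
  proof (intro Bochner_Integration.integral_cong refl)
    fix z assume z: "z \<in> space circle_lebesgue"
    have "norm (z - a) = norm (a * (1 - 1 / a * z))"
      using assms by (simp add: algebra_simps norm_minus_commute)
    then show "ln (norm (z - a)) = ln (norm a) + ln (norm (1 - 1 / a * z))"
      using ne[of z] z assms by (simp add: norm_mult ln_mult)
  qed
  also have "\<dots> = ln (norm a) + (\<integral>z. ln (norm (1 - 1 / a * z)) \<partial>circle_lebesgue)"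
  proof (subst Bochner_Integration.integral_add)
    show "integrable circle_lebesgue (\<lambda>z. ln (norm (1 - 1 / a * z)))"
      by (rule circle_lebesgue_integrableI) (use ne a assms in \<open>auto intro!: continuous_intros\<close>)
  qed (use circle.prob_space in auto)
  finally show ?thesis using integral_circle_ln_one_minus[OF w] by simp
qed

lemma circle_integrable_ln_poly:
  assumes "\<And>z. z \<in> sphere 0 1 \<Longrightarrow> poly p z \<noteq> 0"
  shows "integrable circle_lebesgue (\<lambda>z. ln (norm (poly p z)))"
  by (rule circle_lebesgue_integrableI) (use assms in \<open>auto intro!: continuous_intros\<close>)

text \<open>Linear factors are split off one root at a time, and the logarithms add. Only roots
  inside the disc open a gap in the inequality.\<close>

lemma circle_Jensen_poly:
  fixes p :: "complex poly"
  assumes "\<And>z. z \<in> sphere 0 1 \<Longrightarrow> poly p z \<noteq> 0" "poly p 0 \<noteq> 0"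
  shows "ln (norm (poly p 0)) \<le> (\<integral>z. ln (norm (poly p z)) \<partial>circle_lebesgue)"
  using assms
proof (induction "degree p" arbitrary: p)
  case 0
  then obtain c where "p = [:c:]" by (metis degree_eq_zeroE)
  then show ?case using circle.prob_space by simp
next
  case (Suc n)
  have "\<exists>a. poly p a = 0"
    using fundamental_theorem_of_algebra[of p] Suc.hyps(2) by (simp add: constant_degree)
  then obtain a where a: "poly p a = 0" by blast
  then obtain q where p: "p = [:- a, 1:] * q" by (auto simp: poly_eq_0_iff_dvd)
  have "p \<noteq> 0" using Suc.prems by auto
  then have q: "q \<noteq> 0" using p by auto
  have dq: "degree q = n" using Suc.hyps(2) q unfolding p by (subst (asm) degree_mult_eq) auto
  have poly_p: "poly p z = (z - a) * poly q z" for z by (simp add: p algebra_simps)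
  have qnz: "poly q z \<noteq> 0" if "z \<in> sphere 0 1" for z using Suc.prems(1)[OF that] by (auto simp: poly_p)
  have q0: "poly q 0 \<noteq> 0" and a0: "a \<noteq> 0" using Suc.prems(2) by (auto simp: poly_p)
  have a1: "norm a \<noteq> 1" using Suc.prems(1)[of a] a by (auto simp: dist_norm)
  have anz: "z - a \<noteq> 0" if "z \<in> sphere 0 1" for z using Suc.prems(1)[OF that] by (auto simp: poly_p)
  have aI: "integrable circle_lebesgue (\<lambda>z. ln (norm (z - a)))"
    by (rule circle_lebesgue_integrableI) (use anz in \<open>auto intro!: continuous_intros\<close>)
  have "ln (norm (poly p 0)) = ln (norm a) + ln (norm (poly q 0))"
    using a0 q0 by (simp add: poly_p norm_mult ln_mult)
  also have "\<dots> \<le> (\<integral>z. ln (norm (z - a)) \<partial>circle_lebesgue) + (\<integral>z. ln (norm (poly q z)) \<partial>circle_lebesgue)"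
    by (intro add_mono integral_circle_ln_linear a1 a0 Suc.hyps(1) qnz q0) (use dq in auto)
  also have "\<dots> = (\<integral>z. ln (norm (z - a)) + ln (norm (poly q z)) \<partial>circle_lebesgue)"
    using aI circle_integrable_ln_poly[of q] qnz by simp
  also have "\<dots> = (\<integral>z. ln (norm (poly p z)) \<partial>circle_lebesgue)"
  proof (intro Bochner_Integration.integral_cong refl)
    fix z assume "z \<in> space circle_lebesgue"
    then show "ln (norm (z - a)) + ln (norm (poly q z)) = ln (norm (poly p z))"
      using anz[of z] qnz[of z] by (simp add: poly_p norm_mult ln_mult)
  qed
  finally show ?case .
qed

subsection \<open>Densities of finite marginals\<close>

abbreviation lebesgue_pow :: "nat \<Rightarrow> (nat \<Rightarrow> real) measure" where
  "lebesgue_pow n \<equiv> \<Pi>\<^sub>M i\<in>{..<n}. lborel"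

text \<open>Applied to the innovations \<open>W 0, ..., W (n - 1)\<close> this returns the first
  \<open>n\<close> coordinates of the process. The diagonal entries are 1, which is why no Jacobian
  appears in the densities below.\<close>

definition tri_map :: "(nat \<Rightarrow> nat \<Rightarrow> real) \<Rightarrow> nat \<Rightarrow> (nat \<Rightarrow> real) \<Rightarrow> nat \<Rightarrow> real" where
  "tri_map a n w = (\<lambda>k\<in>{..<n}. w k + (\<Sum>i<k. a k i * w i))"

text \<open>Lets the termination proof of \<open>tri_inv\<close> use \<open>i < k\<close> for the
  recursive calls under the sum. That function is forward substitution for
  \<open>tri_map\<close>.\<close>

declare sum.cong [fundef_cong]

fun tri_inv :: "(nat \<Rightarrow> nat \<Rightarrow> real) \<Rightarrow> nat \<Rightarrow> (nat \<Rightarrow> real) \<Rightarrow> real" where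
  "tri_inv a k x = x k - (\<Sum>i<k. a k i * tri_inv a i x)"

declare tri_inv.simps [simp del]

lemma tri_inv_eqI:
  assumes "\<And>j. j \<le> k \<Longrightarrow> x j = w j + (\<Sum>i<j. a j i * w i)"
  shows "tri_inv a k x = w k"
  using assms
proof (induction k rule: less_induct)
  case (less k)
  have "(\<Sum>i<k. a k i * tri_inv a i x) = (\<Sum>i<k. a k i * w i)"
    using less by (intro sum.cong) auto
  then show ?case using less.prems[of k] by (simp add: tri_inv.simps[of a k])
qed

lemma tri_inv_measurable [measurable]:
  "k < n \<Longrightarrow> tri_inv a k \<in> borel_measurable (lebesgue_pow n)"
proof (induction k rule: less_induct)
  case (less k)
  have [measurable]: "tri_inv a i \<in> borel_measurable (lebesgue_pow n)" if "i < k" for i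
    using less that by auto
  have "(\<lambda>x. x k - (\<Sum>i<k. a k i * tri_inv a i x)) \<in> borel_measurable (lebesgue_pow n)"
  proof (intro borel_measurable_diff borel_measurable_sum borel_measurable_times borel_measurable_const)
    have "(\<lambda>x. x k) \<in> measurable (lebesgue_pow n) (lborel :: real measure)"
      using less.prems by (intro measurable_component_singleton) auto
    then show "(\<lambda>x. x k) \<in> borel_measurable (lebesgue_pow n)" by simp
  qed (use less in auto)
  moreover have "tri_inv a k = (\<lambda>x. x k - (\<Sum>i<k. a k i * tri_inv a i x))"
    by (rule ext) (rule tri_inv.simps)
  ultimately show ?case by (simp only:)
qed

lemma tri_map_measurable [measurable]:
  "tri_map a n \<in> measurable (lebesgue_pow n) (lebesgue_pow n)"
proof -
  have c: "(\<lambda>w. w i) \<in> borel_measurable (lebesgue_pow n)" if "i < n" for i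
    using measurable_component_singleton[of i "{..<n}" "\<lambda>_. lborel :: real measure"] that by simp
  show ?thesis
    unfolding tri_map_def
  proof (intro measurable_restrict)
    fix k assume "k \<in> {..<n}"
    then have "(\<lambda>w. w k + (\<Sum>i<k. a k i * w i)) \<in> borel_measurable (lebesgue_pow n)"
      by (intro borel_measurable_add borel_measurable_sum borel_measurable_times borel_measurable_const c) auto
    then show "(\<lambda>w. w k + (\<Sum>i<k. a k i * w i)) \<in> measurable (lebesgue_pow n) lborel"
      by simp
  qed
qed

interpretation lborel_product: product_sigma_finite "\<lambda>_::nat. lborel :: real measure"
  by standard

text \<open>Unitriangular maps preserve Lebesgue measure: the last coordinate is translated by a
  function of the others.\<close>

lemma nn_integral_tri_map:
  assumes "F \<in> borel_measurable (lebesgue_pow n)"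
  shows "(\<integral>\<^sup>+w. F (tri_map a n w) \<partial>(lebesgue_pow n)) = (\<integral>\<^sup>+w. F w \<partial>(lebesgue_pow n))"
  using assms
proof (induction n arbitrary: F)
  case 0
  have "tri_map a 0 w = w" if "w \<in> space (lebesgue_pow 0)" for w
    using that by (auto simp: tri_map_def space_PiM)
  then show ?case by (intro nn_integral_cong) simp
next
  case (Suc n)
  let ?P = "lebesgue_pow n"
  have ins: "{..<Suc n} = insert n {..<n}" by auto
  have F [measurable]: "F \<in> borel_measurable (\<Pi>\<^sub>M i\<in>insert n {..<n}. (lborel::real measure))"
    using Suc.prems by (simp add: ins)
  have tri [measurable]: "tri_map a (Suc n) \<in> measurable (\<Pi>\<^sub>M i\<in>insert n {..<n}. lborel) (\<Pi>\<^sub>M i\<in>insert n {..<n}. lborel)"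
    using tri_map_measurable[of a "Suc n"] by (simp only: ins)
  have upd: "(\<lambda>y. w(n := y)) \<in> measurable lborel (\<Pi>\<^sub>M i\<in>insert n {..<n}. (lborel::real measure))"
    if "w \<in> space ?P" for w
    by (rule measurable_component_update[OF that]) auto
  have "(\<integral>\<^sup>+w. F (tri_map a (Suc n) w) \<partial>(lebesgue_pow (Suc n)))
      = (\<integral>\<^sup>+w. (\<integral>\<^sup>+y. F (tri_map a (Suc n) (w(n := y))) \<partial>lborel) \<partial>?P)"
    unfolding ins by (rule lborel_product.product_nn_integral_insert) auto
  also have "\<dots> = (\<integral>\<^sup>+w. (\<integral>\<^sup>+y. F ((tri_map a n w)(n := y)) \<partial>lborel) \<partial>?P)"
  proof (rule nn_integral_cong)
    fix w assume w: "w \<in> space ?P"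
    have w': "tri_map a n w \<in> space ?P" using measurable_space[OF tri_map_measurable w] .
    define c where "c = (\<Sum>i<n. a n i * w i)"
    have *: "tri_map a (Suc n) (w(n := y)) = (tri_map a n w)(n := c + 1 * y)" for y
      by (auto simp: tri_map_def fun_eq_iff c_def intro!: sum.cong)
    have "(\<integral>\<^sup>+y. F (tri_map a (Suc n) (w(n := y))) \<partial>lborel) = (\<integral>\<^sup>+y. F ((tri_map a n w)(n := c + 1 * y)) \<partial>lborel)"
      unfolding * ..
    also have "\<dots> = (\<integral>\<^sup>+y. F ((tri_map a n w)(n := y)) \<partial>lborel)"
      using nn_integral_real_affine[of "\<lambda>y. F ((tri_map a n w)(n := y))" 1 c] measurable_compose[OF upd[OF w'] F]
      by simp
    finally show "(\<integral>\<^sup>+y. F (tri_map a (Suc n) (w(n := y))) \<partial>lborel) = (\<integral>\<^sup>+y. F ((tri_map a n w)(n := y)) \<partial>lborel)" .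
  qed
  also have "\<dots> = (\<integral>\<^sup>+w. (\<integral>\<^sup>+y. F (w(n := y)) \<partial>lborel) \<partial>?P)"
  proof (rule Suc.IH)
    have "(\<lambda>(w, y). w(n := y)) \<in> measurable (?P \<Otimes>\<^sub>M lborel) (\<Pi>\<^sub>M i\<in>insert n {..<n}. (lborel::real measure))"
      using measurable_add_dim[of n "{..<n}" "\<lambda>_. lborel :: real measure"] by simp
    from measurable_compose[OF this F]
    show "(\<lambda>w. \<integral>\<^sup>+y. F (w(n := y)) \<partial>lborel) \<in> borel_measurable ?P"
      by (intro sigma_finite_measure.borel_measurable_nn_integral[OF sigma_finite_lborel]) (simp add: case_prod_beta')
  qed
  also have "\<dots> = (\<integral>\<^sup>+w. F w \<partial>(lebesgue_pow (Suc n)))"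
    unfolding ins by (rule lborel_product.product_nn_integral_insert[symmetric]) auto
  finally show ?case .
qed

lemma distr_tri_map:
  "distr (lebesgue_pow n) (lebesgue_pow n) (tri_map a n) = (lebesgue_pow n)"
proof (rule measure_eqI)
  fix A assume "A \<in> sets (distr (lebesgue_pow n) (lebesgue_pow n) (tri_map a n))"
  then have A [measurable]: "A \<in> sets (lebesgue_pow n)" by simp
  show "emeasure (distr (lebesgue_pow n) (lebesgue_pow n) (tri_map a n)) A = emeasure (lebesgue_pow n) A"
    using nn_integral_tri_map[of "indicator A" n a]
    by (subst nn_integral_indicator[symmetric], simp, subst nn_integral_distr) auto
qed simp

lemma PiM_density_lborel:
  fixes g :: "nat \<Rightarrow> real \<Rightarrow> ennreal"
  assumes g [measurable]: "\<And>k. g k \<in> borel_measurable borel" and prob: "\<And>k. prob_space (density lborel (g k))"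
  shows "(\<Pi>\<^sub>M k\<in>{..<n}. density lborel (g k)) = density (lebesgue_pow n) (\<lambda>x. \<Prod>k<n. g k (x k))"
proof -
  interpret prob_space "density lborel (g k)" for k by (rule prob)
  interpret product_sigma_finite "\<lambda>k. density lborel (g k)" by standard
  have c [measurable]: "(\<lambda>w. g i (w i)) \<in> borel_measurable (lebesgue_pow n)" if "i < n" for i
    using measurable_compose[OF measurable_component_singleton[of i "{..<n}" "\<lambda>_. lborel :: real measure"], of "g i" borel] that by simp
  have G: "(\<lambda>x. \<Prod>k<n. g k (x k)) \<in> borel_measurable (lebesgue_pow n)"
    by (intro borel_measurable_prod_ennreal c) auto
  show ?thesis
  proof (rule PiM_eqI[symmetric])
    show "sets (density (lebesgue_pow n) (\<lambda>x. \<Prod>k<n. g k (x k))) = sets (\<Pi>\<^sub>M k\<in>{..<n}. density lborel (g k))"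
      by (simp, intro sets_PiM_cong) auto
    fix A assume A: "\<And>i. i \<in> {..<n} \<Longrightarrow> A i \<in> sets (density lborel (g i))"
    then have A' [measurable]: "A i \<in> sets borel" if "i < n" for i using that by auto
    have PiA: "Pi\<^sub>E {..<n} A \<in> sets (lebesgue_pow n)"
      using A' by (intro sets_PiM_I_finite) auto
    have "emeasure (density (lebesgue_pow n) (\<lambda>x. \<Prod>k<n. g k (x k))) (Pi\<^sub>E {..<n} A)
        = (\<integral>\<^sup>+x. (\<Prod>k<n. g k (x k)) * indicator (Pi\<^sub>E {..<n} A) x \<partial>(lebesgue_pow n))"
      by (rule emeasure_density[OF G PiA])
    also have "\<dots> = (\<integral>\<^sup>+x. (\<Prod>k<n. g k (x k) * indicator (A k) (x k)) \<partial>(lebesgue_pow n))"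
    proof (rule nn_integral_cong)
      fix x assume x: "x \<in> space (lebesgue_pow n)"
      have "(\<Prod>k<n. indicator (A k) (x k)) = (indicator (Pi\<^sub>E {..<n} A) x :: ennreal)"
      proof (cases "x \<in> Pi\<^sub>E {..<n} A")
        case False
        then obtain k where "k < n" "x k \<notin> A k" using x by (auto simp: space_PiM PiE_iff)
        then show ?thesis using False by (auto intro!: prod_zero bexI[of _ k])
      qed (auto simp: PiE_iff)
      then show "(\<Prod>k<n. g k (x k)) * indicator (Pi\<^sub>E {..<n} A) x = (\<Prod>k<n. g k (x k) * indicator (A k) (x k))"
        by (simp add: prod.distrib)
    qed
    also have "\<dots> = (\<Prod>k<n. \<integral>\<^sup>+x. g k x * indicator (A k) x \<partial>lborel)"
      by (rule lborel_product.product_nn_integral_prod) auto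
    also have "\<dots> = (\<Prod>k\<in>{..<n}. emeasure (density lborel (g k)) (A k))"
      by (intro prod.cong refl emeasure_density[symmetric]) auto
    finally show "emeasure (density (lebesgue_pow n) (\<lambda>x. \<Prod>k<n. g k (x k))) (Pi\<^sub>E {..<n} A)
       = (\<Prod>k\<in>{..<n}. emeasure (density lborel (g k)) (A k))" .
  qed simp
qed

text \<open>The first \<open>n\<close> coordinates are the image under \<open>tri_map\<close> of the
  independent variables \<open>W 0, ..., W (n - 1)\<close>. Since that map preserves Lebesgue
  measure, the density is the product density composed with the inverse map.\<close>

lemma marginal_law_density:
  fixes g :: "nat \<Rightarrow> real \<Rightarrow> ennreal" and W :: "nat \<Rightarrow> (nat \<Rightarrow> real) \<Rightarrow> real"
  assumes M: "sets M = sets seq_borel"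
    and g [measurable]: "\<And>k. g k \<in> borel_measurable borel" and prob: "\<And>k. prob_space (density lborel (g k))"
    and W: "\<And>k. W k \<in> borel_measurable M"
    and law: "distr M seq_borel (\<lambda>x k. W k x) = (\<Pi>\<^sub>M k\<in>UNIV. density lborel (g k))"
    and x_eq: "\<And>x k. x k = W k x + (\<Sum>i<k. a k i * W i x)"
  shows "marginal_law M n = density (lebesgue_pow n) (\<lambda>x. \<Prod>k<n. g k (tri_inv a k x))"
proof -
  let ?L = "lebesgue_pow n"
  let ?B = "\<Pi>\<^sub>M k\<in>{..<n}. (borel::real measure)"
  have LB: "sets ?L = sets ?B" by (intro sets_PiM_cong) auto
  have LM: "measurable K ?L = measurable K ?B" for K :: "'x measure" by (rule measurable_cong_sets[OF refl LB])
  interpret prob_space "density lborel (g k)" for k by (rule prob)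
  interpret product_prob_space "\<lambda>k. density lborel (g k)" UNIV by standard
  have Wm [measurable]: "(\<lambda>x k. W k x) \<in> measurable M seq_borel"
    by (rule measurable_PiM_single') (use W in auto)
  have r [measurable]: "(\<lambda>x. restrict x {..<n}) \<in> measurable seq_borel ?L"
    unfolding LM by (rule measurable_restrict_subset) auto
  have "distr M ?L (\<lambda>x. \<lambda>k\<in>{..<n}. W k x) = distr (distr M seq_borel (\<lambda>x k. W k x)) ?L (\<lambda>x. restrict x {..<n})"
    by (subst distr_distr[OF r Wm]) (simp add: comp_def)
  also have "\<dots> = distr (\<Pi>\<^sub>M k\<in>UNIV. density lborel (g k)) (\<Pi>\<^sub>M k\<in>{..<n}. density lborel (g k)) (\<lambda>x. restrict x {..<n})"
    unfolding law by (rule distr_cong) (auto intro!: sets_PiM_cong)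
  also have "\<dots> = (\<Pi>\<^sub>M k\<in>{..<n}. density lborel (g k))"
    by (rule distr_PiM_restrict_finite) auto
  also have "\<dots> = density ?L (\<lambda>x. \<Prod>k<n. g k (x k))"
    by (rule PiM_density_lborel[OF g prob])
  finally have D: "distr M ?L (\<lambda>x. \<lambda>k\<in>{..<n}. W k x) = density ?L (\<lambda>x. \<Prod>k<n. g k (x k))" .
  have Wn: "(\<lambda>x. \<lambda>k\<in>{..<n}. W k x) \<in> measurable M ?L"
    by (intro measurable_restrict) (use W in auto)
  have "marginal_law M n = distr M ?L (\<lambda>x. restrict x {..<n})"
    unfolding marginal_law_def by (rule distr_cong) (auto simp: LB)
  also have "\<dots> = distr M ?L (\<lambda>x. tri_map a n (\<lambda>k\<in>{..<n}. W k x))"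
  proof (rule distr_cong)
    fix x
    show "restrict x {..<n} = tri_map a n (\<lambda>k\<in>{..<n}. W k x)"
    proof
      fix k
      show "restrict x {..<n} k = tri_map a n (\<lambda>k\<in>{..<n}. W k x) k"
      proof (cases "k < n")
        case True
        then have "(\<Sum>i<k. a k i * (\<lambda>k\<in>{..<n}. W k x) i) = (\<Sum>i<k. a k i * W i x)"
          by (intro sum.cong) auto
        then show ?thesis using True x_eq[of x k] by (simp add: tri_map_def)
      qed (simp add: tri_map_def)
    qed
  qed auto
  also have "\<dots> = distr (distr M ?L (\<lambda>x. \<lambda>k\<in>{..<n}. W k x)) ?L (tri_map a n)"
    by (subst distr_distr[OF tri_map_measurable Wn]) (simp add: comp_def)
  also have "\<dots> = distr (density ?L (\<lambda>x. \<Prod>k<n. g k (x k))) ?L (tri_map a n)" by (simp only: D)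
  \<comment> \<open>Once the density is written as a function of \<open>tri_map a n x\<close>, it
    can be moved outside the image measure.\<close>
  also have "\<dots> = distr (density ?L (\<lambda>x. \<Prod>k<n. g k (tri_inv a k (tri_map a n x)))) ?L (tri_map a n)"
  proof -
    have "tri_inv a k (tri_map a n x) = x k" if "k < n" for x k
      by (rule tri_inv_eqI) (use that in \<open>auto simp: tri_map_def\<close>)
    then have "(\<lambda>x. \<Prod>k<n. g k (x k)) = (\<lambda>x. \<Prod>k<n. g k (tri_inv a k (tri_map a n x)))"
      by (intro ext prod.cong) auto
    then show ?thesis by (rule arg_cong)
  qed
  also have "\<dots> = density (distr ?L ?L (tri_map a n)) (\<lambda>x. \<Prod>k<n. g k (tri_inv a k x))"
    by (rule density_distr[symmetric]) (auto intro!: borel_measurable_prod_ennreal measurable_compose[OF tri_inv_measurable g])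
  finally show ?thesis by (simp only: distr_tri_map)
qed

text \<open>The entropy is the expectation of \<open>- ln \<rho>\<close> at the sample point, and
  there \<open>ln \<rho>\<close> is the sum of the logarithms of the normal densities of the
  \<open>W k\<close>. Each quadratic term contributes \<open>s k / (2 * s k)\<close>, which is the
  constant 1/2 beside \<open>ln (2 * pi * s k) / 2\<close>.\<close>

lemma marginal_entropy:
  fixes W :: "nat \<Rightarrow> (nat \<Rightarrow> real) \<Rightarrow> real" and s :: "nat \<Rightarrow> real"
  assumes M: "sets M = sets seq_borel"
    and s: "\<And>k. 0 < s k"
    and W: "\<And>k. W k \<in> borel_measurable M"
    and law: "distr M seq_borel (\<lambda>x k. W k x)
       = (\<Pi>\<^sub>M k\<in>UNIV. density lborel (\<lambda>x. ennreal (normal_density 0 (sqrt (s k)) x)))"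
    and x_eq: "\<And>x k. x k = W k x + (\<Sum>i<k. a k i * W i x)"
    and prob: "prob_space M"
    and var: "\<And>k. integrable M (\<lambda>x. (W k x)\<^sup>2)" "\<And>k. (\<integral>x. (W k x)\<^sup>2 \<partial>M) = s k"
  shows "- (\<integral>x. marginal_density M n x * ln (marginal_density M n x) \<partial>(lebesgue_pow n))
     = (\<Sum>k<n. (ln (2 * pi * s k) + 1) / 2)"
proof -
  interpret prob_space M by (rule prob)
  let ?L = "lebesgue_pow n"
  let ?B = "\<Pi>\<^sub>M k\<in>{..<n}. (borel::real measure)"
  have LB: "sets ?L = sets ?B" by (intro sets_PiM_cong) auto
  let ?g = "\<lambda>k. normal_density 0 (sqrt (s k))"
  define \<rho> where "\<rho> x = (\<Prod>k<n. ?g k (tri_inv a k x))" for x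
  have g_pos: "?g k y > 0" for k y using s[of k] by (intro normal_density_pos) simp
  have \<rho>_pos: "\<rho> x > 0" for x
    unfolding \<rho>_def by (intro prod_pos ballI g_pos)
  have \<rho>_meas [measurable]: "\<rho> \<in> borel_measurable ?L"
    unfolding \<rho>_def by (intro borel_measurable_prod measurable_compose[OF tri_inv_measurable borel_measurable_normal_density]) auto
  interpret L: sigma_finite_measure ?L by (rule lborel_product.sigma_finite) simp
  have "marginal_law M n = density ?L (\<lambda>x. \<Prod>k<n. ennreal (?g k (tri_inv a k x)))"
    by (rule marginal_law_density[OF M _ _ W law x_eq]) (use s in \<open>auto intro!: prob_space_normal_density\<close>)
  also have "\<dots> = density ?L (\<lambda>x. ennreal (\<rho> x))"
    unfolding \<rho>_def by (subst prod_ennreal) auto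
  finally have dens: "marginal_law M n = density ?L (\<lambda>x. ennreal (\<rho> x))" .
  \<comment> \<open>The Radon-Nikodym derivative is determined only almost everywhere, so
    \<open>marginal_density\<close> is replaced by \<open>\<rho>\<close> under the integral and not
    pointwise.\<close>
  have "AE x in ?L. ennreal (\<rho> x) = RN_deriv ?L (marginal_law M n) x"
    by (rule L.RN_deriv_unique) (auto simp: dens)
  then have AE: "AE x in ?L. marginal_density M n x = \<rho> x"
    unfolding marginal_density_def
  proof eventually_elim
    case (elim x)
    show ?case unfolding elim[symmetric] using \<rho>_pos[of x] by simp
  qed
  have md: "marginal_density M n \<in> borel_measurable ?L"
    unfolding marginal_density_def by measurable
  have lng: "ln (?g k (W k x)) = - (ln (2 * pi * s k) / 2) - (W k x)\<^sup>2 / (2 * s k)" for k x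
  proof -
    have "ln (?g k (W k x)) = ln (1 / sqrt (2 * pi * s k)) + ln (exp (- ((W k x)\<^sup>2) / (2 * s k)))"
    proof -
      have "?g k (W k x) = 1 / sqrt (2 * pi * s k) * exp (- ((W k x)\<^sup>2) / (2 * s k))"
        using s[of k] by (simp add: normal_density_def)
      then show ?thesis using s[of k] by (simp only:) (rule ln_mult_pos, auto)
    qed
    also have "ln (1 / sqrt (2 * pi * s k)) = - (ln (2 * pi * s k) / 2)"
      using s[of k] by (simp add: ln_div ln_sqrt)
    finally show ?thesis by simp
  qed
  have ln\<rho>: "ln (\<rho> (restrict x {..<n})) = (\<Sum>k<n. - (ln (2 * pi * s k) / 2) - (W k x)\<^sup>2 / (2 * s k))" for x
  proof -
    have "tri_inv a k (restrict x {..<n}) = W k x" if "k < n" for k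
    proof (rule tri_inv_eqI)
      fix j assume "j \<le> k"
      then show "restrict x {..<n} j = W j x + (\<Sum>i<j. a j i * W i x)"
        using x_eq[of x j] that by simp
    qed
    then have "\<rho> (restrict x {..<n}) = (\<Prod>k<n. ?g k (W k x))"
      unfolding \<rho>_def by (intro prod.cong) auto
    also have "ln \<dots> = (\<Sum>k<n. ln (?g k (W k x)))"
      by (rule ln_prod) (use g_pos[THEN less_imp_neq] in auto)
    also have "\<dots> = (\<Sum>k<n. - (ln (2 * pi * s k) / 2) - (W k x)\<^sup>2 / (2 * s k))"
      by (simp only: lng)
    finally show ?thesis .
  qed
  have "(\<integral>x. marginal_density M n x * ln (marginal_density M n x) \<partial>?L) = (\<integral>x. \<rho> x * ln (\<rho> x) \<partial>?L)"
    by (rule integral_cong_AE) (use AE md in \<open>auto elim!: eventually_mono\<close>)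
  also have "\<dots> = (\<integral>x. ln (\<rho> x) \<partial>density ?L (\<lambda>x. ennreal (\<rho> x)))"
    by (subst integral_density) (use \<rho>_pos in \<open>auto intro: less_imp_le\<close>)
  also have "\<dots> = (\<integral>x. ln (\<rho> x) \<partial>marginal_law M n)" by (simp only: dens)
  also have "\<dots> = (\<integral>x. ln (\<rho> (restrict x {..<n})) \<partial>M)"
    unfolding marginal_law_def
  proof (rule integral_distr)
    show "(\<lambda>x. restrict x {..<n}) \<in> measurable M ?B"
      unfolding measurable_cong_sets[OF M refl] by (rule measurable_restrict_subset) auto
    show "(\<lambda>x. ln (\<rho> x)) \<in> borel_measurable ?B"
      unfolding measurable_cong_sets[OF LB[symmetric] refl] by measurable
  qed
  also have "\<dots> = (\<Sum>k<n. - (ln (2 * pi * s k) / 2) - s k / (2 * s k))"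
    unfolding ln\<rho> using var by (subst Bochner_Integration.integral_sum) (auto simp: prob_space)
  also have "\<dots> = (\<Sum>k<n. - ((ln (2 * pi * s k) + 1) / 2))"
    using s by (intro sum.cong) (auto simp: field_simps less_imp_neq[THEN not_sym])
  finally show ?thesis by (simp add: sum_negf)
qed

text \<open>Finitely many early terms add a bounded amount \<open>C\<close>, which after division by
  \<open>n\<close> falls below \<open>e\<close>. A one-sided form serves both finite limits, through
  negation, and divergence to minus infinity.\<close>

lemma eventually_mean_le:
  fixes a :: "nat \<Rightarrow> real"
  assumes ev: "\<forall>\<^sub>F k in sequentially. a k \<le> B" and e: "e > 0"
  shows "\<forall>\<^sub>F n in sequentially. 1 / real n * (\<Sum>k<n. a k) \<le> B + e"
proof -
  obtain N where N: "\<And>k. k \<ge> N \<Longrightarrow> a k \<le> B" using ev by (auto simp: eventually_sequentially)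
  define C where "C = (\<Sum>k<N. \<bar>a k - B\<bar>)"
  have "(\<Sum>k<n. a k) \<le> C + real n * B" for n
  proof -
    have "(\<Sum>k<n. a k - B) \<le> (\<Sum>k<n. if k < N then \<bar>a k - B\<bar> else 0)"
      by (intro sum_mono) (use N in auto)
    also have "\<dots> = (\<Sum>k\<in>{..<n} \<inter> {..<N}. \<bar>a k - B\<bar>)"
      by (subst sum.inter_restrict) (auto intro!: sum.cong)
    also have "\<dots> \<le> C" unfolding C_def by (intro sum_mono2) auto
    finally show ?thesis by (simp add: sum_subtractf)
  qed
  moreover have "\<forall>\<^sub>F n in sequentially. n > 0 \<and> C / e \<le> real n"
    by (intro eventually_conj eventually_gt_at_top)
       (metis (mono_tags, lifting) eventually_sequentiallyI nat_ceiling_le_eq)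
  ultimately show ?thesis
  proof (elim eventually_mono)
    fix n assume le: "\<And>n. (\<Sum>k<n. a k) \<le> C + real n * B" and n: "n > 0 \<and> C / e \<le> real n"
    have "C \<le> real n * e" using n e by (simp add: field_simps)
    then have "(\<Sum>k<n. a k) \<le> real n * (B + e)" using le[of n] by (simp add: algebra_simps)
    then show "1 / real n * (\<Sum>k<n. a k) \<le> B + e" using n by (simp add: field_simps)
  qed
qed

lemma Cesaro_mean_tendsto:
  fixes a :: "nat \<Rightarrow> real"
  assumes "a \<longlonglongrightarrow> L"
  shows "(\<lambda>n. 1 / real n * (\<Sum>k<n. a k)) \<longlonglongrightarrow> L"
proof (rule order_tendstoI)
  have up: "\<forall>\<^sub>F n in sequentially. 1 / real n * (\<Sum>k<n. b k) < y"
    if "b \<longlonglongrightarrow> L'" "L' < y" for b L' y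
  proof -
    define e where "e = (y - L') / 3"
    have e: "e > 0" "L' + e + e < y" using that by (auto simp: e_def field_simps)
    have "\<forall>\<^sub>F k in sequentially. b k < L' + e" using e by (intro order_tendstoD(2)[OF that(1)]) simp
    then have "\<forall>\<^sub>F k in sequentially. b k \<le> L' + e" by eventually_elim simp
    from eventually_mean_le[OF this e(1)] show ?thesis
      by eventually_elim (use e in linarith)
  qed
  show "\<forall>\<^sub>F n in sequentially. 1 / real n * (\<Sum>k<n. a k) < y" if "L < y" for y
    by (rule up[OF assms that])
  show "\<forall>\<^sub>F n in sequentially. y < 1 / real n * (\<Sum>k<n. a k)" if "y < L" for y
    using up[OF tendsto_minus[OF assms], of "- y"] that by (simp add: sum_negf)
qed

lemma Cesaro_mean_at_bot:
  fixes a :: "nat \<Rightarrow> real"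
  assumes "filterlim a at_bot sequentially"
  shows "filterlim (\<lambda>n. 1 / real n * (\<Sum>k<n. a k)) at_bot sequentially"
  unfolding filterlim_at_bot
proof
  fix Z
  have "\<forall>\<^sub>F k in sequentially. a k \<le> Z - 1" using assms by (auto simp: filterlim_at_bot)
  from eventually_mean_le[OF this, of 1]
  show "\<forall>\<^sub>F n in sequentially. 1 / real n * (\<Sum>k<n. a k) \<le> Z" by simp
qed

text \<open>If \<open>d > 0\<close> the summands converge to
  \<open>(ln (2 * pi * d) + 1) / 2\<close>; if \<open>d = 0\<close> they tend to minus infinity.
  Cesaro averaging keeps either limit, so \<open>lim\<close> denotes a genuine limit in both
  cases.\<close>

lemma lim_mean_finite_iff:
  fixes s :: "nat \<Rightarrow> real"
  assumes s: "\<And>k. 0 < s k" and lim: "s \<longlonglongrightarrow> d"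
  shows "\<bar>lim (\<lambda>n. ereal (1 / real n * (\<Sum>k<n. (ln (2 * pi * s k) + 1) / 2)))\<bar> \<noteq> \<infinity> \<longleftrightarrow> 0 < d"
proof -
  let ?a = "\<lambda>k. (ln (2 * pi * s k) + 1) / 2"
  have "0 \<le> d" using lim s by (intro LIMSEQ_le_const) (auto intro: less_imp_le)
  show ?thesis
  proof (cases "d = 0")
    case False
    then have "d > 0" using \<open>0 \<le> d\<close> by simp
    then have "?a \<longlonglongrightarrow> (ln (2 * pi * d) + 1) / 2"
      by (intro tendsto_intros lim) auto
    from Cesaro_mean_tendsto[OF this]
    have "(\<lambda>n. ereal (1 / real n * (\<Sum>k<n. ?a k))) \<longlonglongrightarrow> ereal ((ln (2 * pi * d) + 1) / 2)"
      by (simp only: lim_ereal)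
    then show ?thesis using \<open>d > 0\<close> by (subst limI) auto
  next
    case True
    have "filterlim (\<lambda>k. 2 * pi * s k) (at_right 0) sequentially"
      unfolding filterlim_at using s tendsto_mult[OF tendsto_const[of "2 * pi"] lim] True
      by (auto simp: s[THEN less_imp_neq, THEN not_sym])
    from filterlim_compose[OF ln_at_0 this]
    have l: "filterlim (\<lambda>k. ln (2 * pi * s k)) at_bot sequentially" .
    have "filterlim ?a at_bot sequentially"
      unfolding filterlim_at_bot
    proof
      fix Z
      have "\<forall>\<^sub>F k in sequentially. ln (2 * pi * s k) \<le> 2 * Z - 1" using l by (auto simp: filterlim_at_bot)
      then show "\<forall>\<^sub>F k in sequentially. ?a k \<le> Z" by eventually_elim (simp add: field_simps)
    qed
    from Cesaro_mean_at_bot[OF this]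
    have "(\<lambda>n. ereal (1 / real n * (\<Sum>k<n. ?a k))) \<longlonglongrightarrow> - \<infinity>"
      unfolding tendsto_MInfty less_ereal.simps(1) filterlim_at_bot_dense by blast
    then show ?thesis using True by (subst limI) auto
  qed
qed

subsection \<open>Isomorphisms of one-sided shifts\<close>

lemma unilateral_shift_measurable [measurable]:
  "unilateral_shift \<in> measurable seq_borel seq_borel"
  unfolding unilateral_shift_def by (rule measurable_PiM_single') auto

lemma sets_fixed_points:
  assumes [measurable]: "h \<in> measurable seq_borel seq_borel"
  shows "{x. h x = x} \<in> sets seq_borel"
proof -
  have h: "(\<lambda>x. h x k) \<in> borel_measurable seq_borel" for k
    by (rule measurable_compose[OF assms measurable_component_singleton]) simp
  have "{x\<in>space seq_borel. \<forall>k. h x k = x k} \<in> sets seq_borel"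
    by (intro sets.sets_Collect_countable_All borel_measurable_eq h measurable_component_singleton UNIV_I)
  then show ?thesis by (simp add: space_PiM fun_eq_iff)
qed

text \<open>The fixed points of \<open>\<Psi>\<close> after \<open>\<Phi>\<close> and of
  \<open>\<Phi>\<close> after \<open>\<Psi>\<close> serve as the two sets. Equivariance at every
  point makes them forward invariant. The first has full measure by assumption, the second because
  \<open>\<Phi>\<close> maps the first into it.\<close>

lemma mpt_isomorphic_unilateral_shiftI:
  assumes M: "sets M = sets seq_borel"
    and \<Phi> [measurable]: "\<Phi> \<in> measurable seq_borel seq_borel"
    and \<Psi> [measurable]: "\<Psi> \<in> measurable seq_borel seq_borel"
    and \<Phi>_shift: "\<And>x. \<Phi> (unilateral_shift x) = unilateral_shift (\<Phi> x)"
    and \<Psi>_shift: "\<And>y. \<Psi> (unilateral_shift y) = unilateral_shift (\<Psi> y)"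
    and N: "distr M seq_borel \<Phi> = N"
    and AE: "AE x in M. \<Psi> (\<Phi> x) = x"
  shows "mpt_isomorphic M unilateral_shift N unilateral_shift"
proof -
  have Nsets: "sets N = sets seq_borel" using N by auto
  have spM: "space M = UNIV" using sets_eq_imp_space_eq[OF M] by (simp add: space_PiM)
  have spN: "space N = UNIV" using sets_eq_imp_space_eq[OF Nsets] by (simp add: space_PiM)
  have \<Phi>MN: "\<Phi> \<in> measurable M N" and \<Psi>NM: "\<Psi> \<in> measurable N M"
    using \<Phi> \<Psi> by (auto simp: measurable_cong_sets[OF M Nsets] measurable_cong_sets[OF Nsets M])
  define A where "A = {x. \<Psi> (\<Phi> x) = x}"
  define B where "B = {y. \<Phi> (\<Psi> y) = y}"
  have A: "A \<in> sets M" unfolding A_def M by (rule sets_fixed_points) measurable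
  have B: "B \<in> sets N" unfolding B_def Nsets by (rule sets_fixed_points) measurable
  have nullA: "space M - A \<in> null_sets M"
    using A AE by (subst AE_iff_null_sets) (auto simp: A_def)
  have NM: "emeasure N C = emeasure M (\<Phi> -` C)" if "C \<in> sets N" for C
    unfolding N[symmetric] using that \<Phi>MN N Nsets
    by (subst emeasure_distr) (auto simp: spM measurable_cong_sets[OF M refl])
  have "\<Phi> -` (space N - B) \<subseteq> space M - A" by (auto simp: A_def B_def spM)
  then have "emeasure N (space N - B) \<le> emeasure M (space M - A)"
    using B A by (subst NM) (auto intro!: emeasure_mono)
  then have nullB: "space N - B \<in> null_sets N"
    using nullA B by (intro null_setsI) (auto simp: null_setsD1)
  have AEA: "AE x in M. x \<in> A" using AE by (simp add: A_def)
  show ?thesis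
    unfolding mpt_isomorphic_def
  proof (rule exI[of _ A], rule exI[of _ B], rule exI[of _ \<Phi>], rule exI[of _ \<Psi>], intro conjI)
    show "A \<in> sets M" "space M - A \<in> null_sets M" "B \<in> sets N" "space N - B \<in> null_sets N" by fact+
    show "unilateral_shift ` A \<subseteq> A" "unilateral_shift ` B \<subseteq> B"
      by (auto simp: A_def B_def \<Phi>_shift \<Psi>_shift)
    show \<Phi>AB: "\<Phi> \<in> measurable (restrict_space M A) (restrict_space N B)"
      by (rule measurable_restrict_space3[OF \<Phi>MN]) (auto simp: A_def B_def)
    show "\<Psi> \<in> measurable (restrict_space N B) (restrict_space M A)"
      by (rule measurable_restrict_space3[OF \<Psi>NM]) (auto simp: A_def B_def)
    show "\<forall>x\<in>A. \<Psi> (\<Phi> x) = x" "\<forall>y\<in>B. \<Phi> (\<Psi> y) = y" "\<forall>x\<in>A. \<Phi> (unilateral_shift x) = unilateral_shift (\<Phi> x)"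
      by (auto simp: A_def B_def \<Phi>_shift)
    show "distr (restrict_space M A) (restrict_space N B) \<Phi> = restrict_space N B"
    proof (rule measure_eqI)
      fix C assume "C \<in> sets (distr (restrict_space M A) (restrict_space N B) \<Phi>)"
      then have C: "C \<in> sets (restrict_space N B)" by simp
      then have CN: "C \<in> sets N" "C \<subseteq> B" using B by (auto simp: sets_restrict_space_iff spN)
      have \<Phi>C: "\<Phi> -` C \<in> sets M" using measurable_sets[OF \<Phi>MN CN(1)] by (simp add: spM)
      have "emeasure (distr (restrict_space M A) (restrict_space N B) \<Phi>) C = emeasure (restrict_space M A) (\<Phi> -` C \<inter> A)"
        using \<Phi>AB C by (subst emeasure_distr) (auto simp: space_restrict_space spM)
      also have "\<dots> = emeasure M (\<Phi> -` C \<inter> A)"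
        using A by (intro emeasure_restrict_space) (auto simp: spM)
      also have "\<dots> = emeasure M (\<Phi> -` C)"
        using AEA \<Phi>C A by (intro emeasure_eq_AE) auto
      also have "\<dots> = emeasure N C" by (rule NM[OF CN(1), symmetric])
      also have "\<dots> = emeasure (restrict_space N B) C"
        using B CN by (intro emeasure_restrict_space[symmetric]) (auto simp: spN)
      finally show "emeasure (distr (restrict_space M A) (restrict_space N B) \<Phi>) C = emeasure (restrict_space N B) C" .
    qed simp
  qed
qed

text \<open>If \<open>x 0\<close> is a function of the shifted sequence, then every event is an event of the shifted
  sequence. Isomorphisms transport this property, but it fails for independent coordinates.\<close>

lemma not_mpt_isomorphic_product:
  fixes \<mu> :: "real measure"
  assumes M: "sets M = sets seq_borel"
    and g [measurable]: "g \<in> borel_measurable seq_borel"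
    and AE: "AE x in M. x 0 = g (unilateral_shift x)"
    and N: "N = (\<Pi>\<^sub>M i\<in>(UNIV::nat set). \<mu>)" and \<mu>: "prob_space \<mu>" "sets \<mu> = sets borel"
    and nontrivial: "0 < measure \<mu> {0<..}" "measure \<mu> {0<..} < 1"
  shows "\<not> mpt_isomorphic M unilateral_shift N unilateral_shift"
proof
  assume "mpt_isomorphic M unilateral_shift N unilateral_shift"
  then show False
    unfolding mpt_isomorphic_def
  proof (elim exE conjE)
    fix A B \<phi> \<psi>
    assume A: "A \<in> sets M" "space M - A \<in> null_sets M" "unilateral_shift ` A \<subseteq> A" and
      B: "B \<in> sets N" "space N - B \<in> null_sets N" "unilateral_shift ` B \<subseteq> B" and
      \<phi>: "\<phi> \<in> measurable (restrict_space M A) (restrict_space N B)" and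
      \<psi>: "\<psi> \<in> measurable (restrict_space N B) (restrict_space M A)" and
      inv: "\<forall>x\<in>A. \<psi> (\<phi> x) = x" "\<forall>y\<in>B. \<phi> (\<psi> y) = y" and
      d: "distr (restrict_space M A) (restrict_space N B) \<phi> = restrict_space N B" and
      equivariant: "\<forall>x\<in>A. \<phi> (unilateral_shift x) = unilateral_shift (\<phi> x)"
    have \<psi>\<phi>: "\<psi> (\<phi> x) = x" if "x \<in> A" for x using inv(1) that by (rule bspec)
    have \<phi>\<psi>: "\<phi> (\<psi> y) = y" if "y \<in> B" for y using inv(2) that by (rule bspec)
    have \<phi>_shift: "\<phi> (unilateral_shift x) = unilateral_shift (\<phi> x)" if "x \<in> A" for x
      using equivariant that by (rule bspec)
      interpret \<mu>: prob_space \<mu> by fact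
    interpret sequence_space \<mu> by standard
    have Nsets: "sets N = sets seq_borel" unfolding N by (intro sets_PiM_cong) (auto simp: \<mu>)
    have spM: "space M = UNIV" using sets_eq_imp_space_eq[OF M] by (simp add: space_PiM)
    have spN: "space N = UNIV" using sets_eq_imp_space_eq[OF Nsets] by (simp add: space_PiM)
    have sp\<mu>: "space \<mu> = UNIV" using sets_eq_imp_space_eq[OF \<mu>(2)] by simp
    have spA: "space (restrict_space M A) = A" and spB: "space (restrict_space N B) = B"
      by (auto simp: space_restrict_space spM spN)
    have \<phi>B: "\<phi> x \<in> B" if "x \<in> A" for x using measurable_space[OF \<phi>] that by (simp add: spA spB)
    have \<psi>A: "\<psi> y \<in> A" if "y \<in> B" for y using measurable_space[OF \<psi>] that by (simp add: spA spB)
    have setsA: "C \<in> sets (restrict_space M A) \<longleftrightarrow> C \<in> sets M \<and> C \<subseteq> A" for C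
      using A(1) by (auto simp: sets_restrict_space_iff spM)
    have setsB: "C \<in> sets (restrict_space N B) \<longleftrightarrow> C \<in> sets N \<and> C \<subseteq> B" for C
      using B(1) by (auto simp: sets_restrict_space_iff spN)
    have \<psi>_shift: "\<psi> (unilateral_shift y) = unilateral_shift (\<psi> y)" if "y \<in> B" for y
    proof -
      have "unilateral_shift (\<psi> y) \<in> A" using A(3) \<psi>A[OF that] by blast
      moreover have "\<phi> (unilateral_shift (\<psi> y)) = unilateral_shift y"
        using \<phi>_shift[OF \<psi>A[OF that]] \<phi>\<psi>[OF that] by simp
      ultimately show ?thesis using \<psi>\<phi> by metis
    qed
    \<comment> \<open>The event to be tested: it depends on coordinate 0 alone, and the isomorphism
      will turn it into an event of the shifted sequence.\<close>
    define E where "E = {y. (0::real) < y 0} \<inter> B"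
    have pos: "{y::nat \<Rightarrow> real. 0 < y 0} \<in> sets seq_borel"
    proof -
      have "{y\<in>space seq_borel. 0 < y 0} \<in> sets seq_borel" by measurable
      then show ?thesis by (simp add: space_PiM)
    qed
    have E: "E \<in> sets N" unfolding E_def using pos B Nsets by auto
    define D where "D = \<phi> -` E \<inter> A"
    have D: "D \<in> sets M"
      using measurable_sets[OF \<phi>, of E] E by (auto simp: D_def spA setsA setsB E_def)
    \<comment> \<open>Prepending \<open>g y\<close> to \<open>y\<close> recovers the unshifted
      sequence almost everywhere, so \<open>D'\<close> is the event \<open>D\<close> read off from
      the shifted sequence.\<close>
    define D' where "D' = {y. case_nat (g y) y \<in> D}"
    have D': "D' \<in> sets M"
    proof -
      have [measurable]: "(\<lambda>y. case_nat (g y) y) \<in> measurable seq_borel seq_borel"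
        by (rule measurable_PiM_single') (auto split: nat.split simp: measurable_split_conv intro!: measurable_case_nat')
      have "(\<lambda>y. case_nat (g y) y) -` D \<inter> space seq_borel \<in> sets seq_borel"
        using D by (intro measurable_sets[of _ seq_borel seq_borel]) (auto simp: M)
      then show ?thesis by (simp add: D'_def vimage_def M space_PiM)
    qed
    \<comment> \<open>Equivariance of \<open>\<psi>\<close> carries \<open>D'\<close> over to the
      product side; intersecting with \<open>A\<close> keeps the set inside the domain of the
      isomorphism.\<close>
    define E' where "E' = \<psi> -` (D' \<inter> A) \<inter> B"
    have E': "E' \<in> sets N"
      using measurable_sets[OF \<psi>, of "D' \<inter> A"] D' A by (auto simp: E'_def spB setsA setsB)
    have good: "AE x in M. x \<in> A \<longrightarrow> (x \<in> D \<longleftrightarrow> unilateral_shift x \<in> D')"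
      using AE
    proof eventually_elim
      case (elim x)
      have "case_nat (g (unilateral_shift x)) (unilateral_shift x) = x"
        using elim[symmetric] by (auto simp: unilateral_shift_def fun_eq_iff split: nat.split)
      then show ?case by (simp add: D'_def)
    qed
    have AE_B: "AE y in N. y \<in> B" using AE_not_in[OF B(2)] by eventually_elim (simp add: spN)
    have "AE x in restrict_space M A. x \<in> D \<longleftrightarrow> unilateral_shift x \<in> D'"
      using good A(1) by (subst AE_restrict_space_iff) (auto simp: spM)
    then have "AE x in restrict_space M A. \<phi> x \<in> E \<longleftrightarrow> unilateral_shift (\<phi> x) \<in> E'"
    proof (rule AE_mp, intro AE_I2 impI)
      fix x assume x: "x \<in> space (restrict_space M A)" and eq: "x \<in> D \<longleftrightarrow> unilateral_shift x \<in> D'"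
      have xA: "x \<in> A" using x spA by simp
      have sA: "unilateral_shift x \<in> A" using A(3) xA by blast
      have sB: "unilateral_shift (\<phi> x) \<in> B" using B(3) \<phi>B[OF xA] by blast
      have "\<psi> (unilateral_shift (\<phi> x)) = unilateral_shift x"
        using \<psi>_shift[OF \<phi>B[OF xA]] \<psi>\<phi>[OF xA] by simp
      then have "unilateral_shift (\<phi> x) \<in> E' \<longleftrightarrow> unilateral_shift x \<in> D'"
        using sA sB by (simp add: E'_def)
      moreover have "\<phi> x \<in> E \<longleftrightarrow> x \<in> D" using xA by (simp add: D_def)
      ultimately show "\<phi> x \<in> E \<longleftrightarrow> unilateral_shift (\<phi> x) \<in> E'" using eq by simp
    qed
    have shift_meas: "unilateral_shift \<in> measurable N N"
      unfolding measurable_cong_sets[OF Nsets Nsets] by measurable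
    have shE': "unilateral_shift -` E' \<in> sets N" using measurable_sets[OF shift_meas E'] by (simp add: spN)
    define F where "F = {y. y \<in> E \<longleftrightarrow> unilateral_shift y \<in> E'}"
    have F: "F \<in> sets N"
    proof -
      have "F = (E \<inter> unilateral_shift -` E') \<union> (UNIV - (E \<union> unilateral_shift -` E'))"
        by (auto simp: F_def)
      then show ?thesis using E shE' sets.compl_sets[of "E \<union> unilateral_shift -` E'" N] by (auto simp: spN)
    qed
    have "AE y in distr (restrict_space M A) (restrict_space N B) \<phi>. y \<in> F"
    proof (subst AE_distr_iff[OF \<phi>])
      show "{y \<in> space (restrict_space N B). y \<in> F} \<in> sets (restrict_space N B)"
        using F B by (auto simp: setsB spB Collect_conj_eq)
      show "AE x in restrict_space M A. \<phi> x \<in> F"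
        using \<open>AE x in restrict_space M A. \<phi> x \<in> E \<longleftrightarrow> unilateral_shift (\<phi> x) \<in> E'\<close> by (simp add: F_def)
    qed
    then have "AE y in N. y \<in> B \<longrightarrow> y \<in> F"
      unfolding d using B(1) by (subst (asm) AE_restrict_space_iff) (auto simp: spN)
    then have AE_F: "AE y in N. (0 < y 0) \<longleftrightarrow> unilateral_shift y \<in> E'"
      using AE_B by eventually_elim (auto simp: F_def E_def)
    define p where "p = measure \<mu> {0<..}"
    \<comment> \<open>Under a product measure the first coordinate is independent of the shifted
      sequence, which again has law \<open>N\<close>.\<close>
    have rect: "emeasure N {y. y 0 \<in> X \<and> unilateral_shift y \<in> Y} = emeasure \<mu> X * emeasure N Y"
      if X: "X \<in> sets borel" and Y: "Y \<in> sets N" for X Y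
    proof -
      let ?f = "\<lambda>(s, \<omega>). case_nat s \<omega> :: nat \<Rightarrow> real"
      let ?R = "{y. y 0 \<in> X \<and> unilateral_shift y \<in> Y}"
      have R: "?R \<in> sets N"
      proof -
        have "{y::nat \<Rightarrow> real. y 0 \<in> X} \<in> sets seq_borel"
        proof -
          have "{y\<in>space seq_borel. y 0 \<in> X} \<in> sets seq_borel" using X by measurable
          then show ?thesis by (simp add: space_PiM)
        qed
        moreover have "unilateral_shift -` Y \<in> sets N" using measurable_sets[OF shift_meas Y] by (simp add: spN)
        moreover have "?R = {y. y 0 \<in> X} \<inter> unilateral_shift -` Y" by auto
        ultimately show ?thesis using Nsets by auto
      qed
      have f: "?f \<in> measurable (\<mu> \<Otimes>\<^sub>M N) N" unfolding N by measurable
      have "emeasure N ?R = emeasure (distr (\<mu> \<Otimes>\<^sub>M N) N ?f) ?R" unfolding N by (simp only: PiM_iter)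
      also have "\<dots> = emeasure (\<mu> \<Otimes>\<^sub>M N) (?f -` ?R \<inter> space (\<mu> \<Otimes>\<^sub>M N))"
        by (rule emeasure_distr[OF f R])
      also have "?f -` ?R \<inter> space (\<mu> \<Otimes>\<^sub>M N) = X \<times> Y"
        by (auto simp: space_pair_measure sp\<mu> spN unilateral_shift_def)
      also have "emeasure (\<mu> \<Otimes>\<^sub>M N) (X \<times> Y) = emeasure \<mu> X * emeasure N Y"
      proof -
        interpret N: prob_space N unfolding N by (rule prob_space_PiM) (rule \<mu>)
        show ?thesis using X Y by (intro N.emeasure_pair_measure_Times) (auto simp: \<mu>)
      qed
      finally show ?thesis .
    qed
    interpret N: prob_space N unfolding N by (rule prob_space_PiM) (rule \<mu>)
    have posN: "{y. (0::real) < y 0} \<in> sets N" using pos Nsets by simp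
    have N1: "emeasure N UNIV = 1" using N.emeasure_space_1 by (simp add: spN)
    have UN: "UNIV \<in> sets N" using sets.top[of N] by (simp add: spN)
    have "emeasure N {y. 0 < y 0} = emeasure \<mu> {0<..}"
      using rect[of "{0<..}" UNIV] N1 UN by simp
    then have Np: "measure N {y. 0 < y 0} = p" by (simp add: p_def measure_def)
    have "measure N (unilateral_shift -` E') = p"
      unfolding Np[symmetric] by (rule N.finite_measure_eq_AE) (use AE_F shE' posN in \<open>auto elim: eventually_mono\<close>)
    moreover have "emeasure N (unilateral_shift -` E') = emeasure N E'"
      using rect[of UNIV E'] E' \<mu>.emeasure_space_1 by (simp add: sp\<mu> vimage_def)
    ultimately have E'p: "measure N E' = p" by (simp add: measure_def)
    have R: "{y. y 0 \<in> {0<..} \<and> unilateral_shift y \<in> E'} = {y. 0 < y 0} \<inter> unilateral_shift -` E'" by auto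
    have "measure N ({y. 0 < y 0} \<inter> unilateral_shift -` E') = p * p"
      using rect[of "{0<..}" E'] E' E'p unfolding R by (simp add: measure_def enn2real_mult p_def)
    moreover have "measure N ({y. 0 < y 0} \<inter> unilateral_shift -` E') = p"
      unfolding Np[symmetric] by (rule N.finite_measure_eq_AE) (use AE_F shE' posN in \<open>auto elim: eventually_mono\<close>)
    \<comment> \<open>The event \<open>0 < y 0\<close> agrees almost everywhere with an event of
      which it is independent, so its probability can only be 0 or 1.\<close>
    ultimately have "p * p = p" by simp
    then show False using nontrivial by (simp add: p_def)
  qed
qed

subsection \<open>Real polynomials on the circle\<close>

text \<open>The power \<open>z ^ i\<close> stands for the coordinate \<open>X_i\<close>.
  Coefficients are real because a real process has real linear combinations.\<close>

definition ev :: "real poly \<Rightarrow> complex \<Rightarrow> complex" where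
  "ev p z = poly (map_poly complex_of_real p) z"

lemma ev_0 [simp]: "ev 0 z = 0" and ev_1 [simp]: "ev 1 z = 1"
  by (simp_all add: ev_def)

lemma ev_pCons [simp]: "ev (pCons a p) z = complex_of_real a + z * ev p z"
  by (simp add: ev_def map_poly_pCons)

lemma ev_add [simp]: "ev (p + q) z = ev p z + ev q z"
  by (induction p q rule: poly_induct2) (auto simp: algebra_simps)

lemma ev_smult [simp]: "ev (smult c p) z = complex_of_real c * ev p z"
  by (induction p) (auto simp: algebra_simps)

lemma ev_uminus [simp]: "ev (- p) z = - ev p z"
  using ev_smult[of "-1" p z] by simp

lemma ev_diff [simp]: "ev (p - q) z = ev p z - ev q z"
  using ev_add[of p "- q" z] by simp

lemma ev_mult [simp]: "ev (p * q) z = ev p z * ev q z"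
  by (induction p) (auto simp: algebra_simps)

lemma ev_sum [simp]: "ev (\<Sum>i\<in>A. p i) z = (\<Sum>i\<in>A. ev (p i) z)"
  by (induction A rule: infinite_finite_induct) auto

lemma ev_monom [simp]: "ev (monom c n) z = complex_of_real c * z ^ n"
  by (induction n) (auto simp: monom_0 monom_Suc)

lemma ev_at_0: "ev p 0 = complex_of_real (poly p 0)"
  by (cases p) auto

lemma cnj_ev: "cnj (ev p z) = ev p (cnj z)"
  by (induction p) auto

lemma continuous_ev: "continuous_on A (ev p)"
  unfolding ev_def[abs_def] by (intro continuous_intros)

lemma ev_circle_bound:
  obtains B where "0 \<le> B" "\<And>z. z \<in> sphere 0 1 \<Longrightarrow> norm (ev p z) \<le> B"
proof -
  have "compact (ev p ` sphere 0 1)" by (intro compact_continuous_image continuous_ev compact_sphere)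
  then obtain B where "\<And>z. z \<in> sphere 0 1 \<Longrightarrow> norm (ev p z) \<le> B"
    by (meson bounded_iff compact_imp_bounded imageI)
  then show ?thesis using that[of "max 0 B"] by (meson max.cobounded1 max.cobounded2 order_trans)
qed

lemma integral_circle_power_ev: "(\<integral>z. z ^ Suc k * ev p z \<partial>circle_lebesgue) = 0"
proof (induction p arbitrary: k)
  case (pCons a p)
  have "(\<integral>z. z ^ Suc k * ev (pCons a p) z \<partial>circle_lebesgue)
     = (\<integral>z. complex_of_real a * z ^ Suc k + z ^ Suc (Suc k) * ev p z \<partial>circle_lebesgue)"
    by (simp add: algebra_simps)
  also have "\<dots> = complex_of_real a * (\<integral>z. z ^ Suc k \<partial>circle_lebesgue) + (\<integral>z. z ^ Suc (Suc k) * ev p z \<partial>circle_lebesgue)"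
    by (subst Bochner_Integration.integral_add)
       (auto intro!: circle_lebesgue_integrableI continuous_intros continuous_ev simp del: power_Suc)
  also have "\<dots> = 0" using integral_circle_power[of "Suc k"] pCons.IH[of "Suc k"] by (simp del: power_Suc)
  finally show ?case .
qed simp

lemma integral_circle_ev: "(\<integral>z. ev p z \<partial>circle_lebesgue) = complex_of_real (poly p 0)"
proof -
  obtain a q where p: "p = pCons a q" by (cases p)
  have "integrable circle_lebesgue (\<lambda>z. z * ev q z)"
    by (intro circle_lebesgue_integrableI continuous_intros continuous_ev)
  then show ?thesis
    unfolding p using integral_circle_power_ev[of 0 q] circle.prob_space by simp
qed

text \<open>A nonzero polynomial has finitely many roots, so some radius below 1 and arbitrarily
  close to it avoids all their moduli; uniform continuity on the disc controls the change. The value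
  at 0, on which Jensen's inequality depends, stays the same.\<close>

lemma radial_perturbation:
  fixes p :: "complex poly"
  assumes "p \<noteq> 0" "e > 0"
  obtains r :: real where
    "\<And>z. z \<in> sphere 0 1 \<Longrightarrow> poly p (of_real r * z) \<noteq> 0"
    "\<And>z. z \<in> sphere 0 1 \<Longrightarrow> norm (poly p (of_real r * z) - poly p z) < e"
proof -
  have "uniformly_continuous_on (cball 0 1) (poly p)"
    by (intro compact_uniformly_continuous continuous_intros compact_cball)
  then obtain d where d: "d > 0" and
    uc: "\<And>x y. x \<in> cball 0 1 \<Longrightarrow> y \<in> cball 0 1 \<Longrightarrow> dist x y < d \<Longrightarrow> dist (poly p x) (poly p y) < e"
    unfolding uniformly_continuous_on_def using \<open>e > 0\<close> by metis
  have "finite (norm ` {z. poly p z = 0})" using poly_roots_finite[OF \<open>p \<noteq> 0\<close>] by simp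
  moreover have "infinite {max 0 (1 - d)<..<1}" using d by (intro infinite_Ioo) simp
  ultimately have "\<exists>r. r \<in> {max 0 (1 - d)<..<1} \<and> r \<notin> norm ` {z. poly p z = 0}"
    by (meson finite_subset subsetI)
  then obtain r where r: "max 0 (1 - d) < r" "r < 1" "r \<notin> norm ` {z. poly p z = 0}" by auto
  show ?thesis
  proof (rule that[of r])
    fix z :: complex assume z: "z \<in> sphere 0 1"
    have nrm: "norm (of_real r * z) = r" using r z by (simp add: norm_mult)
    show "poly p (of_real r * z) \<noteq> 0" using r(3) nrm by force
    have "dist (of_real r * z) z = norm ((of_real r - 1) * z)" by (simp add: dist_norm algebra_simps)
    also have "\<dots> = \<bar>r - 1\<bar>" using z by (simp add: norm_mult) (metis norm_of_real of_real_1 of_real_diff)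
    also have "\<dots> < d" using r by auto
    finally have "dist (poly p (of_real r * z)) (poly p z) < e"
      using nrm r z by (intro uc) auto
    then show "norm (poly p (of_real r * z) - poly p z) < e" by (simp add: dist_norm)
  qed
qed

lemma radial_Jensen:
  fixes p :: "complex poly"
  assumes "poly p 0 \<noteq> 0" and "\<And>z. z \<in> sphere 0 1 \<Longrightarrow> poly p (of_real r * z) \<noteq> 0"
  shows "ln (norm (poly p 0)) \<le> (\<integral>z. ln (norm (poly p (of_real r * z))) \<partial>circle_lebesgue)"
    and "integrable circle_lebesgue (\<lambda>z. ln (norm (poly p (of_real r * z))))"
  using circle_Jensen_poly[of "pcompose p [:0, of_real r:]"] circle_integrable_ln_poly[of "pcompose p [:0, of_real r:]"] assms
  by (simp_all add: poly_pcompose mult.commute)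

section \<open>The spectral measure and the norms of polynomials\<close>

locale spectral_density = prob_space \<nu> for \<nu> :: "complex measure" +
  fixes f :: "complex \<Rightarrow> real"
  assumes sets_\<nu> [measurable_cong]: "sets \<nu> = sets circle_borel"
    and conj_invariant: "distr \<nu> circle_borel cnj = \<nu>"
    and f_measurable: "f \<in> borel_measurable circle_lebesgue"
    and f_pos: "AE z in circle_lebesgue. 0 < f z"
    and \<nu>_density: "\<nu> = density circle_lebesgue (\<lambda>z. ennreal (f z))"
begin

lemma space_\<nu>: "space \<nu> = sphere 0 1"
  by (rule space_circle[OF sets_\<nu>])

lemma f_nonneg: "AE z in circle_lebesgue. 0 \<le> f z"
  using f_pos by eventually_elim simp

lemma measurable_\<nu>: "borel_measurable \<nu> = borel_measurable circle_lebesgue"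
  by (rule measurable_cong_sets) (simp_all add: sets_\<nu>)

lemma integral_\<nu>:
  fixes g :: "complex \<Rightarrow> 'b::{banach, second_countable_topology}"
  assumes "g \<in> borel_measurable \<nu>"
  shows "(\<integral>z. g z \<partial>\<nu>) = (\<integral>z. f z *\<^sub>R g z \<partial>circle_lebesgue)"
  using assms unfolding measurable_\<nu> by (subst \<nu>_density) (simp add: integral_density f_measurable f_nonneg)

lemma integrable_\<nu>:
  fixes g :: "complex \<Rightarrow> 'b::{banach, second_countable_topology}"
  assumes "g \<in> borel_measurable \<nu>"
  shows "integrable \<nu> g \<longleftrightarrow> integrable circle_lebesgue (\<lambda>z. f z *\<^sub>R g z)"
  using assms unfolding measurable_\<nu> by (subst \<nu>_density) (simp add: integrable_density f_measurable f_nonneg)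

text \<open>Positivity of the density makes the null sets of both measures coincide.\<close>

lemma AE_\<nu>: "(AE z in \<nu>. P z) \<longleftrightarrow> (AE z in circle_lebesgue. P z)"
proof -
  have "(AE z in \<nu>. P z) \<longleftrightarrow> (AE z in circle_lebesgue. 0 < ennreal (f z) \<longrightarrow> P z)"
    by (subst \<nu>_density, rule AE_density) (use f_measurable in measurable)
  also have "\<dots> \<longleftrightarrow> (AE z in circle_lebesgue. P z)"
    by (rule eventually_cong[OF f_pos]) simp
  finally show ?thesis .
qed

lemma f_integrable: "integrable circle_lebesgue f"
proof -
  have "integrable \<nu> (\<lambda>_. 1::real)" by simp
  then show ?thesis by (subst (asm) integrable_\<nu>) auto
qed

lemma measurable_continuous_\<nu>: "continuous_on UNIV g \<Longrightarrow> g \<in> borel_measurable \<nu>"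
  unfolding measurable_\<nu> by (rule continuous_borel_measurable_circle)

lemma integrable_continuous_\<nu>:
  fixes g :: "complex \<Rightarrow> 'b::{banach, second_countable_topology}"
  shows "continuous_on (sphere 0 1) g \<Longrightarrow> integrable \<nu> g"
  by (rule circle_integrableI[OF finite_measure_axioms sets_\<nu>])

lemma ev_measurable: "ev p \<in> borel_measurable \<nu>"
  by (intro measurable_continuous_\<nu> continuous_ev)

lemma sq_integrable_ev: "sq_integrable \<nu> (ev p)"
  unfolding sq_integrable_def
  by (intro conjI ev_measurable integrable_continuous_\<nu> continuous_intros continuous_ev)

text \<open>The squared norm; for the process it is the variance of the linear combination with the
  coefficients of \<open>p\<close>.\<close>

definition nrm :: "real poly \<Rightarrow> real" where
  "nrm p = (\<integral>z. (norm (ev p z))\<^sup>2 \<partial>\<nu>)"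

lemma nrm_nonneg: "0 \<le> nrm p"
  by (simp add: nrm_def)

lemma nrm_monom_mult: "nrm (monom 1 k * p) = nrm p"
  unfolding nrm_def by (intro Bochner_Integration.integral_cong) (auto simp: space_\<nu> norm_mult norm_power)

lemma integral_cnj_\<nu>:
  fixes g :: "complex \<Rightarrow> complex"
  assumes "g \<in> borel_measurable \<nu>"
  shows "(\<integral>z. g (cnj z) \<partial>\<nu>) = (\<integral>z. g z \<partial>\<nu>)"
proof -
  have cnj: "cnj \<in> measurable \<nu> circle_borel"
    unfolding circle_borel_def
    by (rule measurable_restrict_space2) (auto simp: space_\<nu> intro!: measurable_continuous_\<nu> continuous_intros)
  have "g \<in> borel_measurable circle_borel"
    using assms by (simp add: measurable_cong_sets[OF sets_\<nu> refl])
  then have "(\<integral>z. g z \<partial>distr \<nu> circle_borel cnj) = (\<integral>z. g (cnj z) \<partial>\<nu>)"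
    by (rule integral_distr[OF cnj])
  then show ?thesis by (simp add: conj_invariant)
qed

text \<open>Conjugation invariance of the measure makes this integral equal to its own conjugate.
  The minimizing sequences below run over real polynomials and control only real parts of inner
  products; with this lemma they control the complex ones.\<close>

lemma Im_integral_ev:
  "Im (\<integral>z. ev p z * cnj (ev q z) \<partial>\<nu>) = 0"
proof -
  have m: "(\<lambda>z. ev p z * cnj (ev q z)) \<in> borel_measurable \<nu>"
    by (intro measurable_continuous_\<nu> continuous_intros continuous_ev)
  have "cnj (\<integral>z. ev p z * cnj (ev q z) \<partial>\<nu>) = (\<integral>z. cnj (ev p z * cnj (ev q z)) \<partial>\<nu>)"
    by (rule Bochner_Integration.integral_cnj[symmetric])
  also have "\<dots> = (\<integral>z. ev p (cnj z) * cnj (ev q (cnj z)) \<partial>\<nu>)"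
    by (simp add: cnj_ev)
  also have "\<dots> = (\<integral>z. ev p z * cnj (ev q z) \<partial>\<nu>)"
    by (rule integral_cnj_\<nu>[OF m])
  finally show ?thesis by (simp add: complex_eq_iff)
qed

lemma integral_inner_eq_Re:
  fixes u v :: "complex \<Rightarrow> complex"
  assumes "sq_integrable \<nu> u" "sq_integrable \<nu> v"
  shows "(\<integral>z. u z \<bullet> v z \<partial>\<nu>) = Re (\<integral>z. u z * cnj (v z) \<partial>\<nu>)"
proof -
  have "(\<integral>z. u z \<bullet> v z \<partial>\<nu>) = (\<integral>z. Re (u z * cnj (v z)) \<partial>\<nu>)"
    by (simp add: inner_complex_def)
  also have "\<dots> = Re (\<integral>z. u z * cnj (v z) \<partial>\<nu>)"
    by (rule integral_Re) (rule integrable_mult_cnj[OF assms])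
  finally show ?thesis .
qed

lemma sq_integrable_ev_mult:
  assumes "sq_integrable \<nu> h" shows "sq_integrable \<nu> (\<lambda>z. ev q z * h z)"
proof -
  obtain B where "\<And>z. z \<in> sphere 0 1 \<Longrightarrow> norm (ev q z) \<le> B" using ev_circle_bound by metis
  then show ?thesis
    by (intro sq_integrable_cmult[OF assms ev_measurable, where C = B] AE_I2) (simp add: space_\<nu>)
qed

lemma ev_mult_tendsto:
  assumes h: "\<And>n. sq_integrable \<nu> (h n)" and l: "sq_integrable \<nu> l"
    and lim: "(\<lambda>n. \<integral>z. (norm (h n z - l z))\<^sup>2 \<partial>\<nu>) \<longlonglongrightarrow> 0"
  shows "(\<lambda>n. \<integral>z. (norm (ev q z * h n z - ev q z * l z))\<^sup>2 \<partial>\<nu>) \<longlonglongrightarrow> 0"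
proof -
  obtain B where B: "0 \<le> B" "\<And>z. z \<in> sphere 0 1 \<Longrightarrow> norm (ev q z) \<le> B" using ev_circle_bound by metis
  have le: "(\<integral>z. (norm (ev q z * h n z - ev q z * l z))\<^sup>2 \<partial>\<nu>) \<le> B\<^sup>2 * (\<integral>z. (norm (h n z - l z))\<^sup>2 \<partial>\<nu>)" for n
  proof -
    have "(\<integral>z. (norm (ev q z * h n z - ev q z * l z))\<^sup>2 \<partial>\<nu>) \<le> (\<integral>z. B\<^sup>2 * (norm (h n z - l z))\<^sup>2 \<partial>\<nu>)"
    proof (rule integral_mono)
      show "integrable \<nu> (\<lambda>z. (norm (ev q z * h n z - ev q z * l z))\<^sup>2)"
        by (intro sq_integrable_integrable sq_integrable_diff sq_integrable_ev_mult h l)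
      show "integrable \<nu> (\<lambda>z. B\<^sup>2 * (norm (h n z - l z))\<^sup>2)"
        by (intro integrable_mult_right sq_integrable_integrable sq_integrable_diff h l)
      fix z assume "z \<in> space \<nu>"
      then have "(norm (ev q z))\<^sup>2 \<le> B\<^sup>2" using B by (intro power_mono) (auto simp: space_\<nu>)
      then show "(norm (ev q z * h n z - ev q z * l z))\<^sup>2 \<le> B\<^sup>2 * (norm (h n z - l z))\<^sup>2"
        by (simp flip: right_diff_distrib add: norm_mult power_mult_distrib mult_right_mono)
    qed
    then show ?thesis by simp
  qed
  have "(\<lambda>n. B\<^sup>2 * (\<integral>z. (norm (h n z - l z))\<^sup>2 \<partial>\<nu>)) \<longlonglongrightarrow> B\<^sup>2 * 0" by (intro tendsto_intros lim)
  then have lim': "(\<lambda>n. B\<^sup>2 * (\<integral>z. (norm (h n z - l z))\<^sup>2 \<partial>\<nu>)) \<longlonglongrightarrow> 0" by simp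
  show ?thesis
    by (rule tendsto_sandwich[OF _ _ tendsto_const lim']) (use le in auto)
qed

subsection \<open>The innovation\<close>

text \<open>\<open>d\<close> bounds from below the variance of the error in predicting \<open>X\<^sub>0\<close> from finitely many of the
  later coordinates.\<close>

definition unpredictable :: bool where
  "unpredictable \<longleftrightarrow> (\<exists>d>0. \<forall>p. poly p 0 = 1 \<longrightarrow> d \<le> nrm p)"

text \<open>The approximants \<open>p n\<close> and their geometric rate are part of the conclusion,
  because for the process the innovation is accessible only as a limit of finite linear
  combinations.\<close>

lemma innovation_exists:
  assumes unpredictable
  obtains p \<phi> c where "\<And>n. poly (p n) 0 = 1" "0 < c"
    "\<And>n m. n \<le> m \<Longrightarrow> nrm (p m - p n) \<le> 1 / 8 ^ n"
    "sq_integrable \<nu> \<phi>"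
    "(\<lambda>n. \<integral>z. (norm (ev (p n) z - \<phi> z))\<^sup>2 \<partial>\<nu>) \<longlonglongrightarrow> 0"
    "\<And>q. (\<integral>z. \<phi> z * cnj (ev (pCons 0 q) z) \<partial>\<nu>) = 0"
    "AE z in circle_lebesgue. (norm (\<phi> z))\<^sup>2 * f z = c"
proof -
  obtain d where d: "d > 0" "\<And>p. poly p 0 = 1 \<Longrightarrow> d \<le> nrm p"
    using assms unfolding unpredictable_def by metis
  have one: "sq_integrable \<nu> (\<lambda>_. 1 :: complex)" by (simp add: sq_integrable_def)
  \<comment> \<open>The constant 1 is approximated by polynomials without constant term, that is,
    \<open>X_0\<close> by combinations of later coordinates. The residuals
    \<open>1 - pCons 0 (q n)\<close> have constant term 1.\<close>
  obtain q where
    vc: "\<And>n m. n \<le> m \<Longrightarrow> (\<integral>x. (norm (ev (pCons 0 (q m)) x - ev (pCons 0 (q n)) x))\<^sup>2 \<partial>\<nu>) \<le> 1 / 8 ^ n"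
    and vo: "\<And>n r. (\<integral>x. (1 - ev (pCons 0 (q n)) x) \<bullet> ev (pCons 0 r) x \<partial>\<nu>)\<^sup>2 \<le> (\<integral>x. (norm (ev (pCons 0 r) x))\<^sup>2 \<partial>\<nu>) / 8 ^ n"
  proof (rule almost_minimizing_sequence[OF one, of "\<lambda>q. ev (pCons 0 q)"])
    show "\<exists>r. ev (pCons 0 r) = (\<lambda>x. ev (pCons 0 p) x + ev (pCons 0 q) x)" for p q
      by (rule exI[of _ "p + q"]) (auto simp: algebra_simps)
    show "\<exists>r. ev (pCons 0 r) = (\<lambda>x. c *\<^sub>R ev (pCons 0 p) x)" for c p
      by (rule exI[of _ "smult c p"]) (auto simp: scaleR_conv_of_real)
    show "sq_integrable \<nu> (ev (pCons 0 p))" for p by (rule sq_integrable_ev)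
  qed (rule that; assumption)
  define p where "p n = 1 - pCons 0 (q n)" for n
  have p0: "poly (p n) 0 = 1" for n by (simp add: p_def)
  have evp: "ev (p n) z = 1 - ev (pCons 0 (q n)) z" for n z by (simp add: p_def)
  have pc: "nrm (p m - p n) \<le> 1 / 8 ^ n" if "n \<le> m" for n m
  proof -
    have "norm (ev (p m - p n) z) = norm (ev (pCons 0 (q m)) z - ev (pCons 0 (q n)) z)" for z
      by (simp only: ev_diff evp) (simp add: norm_minus_commute del: ev_pCons)
    then show ?thesis using vc[OF that] by (simp only: nrm_def)
  qed
  have po: "(Re (\<integral>z. ev (p n) z * cnj (ev (pCons 0 r) z) \<partial>\<nu>))\<^sup>2 \<le> nrm (pCons 0 r) / 8 ^ n" for n r
    using vo[of n r] integral_inner_eq_Re[OF sq_integrable_ev[of "p n"] sq_integrable_ev[of "pCons 0 r"]]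
    by (simp add: nrm_def evp del: ev_pCons)
  define \<phi> where "\<phi> z = lim (\<lambda>n. ev (p n) z)" for z
  have cauchy: "(\<integral>z. (norm (ev (p m) z - ev (p n) z))\<^sup>2 \<partial>\<nu>) \<le> 1 / 8 ^ n" if "n \<le> m" for n m
    using pc[OF that] by (simp add: nrm_def)
  note L = L2_Cauchy_limit[of \<nu> "\<lambda>n. ev (p n)", OF sq_integrable_ev cauchy, folded \<phi>_def]
  have \<phi>: "sq_integrable \<nu> \<phi>" using L(2) by (simp add: \<phi>_def[abs_def])
  have lim: "(\<lambda>n. \<integral>z. (norm (ev (p n) z - \<phi> z))\<^sup>2 \<partial>\<nu>) \<longlonglongrightarrow> 0" by (rule L(4))
  note T = tendsto_integral_mult_cnj[of \<nu> "\<lambda>n. ev (p n)" "\<lambda>n. w n" \<phi> w' for w w', OF sq_integrable_ev _ \<phi> _ lim]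
  \<comment> \<open>The test polynomial may vary with \<open>n\<close> as long as its norm stays
    bounded. This permits testing with \<open>z ^ Suc k * p n\<close>, which changes together with
    the approximant.\<close>
  have ortho0: "(\<lambda>n. \<integral>z. ev (p n) z * cnj (ev (pCons 0 (r n)) z) \<partial>\<nu>) \<longlonglongrightarrow> 0"
    if K: "\<And>n. nrm (pCons 0 (r n)) \<le> K" for r K
  proof -
    have "(\<lambda>n. Re (\<integral>z. ev (p n) z * cnj (ev (pCons 0 (r n)) z) \<partial>\<nu>)) \<longlonglongrightarrow> 0"
    proof (rule tendsto_0_of_sq_le)
      fix n
      have "nrm (pCons 0 (r n)) / 8 ^ n \<le> K / 8 ^ n" using K[of n] by (intro divide_right_mono) auto
      then show "(Re (\<integral>z. ev (p n) z * cnj (ev (pCons 0 (r n)) z) \<partial>\<nu>))\<^sup>2 \<le> K / 8 ^ n"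
        using po[of n "r n"] by linarith
    qed
    then show ?thesis by (simp add: tendsto_complex_iff Im_integral_ev del: ev_pCons)
  qed
  have orth: "(\<integral>z. \<phi> z * cnj (ev (pCons 0 r) z) \<partial>\<nu>) = 0" for r
  proof (rule LIMSEQ_unique)
    show "(\<lambda>n. \<integral>z. ev (p n) z * cnj (ev (pCons 0 r) z) \<partial>\<nu>) \<longlonglongrightarrow> 0"
      by (rule ortho0) (rule order_refl)
    show "(\<lambda>n. \<integral>z. ev (p n) z * cnj (ev (pCons 0 r) z) \<partial>\<nu>) \<longlonglongrightarrow> (\<integral>z. \<phi> z * cnj (ev (pCons 0 r) z) \<partial>\<nu>)"
      by (rule T[OF sq_integrable_ev sq_integrable_ev]) simp
  qed
  define c where "c = (\<integral>z. (norm (\<phi> z))\<^sup>2 \<partial>\<nu>)"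
  have int_sq: "(\<integral>z. u z * cnj (u z) \<partial>\<nu>) = complex_of_real (\<integral>z. (norm (u z))\<^sup>2 \<partial>\<nu>)" for u
    by (simp flip: complex_norm_square integral_complex_of_real of_real_power)
  have nrm_lim: "(\<lambda>n. nrm (p n)) \<longlonglongrightarrow> c"
  proof -
    have "(\<lambda>n. complex_of_real (nrm (p n))) \<longlonglongrightarrow> complex_of_real c"
      using T[OF sq_integrable_ev \<phi> lim] unfolding int_sq nrm_def c_def .
    then show ?thesis by (simp add: tendsto_of_real_iff)
  qed
  \<comment> \<open>Here unpredictability enters: the lower bound for all residuals survives in the
    limit and keeps \<open>\<phi>\<close> away from 0.\<close>
  have "d \<le> c" by (rule LIMSEQ_le_const[OF nrm_lim]) (use d(2) p0 in blast)
  then have c: "c > 0" using d by simp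
  obtain K where K: "\<And>n. nrm (p n) \<le> K"
    using convergent_imp_Bseq[OF convergentI[OF nrm_lim]] by (auto simp: Bseq_def nrm_nonneg)
  \<comment> \<open>The multiples \<open>z ^ Suc k * p n\<close> have no constant term, so the
    residuals are asymptotically orthogonal to them; in the limit this says that
    \<open>|\<phi>|^2\<close> has no coefficient at nonzero frequencies.\<close>
  have zk: "(\<integral>z. z ^ Suc k * (\<phi> z * cnj (\<phi> z)) \<partial>\<nu>) = 0" for k
  proof -
    have "(\<lambda>n. \<integral>z. ev (p n) z * cnj (ev (monom 1 (Suc k)) z * ev (p n) z) \<partial>\<nu>)
       \<longlonglongrightarrow> (\<integral>z. \<phi> z * cnj (ev (monom 1 (Suc k)) z * \<phi> z) \<partial>\<nu>)"
      by (intro T sq_integrable_ev_mult sq_integrable_ev \<phi> ev_mult_tendsto lim)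
    moreover have "(\<lambda>n. \<integral>z. ev (p n) z * cnj (ev (monom 1 (Suc k)) z * ev (p n) z) \<partial>\<nu>) \<longlonglongrightarrow> 0"
    proof -
      have eq: "pCons 0 (monom 1 k * p n) = monom 1 (Suc k) * p n" for n by (simp add: monom_Suc)
      have "nrm (pCons 0 (monom 1 k * p n)) \<le> K" for n
        unfolding eq nrm_monom_mult by (rule K)
      from ortho0[OF this] show ?thesis unfolding eq ev_mult .
    qed
    ultimately have "(\<integral>z. \<phi> z * cnj (ev (monom 1 (Suc k)) z * \<phi> z) \<partial>\<nu>) = 0" by (rule LIMSEQ_unique)
    then have "cnj (\<integral>z. \<phi> z * cnj (ev (monom 1 (Suc k)) z * \<phi> z) \<partial>\<nu>) = 0" by simp
    then show ?thesis by (simp add: Bochner_Integration.integral_cnj[symmetric] mult_ac del: Bochner_Integration.integral_cnj)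
  qed
  have \<phi>m: "\<phi> \<in> borel_measurable \<nu>" using \<phi> by (simp add: sq_integrable_def)
  have cnjm [measurable]: "cnj \<in> borel_measurable borel"
    by (intro borel_measurable_continuous_onI continuous_intros)
  have \<phi>\<phi>m: "(\<lambda>z. \<phi> z * cnj (\<phi> z)) \<in> borel_measurable \<nu>" using \<phi>m by measurable
  \<comment> \<open>\<open>c\<close> is the mean of \<open>|\<phi>|^2 f\<close>, so the coefficient
    of \<open>g\<close> at frequency 0 vanishes as well. As \<open>g\<close> is real-valued, its
    negative frequencies follow by conjugation.\<close>
  define g where "g z = f z *\<^sub>R (\<phi> z * cnj (\<phi> z)) - complex_of_real c" for z
  have I1: "integrable circle_lebesgue (\<lambda>z. f z *\<^sub>R (\<phi> z * cnj (\<phi> z)))"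
    using integrable_mult_cnj[OF \<phi> \<phi>] integrable_\<nu>[OF \<phi>\<phi>m] by simp
  have gint: "integrable circle_lebesgue g" unfolding g_def using I1 by simp
  have gk: "(\<integral>z. z ^ k * g z \<partial>circle_lebesgue) = 0" for k
  proof -
    have "(\<integral>z. z ^ k * g z \<partial>circle_lebesgue) = (\<integral>z. z ^ k * (f z *\<^sub>R (\<phi> z * cnj (\<phi> z))) - complex_of_real c * z ^ k \<partial>circle_lebesgue)"
      by (simp add: g_def algebra_simps)
    also have "\<dots> = (\<integral>z. z ^ k * (f z *\<^sub>R (\<phi> z * cnj (\<phi> z))) \<partial>circle_lebesgue) - complex_of_real c * (\<integral>z. z ^ k \<partial>circle_lebesgue)"
    proof (subst Bochner_Integration.integral_diff)
      show "integrable circle_lebesgue (\<lambda>z. z ^ k * (f z *\<^sub>R (\<phi> z * cnj (\<phi> z))))"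
        by (rule integrable_circle_power_mult[OF I1])
      show "integrable circle_lebesgue (\<lambda>z. complex_of_real c * z ^ k)"
        by (intro circle_lebesgue_integrableI continuous_intros)
    qed simp
    also have "(\<integral>z. z ^ k * (f z *\<^sub>R (\<phi> z * cnj (\<phi> z))) \<partial>circle_lebesgue) = (\<integral>z. z ^ k * (\<phi> z * cnj (\<phi> z)) \<partial>\<nu>)"
    proof (subst integral_\<nu>)
      show "(\<lambda>z. z ^ k * (\<phi> z * cnj (\<phi> z))) \<in> borel_measurable \<nu>"
        by (intro borel_measurable_times \<phi>\<phi>m measurable_continuous_\<nu> continuous_intros)
    qed simp
    also have "\<dots> - complex_of_real c * (\<integral>z. z ^ k \<partial>circle_lebesgue) = 0"
    proof (cases k)
      case 0
      then show ?thesis using int_sq[of \<phi>] circle.prob_space by (simp add: c_def)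
    next
      case (Suc j)
      then show ?thesis using zk[of j] integral_circle_power[of k] by simp
    qed
    finally show ?thesis .
  qed
  have gk': "(\<integral>z. cnj z ^ k * g z \<partial>circle_lebesgue) = 0" for k
  proof -
    have "cnj (g z) = g z" for z by (simp add: g_def mult.commute scaleR_conv_of_real)
    then have "cnj z ^ k * g z = cnj (z ^ k * g z)" for z by simp
    then have "(\<integral>z. cnj z ^ k * g z \<partial>circle_lebesgue) = cnj (\<integral>z. z ^ k * g z \<partial>circle_lebesgue)"
      by (simp only: Bochner_Integration.integral_cnj)
    then show ?thesis by (simp add: gk)
  qed
  have "AE z in circle_lebesgue. g z = 0"
    by (rule fourier_null_AE_zero) (simp add: fourier_null_def gint gk gk')
  then have AE: "AE z in circle_lebesgue. (norm (\<phi> z))\<^sup>2 * f z = c"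
  proof eventually_elim
    case (elim z)
    have "complex_of_real ((norm (\<phi> z))\<^sup>2 * f z) = complex_of_real c"
      using elim by (simp add: g_def scaleR_conv_of_real mult.commute flip: complex_norm_square of_real_power)
    then show ?case by (simp only: of_real_eq_iff)
  qed
  show ?thesis
    by (rule that[of p c \<phi>]) (rule p0 c pc \<phi> lim orth AE; assumption)+
qed

end

context spectral_density begin

text \<open>The statement is that 1 lies in the closure of the polynomial multiples of
  \<open>\<phi>\<close>. The residual \<open>l\<close> of this approximation satisfies
  \<open>l cnj(\<phi>) f = 0\<close> by uniqueness of Fourier coefficients, hence
  \<open>l = 0\<close>.\<close>

lemma innovation_invertible:
  assumes c: "0 < c" and \<phi>: "sq_integrable \<nu> \<phi>"
    and lim: "(\<lambda>n. \<integral>z. (norm (ev (p n) z - \<phi> z))\<^sup>2 \<partial>\<nu>) \<longlonglongrightarrow> 0" and p0: "\<And>n. poly (p n) 0 = 1"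
    and orth: "\<And>q. (\<integral>z. \<phi> z * cnj (ev (pCons 0 q) z) \<partial>\<nu>) = 0"
    and flat: "AE z in circle_lebesgue. (norm (\<phi> z))\<^sup>2 * f z = c"
  obtains q where "\<And>n. (\<integral>z. (norm (1 - ev (q n) z * \<phi> z))\<^sup>2 \<partial>\<nu>) \<le> 1 / 8 ^ n"
    "(\<lambda>n. poly (q n) 0) \<longlonglongrightarrow> 1"
    "AE z in circle_lebesgue. (\<lambda>n. ev (q n) z * \<phi> z) \<longlonglongrightarrow> 1"
proof -
  have one: "sq_integrable \<nu> (\<lambda>_. 1 :: complex)" by (simp add: sq_integrable_def)
  have \<phi>m: "\<phi> \<in> borel_measurable \<nu>" using \<phi> by (simp add: sq_integrable_def)
  have cnjm [measurable]: "cnj \<in> borel_measurable borel"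
    by (intro borel_measurable_continuous_onI continuous_intros)
  \<comment> \<open>Against \<open>|\<phi>|^2\<close> the measure becomes \<open>c\<close> times
    Lebesgue measure, whose mean value property picks out the constant term.\<close>
  have \<phi>\<phi>: "(\<integral>z. ev r z * (\<phi> z * cnj (\<phi> z)) \<partial>\<nu>) = complex_of_real (c * poly r 0)" for r
  proof -
    have "(\<integral>z. ev r z * (\<phi> z * cnj (\<phi> z)) \<partial>\<nu>) = (\<integral>z. f z *\<^sub>R (ev r z * (\<phi> z * cnj (\<phi> z))) \<partial>circle_lebesgue)"
      by (rule integral_\<nu>) (use \<phi>m ev_measurable in measurable)
    also have "\<dots> = (\<integral>z. complex_of_real c * ev r z \<partial>circle_lebesgue)"
    proof (rule integral_cong_AE)
      show "(\<lambda>z. f z *\<^sub>R (ev r z * (\<phi> z * cnj (\<phi> z)))) \<in> borel_measurable circle_lebesgue"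
        using \<phi>m ev_measurable f_measurable unfolding measurable_\<nu> by measurable
      show "(\<lambda>z. complex_of_real c * ev r z) \<in> borel_measurable circle_lebesgue"
        using ev_measurable unfolding measurable_\<nu> by measurable
      show "AE z in circle_lebesgue. f z *\<^sub>R (ev r z * (\<phi> z * cnj (\<phi> z))) = complex_of_real c * ev r z"
        using flat
      proof eventually_elim
        case (elim z)
        have "f z *\<^sub>R (ev r z * (\<phi> z * cnj (\<phi> z))) = complex_of_real ((norm (\<phi> z))\<^sup>2 * f z) * ev r z"
          by (simp add: scaleR_conv_of_real mult_ac flip: complex_norm_square of_real_power)
        then show ?case by (simp only: elim)
      qed
    qed
    also have "\<dots> = complex_of_real c * (\<integral>z. ev r z \<partial>circle_lebesgue)" by simp
    finally show ?thesis by (simp add: integral_circle_ev)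
  qed
  obtain q where
    vc: "\<And>n m. n \<le> m \<Longrightarrow> (\<integral>x. (norm (ev (q m) x * \<phi> x - ev (q n) x * \<phi> x))\<^sup>2 \<partial>\<nu>) \<le> 1 / 8 ^ n"
    and vo: "\<And>n r. (\<integral>x. (1 - ev (q n) x * \<phi> x) \<bullet> (ev r x * \<phi> x) \<partial>\<nu>)\<^sup>2 \<le> (\<integral>x. (norm (ev r x * \<phi> x))\<^sup>2 \<partial>\<nu>) / 8 ^ n"
  proof (rule almost_minimizing_sequence[OF one, of "\<lambda>q z. ev q z * \<phi> z"])
    show "\<exists>r. (\<lambda>x. ev r x * \<phi> x) = (\<lambda>x. ev p x * \<phi> x + ev q x * \<phi> x)" for p q
      by (rule exI[of _ "p + q"]) (auto simp: algebra_simps)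
    show "\<exists>r. (\<lambda>x. ev r x * \<phi> x) = (\<lambda>x. c *\<^sub>R (ev p x * \<phi> x))" for c p
      by (rule exI[of _ "smult c p"]) (auto simp: scaleR_conv_of_real)
    show "sq_integrable \<nu> (\<lambda>x. ev p x * \<phi> x)" for p by (rule sq_integrable_ev_mult[OF \<phi>])
  qed (rule that; assumption)
  define h where "h n z = 1 - ev (q n) z * \<phi> z" for n z
  have h: "sq_integrable \<nu> (h n)" for n
    unfolding h_def by (intro sq_integrable_diff one sq_integrable_ev_mult \<phi>)
  have hc: "(\<integral>z. (norm (h m z - h n z))\<^sup>2 \<partial>\<nu>) \<le> 1 / 8 ^ n" if "n \<le> m" for n m
    using vc[OF that] by (simp add: h_def norm_minus_commute)
  define l where "l z = lim (\<lambda>n. h n z)" for z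
  note L = L2_Cauchy_limit[of \<nu> h, OF h hc, folded l_def]
  have l: "sq_integrable \<nu> l" using L(2) by (simp add: l_def[abs_def])
  have hl_AE: "AE z in \<nu>. (\<lambda>n. h n z) \<longlonglongrightarrow> l z" by (rule L(1))
  have hl: "(\<lambda>n. \<integral>z. (norm (h n z - l z))\<^sup>2 \<partial>\<nu>) \<longlonglongrightarrow> 0" by (rule L(4))
  have H: "(\<lambda>n. \<integral>z. h n z * cnj (ev r z * \<phi> z) \<partial>\<nu>) \<longlonglongrightarrow> (\<integral>z. l z * cnj (ev r z * \<phi> z) \<partial>\<nu>)" for r
    by (rule tendsto_integral_mult_cnj[OF h _ l _ hl]) (simp_all add: sq_integrable_ev_mult[OF \<phi>])
  \<comment> \<open>\<open>\<phi>\<close> is only a limit of real polynomials, so the vanishing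
    imaginary part is inherited from the approximants \<open>p m\<close>.\<close>
  have Im0: "Im (\<integral>z. h n z * cnj (ev r z * \<phi> z) \<partial>\<nu>) = 0" for n r
  proof -
    have hn: "h n z = ev (- q n) z * \<phi> z + 1" for z by (simp add: h_def)
    have "(\<lambda>m. \<integral>z. ev (1 - q n * p m) z * cnj (ev r z * ev (p m) z) \<partial>\<nu>) \<longlonglongrightarrow> (\<integral>z. h n z * cnj (ev r z * \<phi> z) \<partial>\<nu>)"
    proof (rule tendsto_integral_mult_cnj)
      have "(\<lambda>m. \<integral>z. (norm (ev (- q n) z * ev (p m) z - ev (- q n) z * \<phi> z))\<^sup>2 \<partial>\<nu>) \<longlonglongrightarrow> 0"
        by (rule ev_mult_tendsto[OF sq_integrable_ev \<phi> lim])
      then show "(\<lambda>m. \<integral>z. (norm (ev (1 - q n * p m) z - h n z))\<^sup>2 \<partial>\<nu>) \<longlonglongrightarrow> 0"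
        by (simp add: hn)
      show "(\<lambda>m. \<integral>z. (norm (ev r z * ev (p m) z - ev r z * \<phi> z))\<^sup>2 \<partial>\<nu>) \<longlonglongrightarrow> 0"
        by (rule ev_mult_tendsto[OF sq_integrable_ev \<phi> lim])
    qed (intro sq_integrable_ev sq_integrable_ev_mult h \<phi>)+
    then have "(\<lambda>m. Im (\<integral>z. ev (1 - q n * p m) z * cnj (ev (r * p m) z) \<partial>\<nu>)) \<longlonglongrightarrow> Im (\<integral>z. h n z * cnj (ev r z * \<phi> z) \<partial>\<nu>)"
      by (intro tendsto_Im) simp
    then show ?thesis unfolding Im_integral_ev by (simp add: LIMSEQ_const_iff)
  qed
  have J: "(\<integral>z. l z * cnj (ev r z * \<phi> z) \<partial>\<nu>) = 0" for r
  proof (rule LIMSEQ_unique[OF H])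
    have "(\<lambda>n. Re (\<integral>z. h n z * cnj (ev r z * \<phi> z) \<partial>\<nu>)) \<longlonglongrightarrow> 0"
    proof (rule tendsto_0_of_sq_le)
      fix n
      from vo[of n r] show "(Re (\<integral>z. h n z * cnj (ev r z * \<phi> z) \<partial>\<nu>))\<^sup>2 \<le> (\<integral>z. (norm (ev r z * \<phi> z))\<^sup>2 \<partial>\<nu>) / 8 ^ n"
        using integral_inner_eq_Re[OF h[of n] sq_integrable_ev_mult[OF \<phi>, of r]] by (simp add: h_def)
    qed
    then show "(\<lambda>n. \<integral>z. h n z * cnj (ev r z * \<phi> z) \<partial>\<nu>) \<longlonglongrightarrow> 0"
      by (simp only: tendsto_complex_iff Im0 zero_complex.simps tendsto_const simp_thms)
  qed
  \<comment> \<open>The frequencies not reached by the residual property. The integrand splits into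
    \<open>z ^ Suc k * cnj (\<phi> z)\<close>, killed by \<open>orth\<close>, and
    \<open>z ^ Suc k * ev (q n) z * |\<phi>|^2\<close>, whose integral is \<open>c\<close> times a
    vanishing constant term.\<close>
  have J': "(\<integral>z. z ^ Suc k * (l z * cnj (\<phi> z)) \<partial>\<nu>) = 0" for k
  proof -
    let ?m = "\<lambda>z. cnj z ^ Suc k * \<phi> z"
    have mI: "sq_integrable \<nu> ?m"
      by (rule sq_integrable_cmult[OF \<phi> measurable_continuous_\<nu>, where C = 1])
         (auto intro!: continuous_intros AE_I2 simp: space_\<nu> norm_mult norm_power simp del: power_Suc)
    have "(\<lambda>n. \<integral>z. h n z * cnj (?m z) \<partial>\<nu>) \<longlonglongrightarrow> (\<integral>z. l z * cnj (?m z) \<partial>\<nu>)"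
      by (rule tendsto_integral_mult_cnj[OF h mI l mI hl]) simp
    moreover have "(\<integral>z. h n z * cnj (?m z) \<partial>\<nu>) = 0" for n
    proof -
      have a: "(\<integral>z. cnj (\<phi> z * cnj (ev (pCons 0 (monom 1 k)) z)) \<partial>\<nu>) = 0"
        unfolding Bochner_Integration.integral_cnj orth by simp
      have ai: "integrable \<nu> (\<lambda>z. cnj (\<phi> z * cnj (ev (pCons 0 (monom 1 k)) z)))"
        by (intro integrable_cnj integrable_mult_cnj \<phi> sq_integrable_ev)
      have b: "(\<integral>z. ev (monom 1 (Suc k) * q n) z * (\<phi> z * cnj (\<phi> z)) \<partial>\<nu>) = 0"
        unfolding \<phi>\<phi> by (simp add: poly_monom)
      have bi: "integrable \<nu> (\<lambda>z. ev (monom 1 (Suc k) * q n) z * (\<phi> z * cnj (\<phi> z)))"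
        using integrable_mult_cnj[OF sq_integrable_ev_mult[OF \<phi>] \<phi>] by (simp add: mult.assoc del: ev_mult)
      have "h n z * cnj (?m z) = cnj (\<phi> z * cnj (ev (pCons 0 (monom 1 k)) z))
         - ev (monom 1 (Suc k) * q n) z * (\<phi> z * cnj (\<phi> z))" for z
        by (simp add: h_def algebra_simps)
      then have "(\<integral>z. h n z * cnj (?m z) \<partial>\<nu>) = (\<integral>z. cnj (\<phi> z * cnj (ev (pCons 0 (monom 1 k)) z)) \<partial>\<nu>)
         - (\<integral>z. ev (monom 1 (Suc k) * q n) z * (\<phi> z * cnj (\<phi> z)) \<partial>\<nu>)"
        by (simp only: Bochner_Integration.integral_diff[OF ai bi])
      then show ?thesis by (simp only: a b diff_zero)
    qed
    ultimately have "(\<integral>z. l z * cnj (?m z) \<partial>\<nu>) = 0" by (simp add: LIMSEQ_const_iff)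
    then show ?thesis by (simp add: mult_ac)
  qed
  have lm: "l \<in> borel_measurable \<nu>" using l by (simp add: sq_integrable_def)
  define g where "g z = f z *\<^sub>R (l z * cnj (\<phi> z))" for z
  have gm: "(\<lambda>z. w z * (l z * cnj (\<phi> z))) \<in> borel_measurable \<nu>" if "continuous_on UNIV w" for w
    using lm \<phi>m measurable_continuous_\<nu>[OF that] by measurable
  have eq: "(\<integral>z. w z * g z \<partial>circle_lebesgue) = (\<integral>z. w z * (l z * cnj (\<phi> z)) \<partial>\<nu>)" if "continuous_on UNIV w" for w
    using integral_\<nu>[OF gm[OF that]] by (simp add: g_def)
  have "fourier_null g"
    unfolding fourier_null_def
  proof (intro conjI allI)
    have "(\<lambda>z. l z * cnj (\<phi> z)) \<in> borel_measurable \<nu>" using gm[of "\<lambda>_. 1"] by simp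
    from integrable_\<nu>[OF this] show "integrable circle_lebesgue g"
      using integrable_mult_cnj[OF l \<phi>] by (simp add: g_def[abs_def])
    fix k
    show "(\<integral>z. z ^ k * g z \<partial>circle_lebesgue) = 0"
    proof (cases k)
      case 0
      then show ?thesis using J[of 1] by (subst eq) (auto intro!: continuous_intros)
    next
      case (Suc j)
      then show ?thesis using J'[of j] by (subst eq) (auto intro!: continuous_intros)
    qed
    show "(\<integral>z. cnj z ^ k * g z \<partial>circle_lebesgue) = 0"
      using J[of "monom 1 k"] by (subst eq) (auto intro!: continuous_intros simp: mult_ac)
  qed
  then have "AE z in circle_lebesgue. g z = 0" by (rule fourier_null_AE_zero)
  \<comment> \<open>Since \<open>|\<phi>|^2 f = c > 0\<close>, neither \<open>\<phi>\<close> nor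
    \<open>f\<close> vanishes, so both can be cancelled.\<close>
  then have "AE z in circle_lebesgue. l z = 0"
    using flat f_pos
  proof eventually_elim
    case (elim z)
    then show ?case using c by (auto simp: g_def)
  qed
  then have l0: "AE z in \<nu>. l z = 0" by (simp add: AE_\<nu>)
  have small: "(\<integral>z. (norm (1 - ev (q n) z * \<phi> z))\<^sup>2 \<partial>\<nu>) \<le> 1 / 8 ^ n" for n
  proof -
    have "(\<integral>z. (norm (1 - ev (q n) z * \<phi> z))\<^sup>2 \<partial>\<nu>) = (\<integral>z. (norm (h n z - l z))\<^sup>2 \<partial>\<nu>)"
      by (rule integral_cong_AE)
         (use l0 lm \<phi>m ev_measurable in \<open>auto simp: h_def elim!: eventually_mono\<close>)
    also have "\<dots> \<le> 1 / 8 ^ n" by (rule L(3))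
    finally show ?thesis .
  qed
  have AE: "AE z in circle_lebesgue. (\<lambda>n. ev (q n) z * \<phi> z) \<longlonglongrightarrow> 1"
  proof -
    have "AE z in \<nu>. (\<lambda>n. ev (q n) z * \<phi> z) \<longlonglongrightarrow> 1"
      using hl_AE l0
    proof eventually_elim
      case (elim z)
      then have "(\<lambda>n. 1 - h n z) \<longlonglongrightarrow> 1 - 0" by (intro tendsto_intros) simp
      then show ?case by (simp add: h_def)
    qed
    then show ?thesis by (simp add: AE_\<nu>)
  qed
  \<comment> \<open>Each \<open>p n\<close> is 1 plus a polynomial orthogonal to
    \<open>\<phi>\<close>, so the integral of \<open>\<phi>\<close> against \<open>p n\<close> does
    not depend on \<open>n\<close>; in the limit it is the squared norm \<open>c\<close> of
    \<open>\<phi>\<close>.\<close>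
  have int\<phi>: "(\<integral>z. cnj (\<phi> z) \<partial>\<nu>) = complex_of_real c"
  proof -
    have "(\<lambda>n. \<integral>z. \<phi> z * cnj (ev (p n) z) \<partial>\<nu>) \<longlonglongrightarrow> (\<integral>z. \<phi> z * cnj (\<phi> z) \<partial>\<nu>)"
      by (rule tendsto_integral_mult_cnj[OF \<phi> sq_integrable_ev \<phi> \<phi> _ lim]) simp
    moreover have "(\<integral>z. \<phi> z * cnj (ev (p n) z) \<partial>\<nu>) = (\<integral>z. \<phi> z \<partial>\<nu>)" for n
    proof -
      obtain a r where "p n = pCons a r" by (cases "p n")
      then have "p n = 1 + pCons 0 r" using p0[of n] by (simp add: one_pCons)
      then have "\<phi> z * cnj (ev (p n) z) = \<phi> z * cnj 1 + \<phi> z * cnj (ev (pCons 0 r) z)" for z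
        by (simp only: ev_add ev_1) (simp add: algebra_simps)
      then show ?thesis
        using integrable_mult_cnj[OF \<phi> one] integrable_mult_cnj[OF \<phi> sq_integrable_ev[of "pCons 0 r"]] orth[of r]
        by (simp del: ev_pCons)
    qed
    ultimately have "(\<integral>z. \<phi> z \<partial>\<nu>) = (\<integral>z. \<phi> z * cnj (\<phi> z) \<partial>\<nu>)" by (simp add: LIMSEQ_const_iff)
    also have "\<dots> = complex_of_real c" using \<phi>\<phi>[of 1] by simp
    finally show ?thesis by simp
  qed
  \<comment> \<open>Pairing \<open>q n * \<phi>\<close> and its limit 1 with \<open>\<phi>\<close>
    gives \<open>c * poly (q n) 0\<close> and \<open>c\<close>. These constant terms are the values
    at which Jensen's inequality is used later.\<close>
  have "(\<lambda>n. poly (q n) 0) \<longlonglongrightarrow> 1"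
  proof -
    have "(\<lambda>n. \<integral>z. (norm (ev (q n) z * \<phi> z - 1))\<^sup>2 \<partial>\<nu>) \<longlonglongrightarrow> 0"
    proof (rule tendsto_sandwich[OF _ _ tendsto_const])
      have "(\<lambda>n. (1/8::real) ^ n) \<longlonglongrightarrow> 0" by (intro LIMSEQ_realpow_zero) auto
      then show "(\<lambda>n. 1 / 8 ^ n :: real) \<longlonglongrightarrow> 0" by (simp add: power_divide)
    qed (use small in \<open>auto simp: norm_minus_commute\<close>)
    then have "(\<lambda>n. \<integral>z. ev (q n) z * \<phi> z * cnj (\<phi> z) \<partial>\<nu>) \<longlonglongrightarrow> (\<integral>z. 1 * cnj (\<phi> z) \<partial>\<nu>)"
      by (intro tendsto_integral_mult_cnj sq_integrable_ev_mult \<phi> one) auto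
    then have "(\<lambda>n. complex_of_real (c * poly (q n) 0)) \<longlonglongrightarrow> complex_of_real c"
      using int\<phi> by (simp add: mult.assoc \<phi>\<phi>)
    then have "(\<lambda>n. c * poly (q n) 0 / c) \<longlonglongrightarrow> c / c"
      using c by (intro tendsto_divide tendsto_const) (auto simp only: tendsto_of_real_iff)
    then show ?thesis using c by simp
  qed
  with that[of q] small AE show ?thesis by blast
qed

end

subsection \<open>Szego's criterion\<close>

context spectral_density begin

text \<open>The lower bound is the geometric mean of \<open>f\<close>. The integral of
  \<open>|p|^2 f\<close> is at least the exponential of the mean of \<open>ln f + 2 ln |p|\<close>,
  and for constant term 1 Jensen's inequality makes the mean of \<open>ln |p|\<close>
  nonnegative.\<close>

lemma unpredictable_if_ln_integrable:
  assumes ln_int: "integrable circle_lebesgue (\<lambda>z. ln (f z))"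
  shows unpredictable
  unfolding unpredictable_def
proof (intro exI conjI allI impI)
  let ?c = "\<integral>z. ln (f z) \<partial>circle_lebesgue"
  show "0 < exp ?c" by simp
  fix p :: "real poly" assume p0: "poly p 0 = 1"
  let ?P = "map_poly complex_of_real p"
  have P0: "poly ?P 0 = 1" using ev_at_0[of p] p0 by (simp add: ev_def)
  then have Pnz: "?P \<noteq> 0" by auto
  obtain B where B: "0 \<le> B" "\<And>z. z \<in> sphere 0 1 \<Longrightarrow> norm (ev p z) \<le> B" using ev_circle_bound by metis
  have "exp ?c \<le> nrm p + e * (2 * B + 1)" if e: "0 < e" "e < 1" for e
  proof -
    obtain r where r: "\<And>z. z \<in> sphere 0 1 \<Longrightarrow> poly ?P (of_real r * z) \<noteq> 0"
      "\<And>z. z \<in> sphere 0 1 \<Longrightarrow> norm (poly ?P (of_real r * z) - poly ?P z) < e"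
      using radial_perturbation[OF Pnz e(1)] by blast
    define Q where "Q z = poly ?P (of_real r * z)" for z
    have contQ: "continuous_on A Q" for A unfolding Q_def by (intro continuous_intros)
    have J: "0 \<le> (\<integral>z. ln (norm (Q z)) \<partial>circle_lebesgue)" "integrable circle_lebesgue (\<lambda>z. ln (norm (Q z)))"
      using radial_Jensen[of ?P r] r(1) P0 by (auto simp: Q_def)
    have Qm: "Q \<in> borel_measurable circle_lebesgue" by (rule continuous_borel_measurable_circle[OF contQ])
    have QI: "integrable \<nu> (\<lambda>z. (norm (Q z))\<^sup>2)" by (intro integrable_continuous_\<nu> continuous_intros contQ)
    have QIf: "integrable circle_lebesgue (\<lambda>z. f z * (norm (Q z))\<^sup>2)"
      using integrable_\<nu>[of "\<lambda>z. (norm (Q z))\<^sup>2"] QI by auto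
    let ?L = "\<lambda>z. ln (f z) + 2 * ln (norm (Q z))"
    have LI: "integrable circle_lebesgue ?L" using ln_int J(2) by simp
    \<comment> \<open>The tangent line bound \<open>1 + t \<le> exp t\<close>, centered at the mean
      \<open>?c\<close> of \<open>ln f\<close>, provides the inequality between arithmetic and
      geometric means. Passing from \<open>ln f\<close> to \<open>?L\<close> can only increase the
      integral by \<open>J\<close>.\<close>
    have "exp ?c = (\<integral>z. exp ?c * (1 + (ln (f z) - ?c)) \<partial>circle_lebesgue)"
      using ln_int circle.prob_space by simp
    also have "\<dots> \<le> (\<integral>z. exp ?c * (1 + (?L z - ?c)) \<partial>circle_lebesgue)"
      using ln_int J circle.prob_space by simp
    also have "\<dots> \<le> (\<integral>z. f z * (norm (Q z))\<^sup>2 \<partial>circle_lebesgue)"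
    proof (rule integral_mono_AE)
      show "integrable circle_lebesgue (\<lambda>z. exp ?c * (1 + (?L z - ?c)))" using LI by simp
      show "AE z in circle_lebesgue. exp ?c * (1 + (?L z - ?c)) \<le> f z * (norm (Q z))\<^sup>2"
        using f_pos AE_space
      proof eventually_elim
        case (elim z)
        then have Qz: "norm (Q z) > 0" using r(1)[of z] by (simp add: Q_def)
        have "exp ?c * (1 + (?L z - ?c)) \<le> exp ?c * exp (?L z - ?c)"
          by (intro mult_left_mono exp_ge_add_one_self) simp
        also have "\<dots> = exp (?L z)" by (simp flip: exp_add)
        also have "\<dots> = f z * (norm (Q z))\<^sup>2"
          using elim Qz by (simp add: exp_add exp_double)
        finally show ?case .
      qed
    qed (rule QIf)
    also have "\<dots> = (\<integral>z. (norm (Q z))\<^sup>2 \<partial>\<nu>)"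
      using integral_\<nu>[of "\<lambda>z. (norm (Q z))\<^sup>2"] QI by auto
    \<comment> \<open>The square of \<open>norm (ev p z) + e\<close> exceeds that of
      \<open>norm (ev p z)\<close> by at most \<open>e * (2 * B + e)\<close>, and
      \<open>e < 1\<close>.\<close>
    also have "\<dots> \<le> (\<integral>z. (norm (ev p z))\<^sup>2 + e * (2 * B + 1) \<partial>\<nu>)"
    proof (rule integral_mono[OF QI])
      show "integrable \<nu> (\<lambda>z. (norm (ev p z))\<^sup>2 + e * (2 * B + 1))"
        using sq_integrable_integrable[OF sq_integrable_ev[of p]] by simp
      fix z assume z: "z \<in> space \<nu>"
      have "norm (Q z - ev p z) < e" using r(2)[of z] z by (simp add: Q_def ev_def space_\<nu>)
      then have "norm (Q z) \<le> norm (ev p z) + e" using norm_triangle_sub[of "Q z" "ev p z"] by linarith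
      then have "(norm (Q z))\<^sup>2 \<le> (norm (ev p z) + e)\<^sup>2" by (intro power_mono) auto
      also have "\<dots> = (norm (ev p z))\<^sup>2 + e * (2 * norm (ev p z) + e)" by (simp add: power2_eq_square algebra_simps)
      also have "\<dots> \<le> (norm (ev p z))\<^sup>2 + e * (2 * B + 1)"
        using B(2)[of z] z e by (intro add_left_mono mult_left_mono add_mono) (auto simp: space_\<nu>)
      finally show "(norm (Q z))\<^sup>2 \<le> (norm (ev p z))\<^sup>2 + e * (2 * B + 1)" .
    qed
    also have "\<dots> = nrm p + e * (2 * B + 1)"
      using sq_integrable_integrable[OF sq_integrable_ev[of p]] prob_space by (simp add: nrm_def)
    finally show ?thesis .
  qed
  then have le: "exp ?c \<le> nrm p + e * (2 * B + 1)" if "0 < e" "e < 1" for e using that by blast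
  show "exp ?c \<le> nrm p"
  proof (rule field_le_epsilon)
    fix t :: real assume t: "t > 0"
    define e where "e = min (1/2) (t / (2 * B + 1))"
    have e: "0 < e" "e < 1" using t B by (auto simp: e_def)
    have "e * (2 * B + 1) \<le> t / (2 * B + 1) * (2 * B + 1)"
      using B by (intro mult_right_mono) (auto simp: e_def)
    also have "\<dots> = t" using B by simp
    finally show "exp ?c \<le> nrm p + t" using le[OF e] by linarith
  qed
qed

text \<open>By \<open>|\<phi>|^2 f = c\<close>, the claim concerns \<open>ln |1 / \<phi>|\<close>.
  Its positive part is bounded by the integrable \<open>|1 / \<phi>|^2 = f / c\<close>; its negative
  part is controlled by Jensen's inequality for the polynomials \<open>q n\<close>, which tend to
  \<open>1 / \<phi>\<close>, and by Fatou's lemma.\<close>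

lemma ln_integrable_if_unpredictable:
  assumes unpredictable
  shows "integrable circle_lebesgue (\<lambda>z. ln (f z))"
proof -
  obtain p \<phi> c where inn: "\<And>n. poly (p n) 0 = 1" "0 < c"
    "\<And>n m. n \<le> m \<Longrightarrow> nrm (p m - p n) \<le> 1 / 8 ^ n"
    "sq_integrable \<nu> \<phi>"
    "(\<lambda>n. \<integral>z. (norm (ev (p n) z - \<phi> z))\<^sup>2 \<partial>\<nu>) \<longlonglongrightarrow> 0"
    "\<And>q. (\<integral>z. \<phi> z * cnj (ev (pCons 0 q) z) \<partial>\<nu>) = 0"
    and flat: "AE z in circle_lebesgue. (norm (\<phi> z))\<^sup>2 * f z = c"
    by (rule innovation_exists[OF assms]) (rule that; assumption)
  note c = inn(2) and \<phi> = inn(4)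
  obtain q where q: "\<And>n. (\<integral>z. (norm (1 - ev (q n) z * \<phi> z))\<^sup>2 \<partial>\<nu>) \<le> 1 / 8 ^ n"
    and q0: "(\<lambda>n. poly (q n) 0) \<longlonglongrightarrow> 1"
    and q_lim: "AE z in circle_lebesgue. (\<lambda>n. ev (q n) z * \<phi> z) \<longlonglongrightarrow> 1"
    by (rule innovation_invertible[OF c \<phi> inn(5) inn(1) inn(6) flat]) (rule that; assumption)
  have \<phi>m: "\<phi> \<in> borel_measurable circle_lebesgue" using \<phi> by (simp add: sq_integrable_def measurable_\<nu>)
  have one: "sq_integrable \<nu> (\<lambda>_. 1 :: complex)" by (simp add: sq_integrable_def)
  let ?P = "\<lambda>n. map_poly complex_of_real (q n)"
  \<comment> \<open>The implication lets the radii be chosen for all \<open>n\<close> at once; since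
    the constant terms tend to 1, the premise holds eventually.\<close>
  have "\<exists>r::real. poly (q n) 0 \<noteq> 0 \<longrightarrow>
      (\<forall>z\<in>sphere 0 1. poly (?P n) (of_real r * z) \<noteq> 0) \<and>
      (\<forall>z\<in>sphere 0 1. norm (poly (?P n) (of_real r * z) - poly (?P n) z) < 1 / real (Suc n))" for n
  proof (cases "poly (q n) 0 = 0")
    case False
    then have "?P n \<noteq> 0" using ev_at_0[of "q n"] by (auto simp: ev_def)
    from radial_perturbation[OF this, of "1 / real (Suc n)"] show ?thesis by (metis divide_pos_pos of_nat_0_less_iff zero_less_Suc zero_less_one)
  qed auto
  then obtain r :: "nat \<Rightarrow> real" where
    r: "\<And>n z. poly (q n) 0 \<noteq> 0 \<Longrightarrow> z \<in> sphere 0 1 \<Longrightarrow> poly (?P n) (of_real (r n) * z) \<noteq> 0"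
    "\<And>n z. poly (q n) 0 \<noteq> 0 \<Longrightarrow> z \<in> sphere 0 1 \<Longrightarrow> norm (poly (?P n) (of_real (r n) * z) - ev (q n) z) < 1 / real (Suc n)"
    unfolding ev_def by metis
  define Q where "Q n z = poly (?P n) (of_real (r n) * z)" for n z
  have contQ: "continuous_on A (Q n)" for A n unfolding Q_def[abs_def] by (intro continuous_intros)
  have Qm [measurable]: "Q n \<in> borel_measurable circle_lebesgue" for n by (rule continuous_borel_measurable_circle[OF contQ])
  have evI: "integrable circle_lebesgue (\<lambda>z. (norm (ev (q n) z))\<^sup>2)" for n
    by (intro circle_lebesgue_integrableI continuous_intros continuous_ev)
  have QI: "integrable circle_lebesgue (\<lambda>z. (norm (Q n z))\<^sup>2)" for n
    by (intro circle_lebesgue_integrableI continuous_intros contQ)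
  \<comment> \<open>As \<open>|\<phi>|^2 f = c\<close>, \<open>c\<close> times this integral is the
    squared norm of \<open>q n * \<phi>\<close> under the spectral measure. That function has
    squared distance at most 1 from the constant 1, whence the bound
    \<open>2 * 1 + 2 * 1\<close>.\<close>
  have ev_bound: "(\<integral>z. (norm (ev (q n) z))\<^sup>2 \<partial>circle_lebesgue) \<le> 4 / c" for n
  proof -
    let ?w = "\<lambda>z. ev (q n) z * \<phi> z"
    have w: "sq_integrable \<nu> ?w" by (rule sq_integrable_ev_mult[OF \<phi>])
    have "c * (\<integral>z. (norm (ev (q n) z))\<^sup>2 \<partial>circle_lebesgue) = (\<integral>z. c * (norm (ev (q n) z))\<^sup>2 \<partial>circle_lebesgue)" by simp
    also have "\<dots> = (\<integral>z. f z *\<^sub>R (norm (?w z))\<^sup>2 \<partial>circle_lebesgue)"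
    proof (rule integral_cong_AE)
      show "AE z in circle_lebesgue. c * (norm (ev (q n) z))\<^sup>2 = f z *\<^sub>R (norm (?w z))\<^sup>2"
        using flat by eventually_elim (auto simp: norm_mult power_mult_distrib)
    qed (use ev_measurable[of "q n"] \<phi>m f_measurable in \<open>auto simp: measurable_\<nu>\<close>)
    also have "\<dots> = (\<integral>z. (norm (?w z))\<^sup>2 \<partial>\<nu>)"
      by (rule integral_\<nu>[symmetric]) (use w in \<open>auto simp: sq_integrable_def\<close>)
    also have "\<dots> \<le> (\<integral>z. 2 * 1 + 2 * (norm (1 - ?w z))\<^sup>2 \<partial>\<nu>)"
    proof (rule integral_mono)
      show "integrable \<nu> (\<lambda>z. (norm (?w z))\<^sup>2)" using w by (rule sq_integrable_integrable)
      show "integrable \<nu> (\<lambda>z. 2 * 1 + 2 * (norm (1 - ?w z))\<^sup>2)"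
        using sq_integrable_integrable[OF sq_integrable_diff[OF one w]] by simp
      fix z
      show "(norm (?w z))\<^sup>2 \<le> 2 * 1 + 2 * (norm (1 - ?w z))\<^sup>2"
        using norm_add_sq_le[of 1 "?w z - 1"] by (simp add: norm_minus_commute)
    qed
    also have "\<dots> = 2 + 2 * (\<integral>z. (norm (1 - ?w z))\<^sup>2 \<partial>\<nu>)"
      using sq_integrable_integrable[OF sq_integrable_diff[OF one w]] prob_space by simp
    also have "\<dots> \<le> 4"
    proof -
      have "1 / 8 ^ n \<le> (1::real)" by simp
      then show ?thesis using q[of n] by linarith
    qed
    finally show ?thesis using c by (simp add: field_simps)
  qed
  \<comment> \<open>\<open>8 / c + 2\<close> will bound the second moment of \<open>Q n\<close>, and
    \<open>ln (1/2)\<close> is the lower bound from Jensen's inequality once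
    \<open>poly (q n) 0\<close> exceeds 1/2.\<close>
  define K where "K = 8 / c + 2 - 2 * ln (1/2)"
  \<comment> \<open>\<open>u\<close> is nonnegative on positive arguments because
    \<open>2 * ln x \<le> 2 * (x - 1) \<le> x\<^sup>2\<close>. Fatou's lemma therefore applies to
    it, and removing the integrable square leaves the logarithm.\<close>
  define u :: "real \<Rightarrow> real" where "u x = x\<^sup>2 - 2 * ln x" for x
  have u_nonneg: "0 \<le> u x" if "x > 0" for x
  proof -
    have "ln x \<le> x - 1" using ln_le_minus_one[OF that] .
    moreover have "2 * (x - 1) \<le> x\<^sup>2" using sum_squares_ge_zero[of "x - 1" 0] by (simp add: power2_eq_square algebra_simps)
    ultimately show ?thesis by (simp add: u_def)
  qed
  have um: "u \<in> borel_measurable borel" unfolding u_def[abs_def] by measurable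
  have ev0: "\<forall>\<^sub>F n in sequentially. 1/2 < poly (q n) 0"
    by (rule order_tendstoD(1)[OF q0]) simp
  have "\<forall>\<^sub>F n in sequentially. (\<integral>\<^sup>+z. ennreal (u (norm (Q n z))) \<partial>circle_lebesgue) \<le> ennreal K"
    using ev0
  proof eventually_elim
    case (elim n)
    then have nz: "poly (q n) 0 \<noteq> 0" by simp
    have P0: "poly (?P n) 0 = complex_of_real (poly (q n) 0)" using ev_at_0[of "q n"] by (simp add: ev_def)
    have J: "ln (norm (poly (?P n) 0)) \<le> (\<integral>z. ln (norm (Q n z)) \<partial>circle_lebesgue)"
      "integrable circle_lebesgue (\<lambda>z. ln (norm (Q n z)))"
      using radial_Jensen[of "?P n" "r n"] r(1)[OF nz] nz P0 by (auto simp: Q_def)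
    have "ln (1/2) \<le> ln (norm (poly (?P n) 0))" unfolding P0 using elim by simp
    then have J': "ln (1/2) \<le> (\<integral>z. ln (norm (Q n z)) \<partial>circle_lebesgue)" using J(1) by linarith
    have Qpos: "norm (Q n z) > 0" if "z \<in> sphere 0 1" for z using r(1)[OF nz that] by (simp add: Q_def)
    have "(\<integral>z. (norm (Q n z))\<^sup>2 \<partial>circle_lebesgue) \<le> (\<integral>z. 2 * (norm (ev (q n) z))\<^sup>2 + 2 \<partial>circle_lebesgue)"
    proof (rule integral_mono[OF QI])
      show "integrable circle_lebesgue (\<lambda>z. 2 * (norm (ev (q n) z))\<^sup>2 + 2)" using evI by simp
      fix z assume "z \<in> space circle_lebesgue"
      then have "norm (Q n z - ev (q n) z) < 1 / real (Suc n)" using r(2)[OF nz, of z] by (simp add: Q_def)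
      then have "norm (Q n z - ev (q n) z) \<le> 1" by (rule order_trans[OF less_imp_le]) simp
      then have "(norm (Q n z - ev (q n) z))\<^sup>2 \<le> 1\<^sup>2" by (intro power_mono) auto
      then show "(norm (Q n z))\<^sup>2 \<le> 2 * (norm (ev (q n) z))\<^sup>2 + 2"
        using norm_add_sq_le[of "ev (q n) z" "Q n z - ev (q n) z"] by simp
    qed
    also have "\<dots> = 2 * (\<integral>z. (norm (ev (q n) z))\<^sup>2 \<partial>circle_lebesgue) + 2"
      using evI circle.prob_space by simp
    also have "\<dots> \<le> 8 / c + 2" using ev_bound[of n] by simp
    finally have Q2: "(\<integral>z. (norm (Q n z))\<^sup>2 \<partial>circle_lebesgue) \<le> 8 / c + 2" .
    have uI: "integrable circle_lebesgue (\<lambda>z. u (norm (Q n z)))" unfolding u_def using QI J(2) by simp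
    have "(\<integral>\<^sup>+z. ennreal (u (norm (Q n z))) \<partial>circle_lebesgue) = ennreal (\<integral>z. u (norm (Q n z)) \<partial>circle_lebesgue)"
      by (rule nn_integral_eq_integral[OF uI]) (use u_nonneg[OF Qpos] in auto)
    also have "(\<integral>z. u (norm (Q n z)) \<partial>circle_lebesgue) = (\<integral>z. (norm (Q n z))\<^sup>2 \<partial>circle_lebesgue) - 2 * (\<integral>z. ln (norm (Q n z)) \<partial>circle_lebesgue)"
      unfolding u_def using QI J(2) by simp
    also have "\<dots> \<le> K" unfolding K_def using Q2 J' by linarith
    finally show ?case by (simp add: ennreal_leI)
  qed
  then have liminf_le: "liminf (\<lambda>n. \<integral>\<^sup>+z. ennreal (u (norm (Q n z))) \<partial>circle_lebesgue) \<le> ennreal K"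
    by (intro Liminf_le) auto
  define F where "F z = norm (1 / \<phi> z)" for z
  have Fm [measurable]: "F \<in> borel_measurable circle_lebesgue" unfolding F_def using \<phi>m by measurable
  have F_pos: "AE z in circle_lebesgue. 0 < F z"
    using flat by eventually_elim (use c in \<open>auto simp: F_def\<close>)
  have F_lim: "AE z in circle_lebesgue. (\<lambda>n. norm (Q n z)) \<longlonglongrightarrow> F z"
    using q_lim flat AE_space
  proof eventually_elim
    case (elim z)
    then have \<phi>z: "\<phi> z \<noteq> 0" using c by auto
    have z: "z \<in> sphere 0 1" using elim by simp
    have "(\<lambda>n. ev (q n) z * \<phi> z / \<phi> z) \<longlonglongrightarrow> 1 / \<phi> z" using elim \<phi>z by (intro tendsto_divide tendsto_const)
    then have l1: "(\<lambda>n. ev (q n) z) \<longlonglongrightarrow> 1 / \<phi> z" using \<phi>z by simp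
    have "(\<lambda>n. Q n z - ev (q n) z) \<longlonglongrightarrow> 0"
    proof (rule Lim_null_comparison)
      show "\<forall>\<^sub>F n in sequentially. norm (Q n z - ev (q n) z) \<le> inverse (real (Suc n))"
        using ev0
      proof eventually_elim
        case (elim n)
        then have "poly (q n) 0 \<noteq> 0" by simp
        from r(2)[OF this z] show ?case by (simp add: Q_def inverse_eq_divide less_imp_le)
      qed
      show "(\<lambda>n. inverse (real (Suc n))) \<longlonglongrightarrow> 0" by (rule LIMSEQ_inverse_real_of_nat)
    qed
    from tendsto_add[OF this l1] have "(\<lambda>n. Q n z) \<longlonglongrightarrow> 1 / \<phi> z" by simp
    then show ?case unfolding F_def by (rule tendsto_norm)
  qed
  \<comment> \<open>\<open>u\<close> is continuous on the positive reals, and \<open>F\<close> is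
    positive almost everywhere, so the limit passes through \<open>u\<close> before Fatou's lemma is
    used.\<close>
  have "(\<integral>\<^sup>+z. ennreal (u (F z)) \<partial>circle_lebesgue) = (\<integral>\<^sup>+z. liminf (\<lambda>n. ennreal (u (norm (Q n z)))) \<partial>circle_lebesgue)"
  proof (rule nn_integral_cong_AE)
    show "AE z in circle_lebesgue. ennreal (u (F z)) = liminf (\<lambda>n. ennreal (u (norm (Q n z))))"
      using F_lim F_pos
    proof eventually_elim
      case (elim z)
      have "(\<lambda>n. ennreal (u (norm (Q n z)))) \<longlonglongrightarrow> ennreal (u (F z))"
        unfolding u_def using elim by (intro tendsto_ennrealI tendsto_intros) auto
      from lim_imp_Liminf[OF _ this] show ?case by simp
    qed
  qed
  also have "\<dots> \<le> liminf (\<lambda>n. \<integral>\<^sup>+z. ennreal (u (norm (Q n z))) \<partial>circle_lebesgue)"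
    by (rule nn_integral_liminf) (use um in measurable)
  also have "\<dots> \<le> ennreal K" by (rule liminf_le)
  finally have fin: "(\<integral>\<^sup>+z. ennreal (u (F z)) \<partial>circle_lebesgue) \<le> ennreal K" .
  have uFI: "integrable circle_lebesgue (\<lambda>z. u (F z))"
  proof (rule integrableI_nonneg)
    show "AE z in circle_lebesgue. 0 \<le> u (F z)" using F_pos by eventually_elim (rule u_nonneg)
    show "(\<integral>\<^sup>+z. ennreal (u (F z)) \<partial>circle_lebesgue) < \<infinity>" using fin by (auto simp: less_top[symmetric] top_unique)
  qed (use um in measurable)
  have F2: "AE z in circle_lebesgue. (F z)\<^sup>2 = f z / c"
    using flat by eventually_elim (use c in \<open>auto simp: F_def norm_divide power_divide field_simps\<close>)
  have F2I: "integrable circle_lebesgue (\<lambda>z. (F z)\<^sup>2)"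
  proof -
    have "integrable circle_lebesgue (\<lambda>z. f z / c)" using f_integrable by simp
    then show ?thesis
      by (rule integrable_cong_AE[THEN iffD1, rotated -1]) (use F2 f_measurable in \<open>auto elim!: eventually_mono\<close>)
  qed
  have "integrable circle_lebesgue (\<lambda>z. ln c + ((F z)\<^sup>2 - u (F z)))"
    using uFI F2I by simp
  then show ?thesis
  proof (rule integrable_cong_AE[THEN iffD1, rotated -1])
    show "AE z in circle_lebesgue. ln c + ((F z)\<^sup>2 - u (F z)) = ln (f z)"
      using F2 F_pos f_pos
    proof eventually_elim
      case (elim z)
      have "2 * ln (F z) = ln ((F z)\<^sup>2)" using ln_realpow[of "F z" 2] elim(2) by simp
      also have "\<dots> = ln (f z) - ln c" unfolding elim(1) using elim c by (intro ln_divide_pos)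
      finally show ?case by (simp add: u_def)
    qed
  qed (use um f_measurable in measurable)
qed

theorem unpredictable_iff_ln_integrable:
  "unpredictable \<longleftrightarrow> integrable circle_lebesgue (\<lambda>z. ln (f z))"
  using unpredictable_if_ln_integrable ln_integrable_if_unpredictable by blast

end

subsection \<open>Linear functionals of a Gaussian sequence\<close>

lemma char_normal_density:
  assumes "0 < \<sigma>"
  shows "char (density lborel (\<lambda>x. ennreal (normal_density 0 \<sigma> x))) t = complex_of_real (exp (- ((\<sigma> * t)\<^sup>2) / 2))"
proof -
  have "char (density lborel (\<lambda>x. ennreal (normal_density 0 \<sigma> x))) t = (\<integral>x. normal_density 0 \<sigma> x *\<^sub>R iexp (t * x) \<partial>lborel)"
    unfolding char_def by (subst integral_density) auto
  also have "\<dots> = \<bar>\<sigma>\<bar> *\<^sub>R (\<integral>x. normal_density 0 \<sigma> (0 + \<sigma> * x) *\<^sub>R iexp (t * (0 + \<sigma> * x)) \<partial>lborel)"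
    by (rule lborel_integral_real_affine) (use assms in simp)
  also have "\<dots> = (\<integral>x. std_normal_density x *\<^sub>R iexp (\<sigma> * t * x) \<partial>lborel)"
  proof (subst integral_scaleR_right[symmetric], rule Bochner_Integration.integral_cong)
    fix x
    have "\<sigma> * normal_density 0 \<sigma> (\<sigma> * x) = std_normal_density x"
      using assms by (simp add: normal_density_def power_mult_distrib real_sqrt_mult)
    then show "\<bar>\<sigma>\<bar> *\<^sub>R normal_density 0 \<sigma> (0 + \<sigma> * x) *\<^sub>R iexp (t * (0 + \<sigma> * x)) = std_normal_density x *\<^sub>R iexp (\<sigma> * t * x)"
      using assms by (simp add: mult_ac)
  qed simp
  also have "\<dots> = char std_normal_distribution (\<sigma> * t)"
    unfolding char_def by (subst integral_density) auto
  finally show ?thesis by (simp add: char_std_normal_distribution)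
qed

text \<open>Expressing the characteristic function through the second moment covers the point mass
  and the normal laws by one formula.\<close>

lemma centered_gaussian_lawD:
  assumes "centered_gaussian_law P"
  shows "integrable P (\<lambda>x. x\<^sup>2)"
    and "char P t = complex_of_real (exp (- (t\<^sup>2 * (\<integral>x. x\<^sup>2 \<partial>P)) / 2))"
proof -
  consider "P = return borel 0" | \<sigma> where "\<sigma> > 0" "P = density lborel (\<lambda>x. ennreal (normal_density 0 \<sigma> x))"
    using assms unfolding centered_gaussian_law_def by blast
  then have "integrable P (\<lambda>x. x\<^sup>2) \<and> char P t = complex_of_real (exp (- (t\<^sup>2 * (\<integral>x. x\<^sup>2 \<partial>P)) / 2))"
  proof cases
    case 1
    have "integrable P (\<lambda>x. x\<^sup>2)" unfolding 1 by (rule integrableI_bounded) (auto simp: nn_integral_return)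
    then show ?thesis unfolding 1 char_def by (simp add: integral_return)
  next
    case 2
    have I: "integrable lborel (\<lambda>x. normal_density 0 \<sigma> x * x\<^sup>2)"
      using integrable_normal_moment[OF 2(1), of 0 2] by simp
    have "integrable P (\<lambda>x. x\<^sup>2)"
      unfolding 2 by (subst integrable_density) (use I in auto)
    moreover have "(\<integral>x. x\<^sup>2 \<partial>P) = \<sigma>\<^sup>2"
    proof -
      have "(\<integral>x. x\<^sup>2 \<partial>P) = (\<integral>x. normal_density 0 \<sigma> x * x\<^sup>2 \<partial>lborel)"
        unfolding 2 by (subst integral_density) auto
      also have "\<dots> = \<sigma>\<^sup>2" using integral_normal_moment_even[OF 2(1), of 0 1] by (simp add: fact_2)
      finally show ?thesis .
    qed
    ultimately show ?thesis
      using char_normal_density[OF 2(1), of t] 2(2) by (simp add: power_mult_distrib mult.commute)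
  qed
  then show "integrable P (\<lambda>x. x\<^sup>2)" "char P t = complex_of_real (exp (- (t\<^sup>2 * (\<integral>x. x\<^sup>2 \<partial>P)) / 2))" by auto
qed

text \<open>The counterpart of \<open>ev\<close> on the sequence space. Multiplication of
  \<open>p\<close> by the variable becomes composition with the shift, which is the content of
  \<open>lin_pCons\<close> at \<open>a = 0\<close>.\<close>

definition lin :: "real poly \<Rightarrow> (nat \<Rightarrow> real) \<Rightarrow> real" where
  "lin p x = (\<Sum>i\<le>degree p. coeff p i * x i)"

lemma lin_0 [simp]: "lin 0 x = 0"
  by (simp add: lin_def)

lemma lin_pCons [simp]: "lin (pCons a p) x = a * x 0 + lin p (unilateral_shift x)"
  by (cases "p = 0") (simp_all add: lin_def degree_pCons_eq unilateral_shift_def sum.atMost_Suc_shift del: sum.atMost_Suc)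

lemma lin_add [simp]: "lin (p + q) x = lin p x + lin q x"
  by (induction p q arbitrary: x rule: poly_induct2) (auto simp: algebra_simps)

lemma lin_smult [simp]: "lin (smult c p) x = c * lin p x"
  by (induction p arbitrary: x) (auto simp: algebra_simps)

lemma lin_diff [simp]: "lin (p - q) x = lin p x - lin q x"
  using lin_add[of p "- q" x] lin_smult[of "-1" q x] by simp

lemma lin_sum [simp]: "lin (\<Sum>i\<in>A. p i) x = (\<Sum>i\<in>A. lin (p i) x)"
  by (induction A rule: infinite_finite_induct) auto

lemma funpow_unilateral_shift: "(unilateral_shift ^^ k) x i = x (k + i)"
  by (induction k arbitrary: i) (auto simp: unilateral_shift_def)

lemma lin_monom_mult [simp]: "lin (monom 1 k * p) x = lin p ((unilateral_shift ^^ k) x)"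
  by (induction k arbitrary: x) (auto simp: monom_0 monom_Suc funpow_swap1 simp flip: one_pCons)

lemma lin_1: "lin 1 x = x 0"
  using lin_pCons[of 1 0] by (simp add: one_pCons)

lemma lin_monom [simp]: "lin (monom 1 k) x = x k"
  using lin_monom_mult[of k 1 x] by (simp add: lin_1 funpow_unilateral_shift)

lemma lin_measurable [measurable]:
  "lin p \<in> borel_measurable seq_borel"
  unfolding lin_def[abs_def] by measurable

lemma ev_eq_sum: "ev p z = (\<Sum>i\<le>degree p. complex_of_real (coeff p i) * z ^ i)"
  unfolding ev_def poly_altdef by (simp add: degree_map_poly coeff_map_poly)

context
  fixes \<nu> :: "complex measure" and M :: "(nat \<Rightarrow> real) measure"
  assumes gauss: "is_gaussian_measure \<nu> M" and \<nu>: "finite_measure \<nu>" "sets \<nu> = sets circle_borel"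
begin

lemma gaussian_prob_space: "prob_space M"
  and gaussian_sets: "sets M = sets seq_borel"
  and gaussian_cov: "complex_of_real (\<integral>x. x m * x n \<partial>M) = fourier_coeff \<nu> (int m - int n)"
  using gauss unfolding is_gaussian_measure_def by blast+

lemma lin_measurable_gaussian: "lin p \<in> borel_measurable M"
  using lin_measurable by (simp add: measurable_cong_sets[OF gaussian_sets refl])

lemma gaussian_lin_law: "centered_gaussian_law (distr M borel (lin p))"
proof -
  have "centered_gaussian_law (distr M borel (\<lambda>x. \<Sum>i<Suc (degree p). coeff p i * x i))"
    using gauss unfolding is_gaussian_measure_def by blast
  moreover have "(\<lambda>x. \<Sum>i<Suc (degree p). coeff p i * x i) = lin p"
    by (auto simp: lin_def lessThan_Suc_atMost)
  ultimately show ?thesis by simp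
qed

lemma gaussian_lin_sq_integrable: "sq_integrable M (lin p)"
  using centered_gaussian_lawD(1)[OF gaussian_lin_law, of p] lin_measurable_gaussian[of p]
  by (auto simp: sq_integrable_def integrable_distr_eq)

lemma gaussian_integrable_product: "integrable M (\<lambda>x. x i * x j)"
proof (rule Bochner_Integration.integrable_bound)
  show "integrable M (\<lambda>x. norm (lin (monom 1 i) x) * norm (lin (monom 1 j) x))"
    by (rule integrable_norm_mult[OF gaussian_lin_sq_integrable gaussian_lin_sq_integrable])
  have "(\<lambda>x. lin (monom 1 i) x * lin (monom 1 j) x) \<in> borel_measurable M"
    by (intro borel_measurable_times lin_measurable_gaussian)
  then show "(\<lambda>x. x i * x j) \<in> borel_measurable M" by simp
qed (simp add: abs_mult)

text \<open>The spectral isometry. The covariance of \<open>X_i\<close> and \<open>X_j\<close> is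
  the integral of \<open>z\<close> to the power \<open>j - i\<close>, which on the circle equals
  \<open>cnj z ^ i * z ^ j\<close>; expanding both squares gives the same double sum.\<close>

lemma gaussian_second_moment: "(\<integral>x. (lin p x)\<^sup>2 \<partial>M) = (\<integral>z. (norm (ev p z))\<^sup>2 \<partial>\<nu>)"
proof -
  let ?n = "degree p" and ?c = "coeff p"
  have cont: "integrable \<nu> (\<lambda>z. complex_of_real (?c i) * complex_of_real (?c j) * (cnj z ^ i * z ^ j))" for i j
    by (rule circle_integrableI[OF \<nu>]) (intro continuous_intros)
  have cov: "complex_of_real (\<integral>x. x i * x j \<partial>M) = (\<integral>z. cnj z ^ i * z ^ j \<partial>\<nu>)" for i j
    unfolding gaussian_cov fourier_coeff_def
  proof (rule Bochner_Integration.integral_cong)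
    fix z assume "z \<in> space \<nu>"
    then have z: "z \<in> sphere 0 1" using space_circle[OF \<nu>(2)] by simp
    then have "z \<noteq> 0" by auto
    have "cnj z = inverse z" using circle_mult_cnj[OF z] by (simp add: inverse_unique)
    then show "z powi - (int i - int j) = cnj z ^ i * z ^ j"
      using \<open>z \<noteq> 0\<close> by (simp add: power_int_diff power_inverse divide_inverse mult.commute)
  qed simp
  have "complex_of_real (\<integral>x. (lin p x)\<^sup>2 \<partial>M)
      = complex_of_real (\<integral>x. (\<Sum>i\<le>?n. \<Sum>j\<le>?n. ?c i * ?c j * (x i * x j)) \<partial>M)"
    by (simp add: lin_def power2_eq_square sum_product mult_ac)
  also have "\<dots> = complex_of_real (\<Sum>i\<le>?n. \<Sum>j\<le>?n. ?c i * ?c j * (\<integral>x. x i * x j \<partial>M))"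
    using gaussian_integrable_product by simp
  also have "\<dots> = (\<Sum>i\<le>?n. \<Sum>j\<le>?n. complex_of_real (?c i) * complex_of_real (?c j) * complex_of_real (\<integral>x. x i * x j \<partial>M))"
    by simp
  also have "\<dots> = (\<Sum>i\<le>?n. \<Sum>j\<le>?n. \<integral>z. complex_of_real (?c i) * complex_of_real (?c j) * (cnj z ^ i * z ^ j) \<partial>\<nu>)"
    by (simp add: cov)
  also have "\<dots> = (\<integral>z. (\<Sum>i\<le>?n. \<Sum>j\<le>?n. complex_of_real (?c i) * complex_of_real (?c j) * (cnj z ^ i * z ^ j)) \<partial>\<nu>)"
    using cont by (simp only: Bochner_Integration.integral_sum Bochner_Integration.integrable_sum)
  also have "\<dots> = (\<integral>z. complex_of_real ((norm (ev p z))\<^sup>2) \<partial>\<nu>)"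
  proof (rule Bochner_Integration.integral_cong)
    fix z
    have "complex_of_real ((norm (ev p z))\<^sup>2) = cnj (ev p z) * ev p z"
      by (simp only: complex_norm_square mult.commute)
    also have "\<dots> = (\<Sum>i\<le>?n. \<Sum>j\<le>?n. complex_of_real (?c i) * complex_of_real (?c j) * (cnj z ^ i * z ^ j))"
      by (subst sum.swap) (simp add: ev_eq_sum sum_product mult_ac)
    finally show "(\<Sum>i\<le>?n. \<Sum>j\<le>?n. complex_of_real (?c i) * complex_of_real (?c j) * (cnj z ^ i * z ^ j))
      = complex_of_real ((norm (ev p z))\<^sup>2)" by simp
  qed simp
  also have "\<dots> = complex_of_real (\<integral>z. (norm (ev p z))\<^sup>2 \<partial>\<nu>)" by (rule integral_complex_of_real)
  finally show ?thesis by (simp only: of_real_eq_iff)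
qed

text \<open>The law of \<open>lin p\<close> is centered Gaussian, so its characteristic function at
  1 depends only on the variance, already transferred to the circle. Independence of linear
  functionals thus becomes additivity of squared norms.\<close>

lemma gaussian_char:
  "(\<integral>x. iexp (lin p x) \<partial>M) = complex_of_real (exp (- (\<integral>z. (norm (ev p z))\<^sup>2 \<partial>\<nu>) / 2))"
proof -
  have "(\<integral>x. iexp (lin p x) \<partial>M) = char (distr M borel (lin p)) 1"
    unfolding char_def by (subst integral_distr[OF lin_measurable_gaussian]) auto
  also have "\<dots> = complex_of_real (exp (- (\<integral>x. x\<^sup>2 \<partial>distr M borel (lin p)) / 2))"
    by (simp add: centered_gaussian_lawD(2)[OF gaussian_lin_law])
  also have "(\<integral>x. x\<^sup>2 \<partial>distr M borel (lin p)) = (\<integral>x. (lin p x)\<^sup>2 \<partial>M)"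
    by (rule integral_distr[OF lin_measurable_gaussian]) simp
  finally show ?thesis by (simp add: gaussian_second_moment)
qed

end

subsection \<open>Coefficient polynomials and Parseval's identity\<close>

text \<open>The polynomial with coefficients \<open>a 0, ..., a (n - 1)\<close>, in a recursive form
  that matches the recursion of \<open>ev\<close> and \<open>lin\<close> over
  \<open>pCons\<close>.\<close>

fun coeff_poly :: "nat \<Rightarrow> (nat \<Rightarrow> real) \<Rightarrow> real poly" where
  "coeff_poly 0 a = 0"
| "coeff_poly (Suc n) a = pCons (a 0) (coeff_poly n (\<lambda>i. a (Suc i)))"

lemma lin_coeff_poly_mult: "lin (coeff_poly n a * p) x = (\<Sum>k<n. a k * lin p ((unilateral_shift ^^ k) x))"
proof (induction n arbitrary: a x)
  case (Suc n)
  then show ?case by (simp add: sum.lessThan_Suc_shift funpow_swap1 del: sum.lessThan_Suc)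
qed simp

lemma lin_coeff_poly: "lin (coeff_poly n a) x = (\<Sum>k<n. a k * x k)"
  using lin_coeff_poly_mult[of n a 1 x] by (simp add: lin_1 funpow_unilateral_shift)

text \<open>The constant \<open>a\<close> is orthogonal to \<open>z * ev p z\<close>, whose mean is
  its value 0 at the origin, and \<open>norm z = 1\<close> on the circle. This is one step of
  Parseval's identity.\<close>

lemma integral_circle_norm_ev_pCons:
  "(\<integral>z. (norm (ev (pCons a p) z))\<^sup>2 \<partial>circle_lebesgue) = a\<^sup>2 + (\<integral>z. (norm (ev p z))\<^sup>2 \<partial>circle_lebesgue)"
proof -
  have pI: "integrable circle_lebesgue (\<lambda>z. (norm (ev p z))\<^sup>2)" for p
    by (intro circle_lebesgue_integrableI continuous_intros continuous_ev)
  have cI: "integrable circle_lebesgue (ev p)" for p by (intro circle_lebesgue_integrableI continuous_ev)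
  have "(\<integral>z. Re (ev (pCons 0 p) z) \<partial>circle_lebesgue) = Re (\<integral>z. ev (pCons 0 p) z \<partial>circle_lebesgue)"
    by (rule integral_Re[OF cI])
  then have Re0: "(\<integral>z. Re (ev (pCons 0 p) z) \<partial>circle_lebesgue) = 0" unfolding integral_circle_ev by simp
  have "(\<integral>z. (norm (ev (pCons a p) z))\<^sup>2 \<partial>circle_lebesgue)
      = (\<integral>z. (a\<^sup>2 + (norm (ev p z))\<^sup>2) + 2 * a * Re (ev (pCons 0 p) z) \<partial>circle_lebesgue)"
  proof (rule Bochner_Integration.integral_cong)
    fix z assume "z \<in> space circle_lebesgue"
    then have z: "norm z = 1" by simp
    have "(norm (complex_of_real a + w))\<^sup>2 = a\<^sup>2 + (norm w)\<^sup>2 + 2 * a * Re w" for w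
      unfolding cmod_power2 by (simp add: power2_eq_square algebra_simps)
    then show "(norm (ev (pCons a p) z))\<^sup>2 = (a\<^sup>2 + (norm (ev p z))\<^sup>2) + 2 * a * Re (ev (pCons 0 p) z)"
      using z by (simp add: norm_mult)
  qed simp
  also have "\<dots> = a\<^sup>2 + (\<integral>z. (norm (ev p z))\<^sup>2 \<partial>circle_lebesgue) + 2 * a * (\<integral>z. Re (ev (pCons 0 p) z) \<partial>circle_lebesgue)"
    using pI[of p] integrable_Re[OF cI[of "pCons 0 p"]] circle.prob_space by (simp del: ev_pCons)
  finally show ?thesis using Re0 by simp
qed

lemma integral_circle_norm_coeff_poly:
  "(\<integral>z. (norm (ev (coeff_poly n a) z))\<^sup>2 \<partial>circle_lebesgue) = (\<Sum>k<n. (a k)\<^sup>2)"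
proof (induction n arbitrary: a)
  case (Suc n)
  then show ?case
    by (simp only: coeff_poly.simps integral_circle_norm_ev_pCons sum.lessThan_Suc_shift)
qed simp

lemma integral_circle_norm_ev_eq_0:
  "(\<integral>z. (norm (ev p z))\<^sup>2 \<partial>circle_lebesgue) = 0 \<Longrightarrow> p = 0"
proof (induction p)
  case (pCons a p)
  have "0 \<le> (\<integral>z. (norm (ev p z))\<^sup>2 \<partial>circle_lebesgue)" by simp
  then have "a\<^sup>2 = 0" "(\<integral>z. (norm (ev p z))\<^sup>2 \<partial>circle_lebesgue) = 0"
    using pCons.prems zero_le_power2[of a] unfolding integral_circle_norm_ev_pCons by linarith+
  then show ?case using pCons.IH by simp
qed simp

text \<open>For Lebesgue measure the powers of \<open>z\<close> are orthonormal, so by Parseval's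
  identity the characteristic functions factor into standard normal ones.\<close>

lemma white_noise_eq_PiM:
  assumes "is_gaussian_measure circle_lebesgue N"
  shows "N = (\<Pi>\<^sub>M k\<in>UNIV. std_normal_distribution)"
proof -
  note g = assms circle.finite_measure_axioms sets_circle_lebesgue
  interpret prob_space N by (rule gaussian_prob_space[OF g])
  have sets: "sets N = sets seq_borel" by (rule gaussian_sets[OF g])
  have "distr N seq_borel (\<lambda>x k. x k) = (\<Pi>\<^sub>M k\<in>UNIV. std_normal_distribution)"
  proof (rule char_product_imp_distr_PiM)
    show "real_distribution std_normal_distribution" by (rule real_dist_normal_dist)
    show "(\<lambda>x. x k) \<in> borel_measurable N" for k
      using lin_measurable_gaussian[OF g, of "monom 1 k"] by (simp cong: measurable_cong)
    fix n and c :: "nat \<Rightarrow> real"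
    have "(\<integral>x. iexp (\<Sum>k<n. c k * x k) \<partial>N) = complex_of_real (exp (- (\<Sum>k<n. (c k)\<^sup>2) / 2))"
      using gaussian_char[OF g, of "coeff_poly n c"]
      by (simp only: lin_coeff_poly integral_circle_norm_coeff_poly)
    also have "\<dots> = (\<Prod>k<n. char std_normal_distribution (c k))"
    proof -
      have "exp (- (\<Sum>k<n. (c k)\<^sup>2) / 2) = (\<Prod>k<n. exp (- (c k)\<^sup>2 / 2))"
        by (subst exp_sum[symmetric]) (simp_all add: sum_negf sum_divide_distrib)
      then show ?thesis by (simp add: char_std_normal_distribution)
    qed
    finally show "(\<integral>x. iexp (\<Sum>k<n. c k * x k) \<partial>N) = (\<Prod>k<n. char std_normal_distribution (c k))" .
  qed
  moreover have "distr N seq_borel (\<lambda>x k. x k) = N"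
    using distr_id2[OF sets[symmetric]] by simp
  ultimately show ?thesis by simp
qed

subsection \<open>Isomorphism with the white noise shift\<close>

locale gaussian_sequence = spectral_density \<nu> f for \<nu> f +
  fixes M :: "(nat \<Rightarrow> real) measure"
  assumes gauss: "is_gaussian_measure \<nu> M"
begin

lemmas gaussian_facts = gauss finite_measure_axioms sets_\<nu>
lemmas sets_M = gaussian_sets[OF gaussian_facts]

sublocale M: prob_space M
  by (rule gaussian_prob_space[OF gaussian_facts])

lemma lin_measurable_M: "lin p \<in> borel_measurable M"
  by (rule lin_measurable_gaussian[OF gaussian_facts])

lemma lin_sq_integrable: "sq_integrable M (lin p)"
  by (rule gaussian_lin_sq_integrable[OF gaussian_facts])

lemma lin_sq_integral: "(\<integral>x. (lin p x)\<^sup>2 \<partial>M) = nrm p"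
  using gaussian_second_moment[OF gaussian_facts] by (simp add: nrm_def)

lemma lin_integrable_sq: "integrable M (\<lambda>x. (lin p x)\<^sup>2)"
  using sq_integrable_integrable[OF lin_sq_integrable] by simp

lemma lin_char: "(\<integral>x. iexp (lin p x) \<partial>M) = complex_of_real (exp (- nrm p / 2))"
  using gaussian_char[OF gaussian_facts] by (simp add: nrm_def)

lemma AE_tendsto_0_if_nrm_le:
  assumes "\<And>n. nrm (p n) \<le> 1 / 8 ^ n"
  shows "AE x in M. (\<lambda>n. lin (p n) x) \<longlonglongrightarrow> 0"
proof -
  have "AE x in M. summable (\<lambda>n. (lin (p n) x)\<^sup>2)"
  proof (rule AE_summable_if_summable_integral[OF lin_integrable_sq])
    show "summable (\<lambda>n. \<integral>x. (lin (p n) x)\<^sup>2 \<partial>M)"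
      by (rule summable_comparison_test[OF _ summable_geometric[of "1/8::real"]])
         (use assms in \<open>auto simp: lin_sq_integral nrm_nonneg power_divide\<close>)
  qed simp
  then show ?thesis
  proof eventually_elim
    case (elim x)
    from tendsto_real_sqrt[OF summable_LIMSEQ_zero[OF elim]]
    show ?case by (simp add: tendsto_rabs_zero_iff)
  qed
qed

lemma funpow_shift_measurable: "(unilateral_shift ^^ k) \<in> measurable seq_borel seq_borel"
proof -
  have "(unilateral_shift ^^ k) = (\<lambda>x i. x (k + i))"
    by (auto simp: funpow_unilateral_shift fun_eq_iff)
  then show ?thesis by (simp only:) (rule measurable_PiM_single'; simp)
qed

lemma lim_lin_measurable:
  "(\<lambda>x k. a * lim (\<lambda>n. lin (p n) ((unilateral_shift ^^ k) x))) \<in> measurable seq_borel seq_borel"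
proof (rule measurable_PiM_single')
  fix k :: nat
  have "(\<lambda>x. lin (p n) ((unilateral_shift ^^ k) x)) \<in> borel_measurable seq_borel" for n
    by (rule measurable_compose[OF funpow_shift_measurable lin_measurable])
  then show "(\<lambda>x. a * lim (\<lambda>n. lin (p n) ((unilateral_shift ^^ k) x))) \<in> borel_measurable seq_borel"
    by measurable
qed simp

text \<open>Since \<open>lim\<close> is a total function, equivariance holds at every point,
  including those where the limits do not exist. The construction of the invariant sets relies on
  this.\<close>

lemma lim_lin_shift:
  "(\<lambda>k. a * lim (\<lambda>n. lin (p n) ((unilateral_shift ^^ k) (unilateral_shift x))))
     = unilateral_shift (\<lambda>k. a * lim (\<lambda>n. lin (p n) ((unilateral_shift ^^ k) x)))"
  by (simp add: unilateral_shift_def[of "\<lambda>k. a * _ k"] funpow_swap1)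

text \<open>Residuals \<open>1 - pCons 0 (q n)\<close> with variance at most
  \<open>1 / 8 ^ n\<close> tend to 0 almost surely, so \<open>x 0\<close> is the limit of the
  functionals \<open>lin (q n)\<close> of the shifted sequence.\<close>

lemma not_isomorphic_if_predictable:
  assumes "\<not> unpredictable" and N: "N = (\<Pi>\<^sub>M k\<in>UNIV. std_normal_distribution)"
  shows "\<not> mpt_isomorphic M unilateral_shift N unilateral_shift"
proof -
  have "\<exists>p. poly p 0 = 1 \<and> nrm p \<le> 1 / 8 ^ n" for n :: nat
  proof -
    have "(0::real) < 1 / 8 ^ n" by simp
    then show ?thesis using assms(1) unfolding unpredictable_def by (meson linear)
  qed
  then obtain p where p: "\<And>n. poly (p n) 0 = 1" "\<And>n. nrm (p n) \<le> 1 / 8 ^ n" by metis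
  have "\<exists>q. p n = 1 - pCons 0 q" for n
  proof -
    obtain a r where "p n = pCons a r" by (cases "p n")
    then have "p n = 1 - pCons 0 (- r)" using p(1)[of n] by (simp add: one_pCons)
    then show ?thesis ..
  qed
  then obtain q where q: "\<And>n. p n = 1 - pCons 0 (q n)" by metis
  define g where "g y = lim (\<lambda>n. lin (q n) y)" for y
  have AE: "AE x in M. x 0 = g (unilateral_shift x)"
    using AE_tendsto_0_if_nrm_le[OF p(2)]
  proof eventually_elim
    case (elim x)
    then have "(\<lambda>n. x 0 - lin (p n) x) \<longlonglongrightarrow> x 0 - 0" by (intro tendsto_intros)
    then have "(\<lambda>n. lin (q n) (unilateral_shift x)) \<longlonglongrightarrow> x 0" by (simp add: q lin_1)
    then show ?case by (simp add: g_def limI)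
  qed
  have g: "g \<in> borel_measurable seq_borel"
    unfolding g_def by measurable
  interpret std: real_distribution std_normal_distribution by (rule real_dist_normal_dist)
  \<comment> \<open>The normal law charges every unit interval; this puts the probability of
    \<open>{0<..}\<close> strictly between 0 and 1.\<close>
  have pos: "0 < measure std_normal_distribution A" if "A \<in> sets borel" "{a<..<a + 1} \<subseteq> A" for A and a :: real
  proof -
    have "A \<notin> null_sets std_normal_distribution"
    proof
      assume "A \<in> null_sets std_normal_distribution"
      then have "AE x in lborel. x \<in> A \<longrightarrow> std_normal_density x \<le> 0"
        by (subst (asm) null_sets_density_iff) (auto simp: ennreal_eq_0_iff)
      then have "AE x in lborel. x \<notin> A"
        by eventually_elim (use normal_density_pos[of 1 0] in \<open>auto simp: not_le[symmetric]\<close>)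
      then have "A \<in> null_sets lborel" using that by (subst AE_iff_null_sets) auto
      then have "emeasure lborel {a<..<a + 1} = 0"
        using that(2) by (metis emeasure_mono le_zero_eq null_setsD1 null_setsD2)
      then show False by simp
    qed
    then show ?thesis using that(1) std.emeasure_eq_measure[of A]
      by (auto simp: null_sets_def zero_less_measure_iff)
  qed
  have p1: "0 < measure std_normal_distribution {0<..}" by (rule pos[of _ 0]) auto
  have p2: "0 < measure std_normal_distribution {..0}" by (rule pos[of _ "-1"]) auto
  have "UNIV - {..0::real} = {0<..}" by auto
  then have "measure std_normal_distribution {0<..} = 1 - measure std_normal_distribution {..0}"
    using std.prob_compl[of "{..0}"] by simp
  then have p3: "measure std_normal_distribution {0<..} < 1" using p2 by simp
  show ?thesis
    by (rule not_mpt_isomorphic_product[OF sets_M g AE N _ _ p1 p3]) (auto intro: std.prob_space_axioms)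
qed

text \<open>\<open>\<Phi>\<close> sends a sequence to its innovations divided by their standard
  deviation \<open>sqrt c\<close>, and \<open>\<Psi>\<close> rebuilds each coordinate from the
  innovations with the polynomials \<open>q n\<close> that approximate \<open>1 / \<phi>\<close>.
  Both look only forward in time.\<close>

lemma isomorphic_if_unpredictable:
  assumes unpredictable and N: "N = (\<Pi>\<^sub>M k\<in>UNIV. std_normal_distribution)"
  shows "mpt_isomorphic M unilateral_shift N unilateral_shift"
proof -
  obtain p \<phi> c where p0: "\<And>n. poly (p n) 0 = 1" and c: "0 < c"
    and pc: "\<And>n m. n \<le> m \<Longrightarrow> nrm (p m - p n) \<le> 1 / 8 ^ n"
    and \<phi>: "sq_integrable \<nu> \<phi>"
    and lim: "(\<lambda>n. \<integral>z. (norm (ev (p n) z - \<phi> z))\<^sup>2 \<partial>\<nu>) \<longlonglongrightarrow> 0"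
    and orth: "\<And>q. (\<integral>z. \<phi> z * cnj (ev (pCons 0 q) z) \<partial>\<nu>) = 0"
    and flat: "AE z in circle_lebesgue. (norm (\<phi> z))\<^sup>2 * f z = c"
    by (rule innovation_exists[OF assms(1)]) (rule that; assumption)
  obtain q where q: "\<And>n. (\<integral>z. (norm (1 - ev (q n) z * \<phi> z))\<^sup>2 \<partial>\<nu>) \<le> 1 / 8 ^ n"
    by (rule innovation_invertible[OF c \<phi> lim p0 orth flat]) (rule that; assumption)
  let ?s = "\<lambda>k. unilateral_shift ^^ k"
  define Y where "Y k x = lim (\<lambda>n. lin (p n) (?s k x))" for k x
  define \<Phi> where "\<Phi> x = (\<lambda>k. 1 / sqrt c * Y k x)" for x
  define \<Psi> where "\<Psi> y = (\<lambda>k. sqrt c * lim (\<lambda>n. lin (q n) (?s k y)))" for y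
  have \<Phi>m: "\<Phi> \<in> measurable seq_borel seq_borel" unfolding \<Phi>_def Y_def by (rule lim_lin_measurable)
  have \<Psi>m: "\<Psi> \<in> measurable seq_borel seq_borel" unfolding \<Psi>_def by (rule lim_lin_measurable)
  have "AE x in M. \<forall>k. (\<lambda>n. lin (p n) (?s k x)) \<longlonglongrightarrow> Y k x"
    unfolding AE_all_countable
  proof
    fix k
    have "AE x in M. convergent (\<lambda>n. lin (monom 1 k * p n) x)"
    proof (rule L2_Cauchy_AE_convergent[OF lin_sq_integrable])
      fix n m :: nat assume "n \<le> m"
      have "(\<integral>x. (norm (lin (monom 1 k * p m) x - lin (monom 1 k * p n) x))\<^sup>2 \<partial>M) = nrm (monom 1 k * (p m - p n))"
        unfolding lin_sq_integral[symmetric] by (simp del: lin_monom_mult flip: lin_diff right_diff_distrib)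
      then show "(\<integral>x. (norm (lin (monom 1 k * p m) x - lin (monom 1 k * p n) x))\<^sup>2 \<partial>M) \<le> 1 / 8 ^ n"
        using pc[OF \<open>n \<le> m\<close>] by (simp only: nrm_monom_mult)
    qed
    then show "AE x in M. (\<lambda>n. lin (p n) (?s k x)) \<longlonglongrightarrow> Y k x"
      by eventually_elim (simp add: Y_def convergent_LIMSEQ_iff)
  qed
  then have Y: "AE x in M. \<forall>k. (\<lambda>n. lin (p n) (?s k x)) \<longlonglongrightarrow> Y k x" .
  \<comment> \<open>Multiplication by \<open>r\<close> forms a finite combination of shifts of
    \<open>lin (p m)\<close>, so one exceptional null set, from the countably many limits
    \<open>Y k\<close>, works for all \<open>r\<close>.\<close>
  have lin_Y: "AE x in M. \<forall>r. (\<lambda>m. lin (r * p m) x) \<longlonglongrightarrow> lin r (\<lambda>k. Y k x)"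
    using Y
  proof eventually_elim
    case (elim x)
    have "(\<lambda>m. lin (r * p m) (?s j x)) \<longlonglongrightarrow> lin r (\<lambda>k. Y (j + k) x)" for r j
    proof (induction r arbitrary: j)
      case (pCons a r)
      have "(\<lambda>m. a * lin (p m) (?s j x) + lin (r * p m) (?s (Suc j) x)) \<longlonglongrightarrow> a * Y j x + lin r (\<lambda>k. Y (Suc j + k) x)"
        using elim by (intro tendsto_intros pCons.IH) auto
      then show ?case by (simp add: unilateral_shift_def[of "\<lambda>k. Y (j + k) x"])
    qed simp
    from this[of _ 0] show ?case by simp
  qed
  have Ym: "Y k \<in> borel_measurable M" for k
    unfolding Y_def measurable_cong_sets[OF sets_M refl]
    by (intro borel_measurable_lim_metric measurable_compose[OF funpow_shift_measurable lin_measurable])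
  have \<Phi>km: "(\<lambda>x. \<Phi> x k) \<in> borel_measurable M" for k
    unfolding \<Phi>_def using Ym by measurable
  have law: "distr M seq_borel \<Phi> = N"
  proof -
    have "distr M seq_borel (\<lambda>x k. \<Phi> x k) = (\<Pi>\<^sub>M k\<in>UNIV. std_normal_distribution)"
    proof (rule M.char_product_imp_distr_PiM[OF real_dist_normal_dist \<Phi>km])
      fix n and a :: "nat \<Rightarrow> real"
      define r where "r = smult (1 / sqrt c) (coeff_poly n a)"
      have rY: "lin r (\<lambda>k. Y k x) = (\<Sum>k<n. a k * \<Phi> x k)" for x
        by (simp add: r_def lin_coeff_poly \<Phi>_def sum_divide_distrib)
      have m1: "(\<lambda>x. iexp (lin r (\<lambda>k. Y k x))) \<in> borel_measurable M"
        unfolding rY using \<Phi>km by measurable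
      have "(\<lambda>m. \<integral>x. iexp (lin (r * p m) x) \<partial>M) \<longlonglongrightarrow> (\<integral>x. iexp (lin r (\<lambda>k. Y k x)) \<partial>M)"
      proof (rule integral_dominated_convergence[where w = "\<lambda>_. 1"])
        show "AE x in M. (\<lambda>m. iexp (lin (r * p m) x)) \<longlonglongrightarrow> iexp (lin r (\<lambda>k. Y k x))"
          using lin_Y by eventually_elim (intro tendsto_intros; blast)
        show "(\<lambda>x. iexp (lin (r * p m) x)) \<in> borel_measurable M" for m
          using lin_measurable_M by measurable
      qed (use m1 in auto)
      moreover have "(\<lambda>m. \<integral>x. iexp (lin (r * p m) x) \<partial>M) \<longlonglongrightarrow> complex_of_real (exp (- (\<Sum>k<n. (a k)\<^sup>2) / 2))"
      proof -
        \<comment> \<open>The variances converge to the squared norm of \<open>r * \<phi>\<close>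
          under the spectral measure. By \<open>|\<phi>|^2 f = c\<close> and the factor
          \<open>1 / sqrt c\<close> in \<open>r\<close>, this is a squared norm under Lebesgue
          measure, which Parseval's identity evaluates.\<close>
        have "(\<lambda>m. \<integral>z. (ev r z * ev (p m) z) * cnj (ev r z * ev (p m) z) \<partial>\<nu>) \<longlonglongrightarrow> (\<integral>z. (ev r z * \<phi> z) * cnj (ev r z * \<phi> z) \<partial>\<nu>)"
          by (intro tendsto_integral_mult_cnj sq_integrable_ev_mult sq_integrable_ev \<phi> ev_mult_tendsto lim)
        then have "(\<lambda>m. complex_of_real (nrm (r * p m))) \<longlonglongrightarrow> complex_of_real (\<integral>z. (norm (ev r z * \<phi> z))\<^sup>2 \<partial>\<nu>)"
          unfolding nrm_def by (simp only: ev_mult complex_norm_square[symmetric] integral_complex_of_real)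
        then have "(\<lambda>m. nrm (r * p m)) \<longlonglongrightarrow> (\<integral>z. (norm (ev r z * \<phi> z))\<^sup>2 \<partial>\<nu>)"
          by (simp only: tendsto_of_real_iff)
        also have "(\<integral>z. (norm (ev r z * \<phi> z))\<^sup>2 \<partial>\<nu>) = (\<integral>z. f z *\<^sub>R (norm (ev r z * \<phi> z))\<^sup>2 \<partial>circle_lebesgue)"
          by (rule integral_\<nu>) (use sq_integrable_ev_mult[OF \<phi>, of r] in \<open>auto simp: sq_integrable_def\<close>)
        also have "\<dots> = (\<integral>z. (norm (ev (coeff_poly n a) z))\<^sup>2 \<partial>circle_lebesgue)"
        proof (rule integral_cong_AE)
          show "AE z in circle_lebesgue. f z *\<^sub>R (norm (ev r z * \<phi> z))\<^sup>2 = (norm (ev (coeff_poly n a) z))\<^sup>2"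
            using flat
          proof eventually_elim
            case (elim z)
            have "(norm (ev r z))\<^sup>2 = (norm (ev (coeff_poly n a) z))\<^sup>2 / c"
              using c by (simp add: r_def norm_mult power_mult_distrib power_divide norm_divide)
            then have "f z *\<^sub>R (norm (ev r z * \<phi> z))\<^sup>2 = (norm (ev (coeff_poly n a) z))\<^sup>2 / c * ((norm (\<phi> z))\<^sup>2 * f z)"
              by (simp add: norm_mult power_mult_distrib)
            then show ?case using c by (simp only: elim) simp
          qed
        qed (use sq_integrable_ev_mult[OF \<phi>, of r] f_measurable ev_measurable[of "coeff_poly n a"] in \<open>auto simp: sq_integrable_def measurable_\<nu>\<close>)
        also have "\<dots> = (\<Sum>k<n. (a k)\<^sup>2)" by (rule integral_circle_norm_coeff_poly)
        finally have "(\<lambda>m. nrm (r * p m)) \<longlonglongrightarrow> (\<Sum>k<n. (a k)\<^sup>2)" .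
        then show ?thesis unfolding lin_char
          by (intro tendsto_of_real tendsto_exp tendsto_divide tendsto_minus tendsto_const) auto
      qed
      ultimately have "(\<integral>x. iexp (\<Sum>k<n. a k * \<Phi> x k) \<partial>M) = complex_of_real (exp (- (\<Sum>k<n. (a k)\<^sup>2) / 2))"
        unfolding rY by (rule LIMSEQ_unique)
      also have "exp (- (\<Sum>k<n. (a k)\<^sup>2) / 2) = (\<Prod>k<n. exp (- (a k)\<^sup>2 / 2))"
        by (subst exp_sum[symmetric]) (simp_all add: sum_negf sum_divide_distrib)
      finally show "(\<integral>x. iexp (\<Sum>k<n. a k * \<Phi> x k) \<partial>M) = (\<Prod>k<n. char std_normal_distribution (a k))"
        by (simp add: char_std_normal_distribution)
    qed
    then show ?thesis using N by simp
  qed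
  have inv: "AE x in M. \<Psi> (\<Phi> x) = x"
  proof -
    have "AE x in M. \<forall>k. (\<lambda>n. sqrt c * lin (q n) (?s k (\<Phi> x))) \<longlonglongrightarrow> x k"
      unfolding AE_all_countable
    proof
      fix k
      \<comment> \<open>The error in rebuilding \<open>x k\<close> with \<open>q n\<close>. It is an
        almost sure limit, as \<open>m\<close> grows, of functionals with polynomials
        \<open>monom 1 k * (1 - q n * p m)\<close>, whose variances are integrals on the
        circle.\<close>
      define D where "D n x = x k - sqrt c * lin (q n) (?s k (\<Phi> x))" for n x
      have D_lim: "AE x in M. \<forall>n. (\<lambda>m. lin (monom 1 k * (1 - q n * p m)) x) \<longlonglongrightarrow> D n x"
        using lin_Y
      proof (eventually_elim, intro allI)
        fix x n assume r: "\<forall>r. (\<lambda>m. lin (r * p m) x) \<longlonglongrightarrow> lin r (\<lambda>k. Y k x)"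
        have "(\<lambda>m. x k - lin (monom 1 k * q n * p m) x) \<longlonglongrightarrow> x k - lin (monom 1 k * q n) (\<lambda>k. Y k x)"
          by (intro tendsto_intros r[rule_format])
        moreover have "lin (monom 1 k * q n) (\<lambda>k. Y k x) = sqrt c * lin (q n) (?s k (\<Phi> x))"
        proof -
          have "(\<lambda>k. Y k x) = (\<lambda>k. sqrt c * \<Phi> x k)" using c by (simp add: \<Phi>_def)
          then have "lin (monom 1 k * q n) (\<lambda>k. Y k x) = lin (monom 1 k * q n) (\<lambda>k. sqrt c * \<Phi> x k)" by simp
          also have "\<dots> = sqrt c * lin (monom 1 k * q n) (\<Phi> x)"
            by (simp add: lin_def sum_distrib_left mult_ac del: lin_monom_mult)
          finally show ?thesis by simp
        qed
        moreover have "lin (monom 1 k * (1 - q n * p m)) x = x k - lin (monom 1 k * q n * p m) x" for m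
          by (simp add: mult.assoc lin_1 funpow_unilateral_shift)
        ultimately show "(\<lambda>m. lin (monom 1 k * (1 - q n * p m)) x) \<longlonglongrightarrow> D n x"
          by (simp only: D_def)
      qed
      have Dm [measurable]: "D n \<in> borel_measurable M" for n
      proof -
        have "(\<lambda>x. x k) \<in> borel_measurable M"
          unfolding measurable_cong_sets[OF sets_M refl] by measurable
        moreover have "(\<lambda>x. lin (q n) (?s k (\<Phi> x))) \<in> borel_measurable M"
          unfolding measurable_cong_sets[OF sets_M refl]
          by (intro measurable_compose[OF \<Phi>m] measurable_compose[OF funpow_shift_measurable lin_measurable])
        ultimately show ?thesis unfolding D_def by measurable
      qed
      have nn: "(\<integral>\<^sup>+x. ennreal ((D n x)\<^sup>2) \<partial>M) \<le> ennreal (1 / 8 ^ n)" for n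
      proof -
        let ?r = "\<lambda>m. monom 1 k * (1 - q n * p m)"
        have nl: "(\<lambda>m. nrm (?r m)) \<longlonglongrightarrow> (\<integral>z. (norm (1 - ev (q n) z * \<phi> z))\<^sup>2 \<partial>\<nu>)"
        proof -
          let ?u = "\<lambda>m z. ev (1 - q n * p m) z" and ?v = "\<lambda>z. 1 - ev (q n) z * \<phi> z"
          have one: "sq_integrable \<nu> (\<lambda>_. 1 :: complex)" by (simp add: sq_integrable_def)
          have v: "sq_integrable \<nu> ?v" by (intro sq_integrable_diff one sq_integrable_ev_mult \<phi>)
          have "(\<lambda>m. \<integral>z. (norm (ev (- q n) z * ev (p m) z - ev (- q n) z * \<phi> z))\<^sup>2 \<partial>\<nu>) \<longlonglongrightarrow> 0"
            by (rule ev_mult_tendsto[OF sq_integrable_ev \<phi> lim])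
          then have uv: "(\<lambda>m. \<integral>z. (norm (?u m z - ?v z))\<^sup>2 \<partial>\<nu>) \<longlonglongrightarrow> 0" by simp
          have "(\<lambda>m. \<integral>z. ?u m z * cnj (?u m z) \<partial>\<nu>) \<longlonglongrightarrow> (\<integral>z. ?v z * cnj (?v z) \<partial>\<nu>)"
            by (rule tendsto_integral_mult_cnj[OF sq_integrable_ev sq_integrable_ev v v uv uv])
          then have "(\<lambda>m. complex_of_real (nrm (1 - q n * p m))) \<longlonglongrightarrow> complex_of_real (\<integral>z. (norm (?v z))\<^sup>2 \<partial>\<nu>)"
            unfolding nrm_def by (simp only: complex_norm_square[symmetric] integral_complex_of_real)
          then show ?thesis by (simp only: tendsto_of_real_iff nrm_monom_mult)
        qed
        \<comment> \<open>Fatou's lemma in \<open>m\<close> bounds the variance of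
          \<open>D n\<close> by the squared distance of \<open>q n * \<phi>\<close> from 1; the
          factor \<open>monom 1 k\<close> does not change norms.\<close>
        have "(\<integral>\<^sup>+x. ennreal ((D n x)\<^sup>2) \<partial>M) = (\<integral>\<^sup>+x. liminf (\<lambda>m. ennreal ((lin (?r m) x)\<^sup>2)) \<partial>M)"
        proof (rule nn_integral_cong_AE)
          show "AE x in M. ennreal ((D n x)\<^sup>2) = liminf (\<lambda>m. ennreal ((lin (?r m) x)\<^sup>2))"
            using D_lim
          proof eventually_elim
            case (elim x)
            then have "(\<lambda>m. ennreal ((lin (?r m) x)\<^sup>2)) \<longlonglongrightarrow> ennreal ((D n x)\<^sup>2)"
              by (intro tendsto_ennrealI tendsto_power) blast
            from lim_imp_Liminf[OF _ this] show ?case by simp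
          qed
        qed
        also have "\<dots> \<le> liminf (\<lambda>m. \<integral>\<^sup>+x. ennreal ((lin (?r m) x)\<^sup>2) \<partial>M)"
        proof (rule nn_integral_liminf)
          show "(\<lambda>x. ennreal ((lin (?r m) x)\<^sup>2)) \<in> borel_measurable M" for m
            using lin_measurable_M[of "?r m"] by measurable
        qed
        also have "\<dots> = liminf (\<lambda>m. ennreal (nrm (?r m)))"
          using nn_integral_eq_integral[OF lin_integrable_sq] by (simp only: lin_sq_integral zero_le_power2 AE_I2)
        also have "\<dots> = ennreal (\<integral>z. (norm (1 - ev (q n) z * \<phi> z))\<^sup>2 \<partial>\<nu>)"
          using lim_imp_Liminf[OF _ tendsto_ennrealI[OF nl]] by simp
        also have "\<dots> \<le> ennreal (1 / 8 ^ n)" by (intro ennreal_leI q)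
        finally show ?thesis .
      qed
      have DI: "integrable M (\<lambda>x. (D n x)\<^sup>2)" for n
        by (rule integrableI_nonneg) (use nn[of n] in \<open>auto simp: less_top[symmetric] top_unique\<close>)
      have Dle: "(\<integral>x. (D n x)\<^sup>2 \<partial>M) \<le> 1 / 8 ^ n" for n
        using nn[of n] nn_integral_eq_integral[OF DI[of n]] by (simp add: ennreal_le_iff)
      have "AE x in M. summable (\<lambda>n. (D n x)\<^sup>2)"
      proof (rule AE_summable_if_summable_integral[OF DI])
        show "summable (\<lambda>n. \<integral>x. (D n x)\<^sup>2 \<partial>M)"
          by (rule summable_comparison_test[OF _ summable_geometric[of "1/8::real"]])
             (use Dle in \<open>auto simp: power_divide\<close>)
      qed simp
      then show "AE x in M. (\<lambda>n. sqrt c * lin (q n) (?s k (\<Phi> x))) \<longlonglongrightarrow> x k"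
      proof eventually_elim
        case (elim x)
        from tendsto_real_sqrt[OF summable_LIMSEQ_zero[OF elim]]
        have "(\<lambda>n. D n x) \<longlonglongrightarrow> 0" by (simp add: tendsto_rabs_zero_iff)
        then have "(\<lambda>n. x k - D n x) \<longlonglongrightarrow> x k - 0" by (intro tendsto_intros)
        then show ?case by (simp add: D_def)
      qed
    qed
    then show ?thesis
    proof eventually_elim
      case (elim x)
      have "\<Psi> (\<Phi> x) k = x k" for k
      proof -
        have "(\<lambda>n. sqrt c * lin (q n) (?s k (\<Phi> x)) / sqrt c) \<longlonglongrightarrow> x k / sqrt c"
          using elim c by (intro tendsto_divide tendsto_const) auto
        then have "(\<lambda>n. lin (q n) (?s k (\<Phi> x))) \<longlonglongrightarrow> x k / sqrt c" using c by simp
        then show ?thesis using c by (simp add: \<Psi>_def limI)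
      qed
      then show ?case by (simp add: fun_eq_iff)
    qed
  qed
  show ?thesis
  proof (rule mpt_isomorphic_unilateral_shiftI[OF sets_M \<Phi>m \<Psi>m _ _ law inv])
    show "\<Phi> (unilateral_shift x) = unilateral_shift (\<Phi> x)" for x
      unfolding \<Phi>_def Y_def by (rule lim_lin_shift)
    show "\<Psi> (unilateral_shift y) = unilateral_shift (\<Psi> y)" for y
      unfolding \<Psi>_def by (rule lim_lin_shift)
  qed
qed

end

subsection \<open>Entropy\<close>

context spectral_density begin

definition ip :: "real poly \<Rightarrow> real poly \<Rightarrow> real" where
  "ip p q = (\<integral>z. ev p z \<bullet> ev q z \<partial>\<nu>)"

lemma ip_integrable: "integrable \<nu> (\<lambda>z. ev p z \<bullet> ev q z)"
  by (intro integrable_continuous_\<nu> continuous_intros continuous_ev)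

lemma ip_commute: "ip p q = ip q p"
  by (simp add: ip_def inner_commute)

lemma ip_add_right: "ip p (q + r) = ip p q + ip p r"
  using ip_integrable by (simp add: ip_def inner_add_right)

lemma ip_diff_right: "ip p (q - r) = ip p q - ip p r"
  using ip_integrable by (simp add: ip_def inner_diff_right)

lemma ip_smult_right: "ip p (smult c q) = c * ip p q"
  by (simp add: ip_def flip: scaleR_conv_of_real)

lemma ip_sum_right: "ip p (\<Sum>i\<in>A. q i) = (\<Sum>i\<in>A. ip p (q i))"
  using ip_integrable by (simp add: ip_def inner_sum_right)

lemma ip_self: "ip p p = nrm p"
  by (simp add: ip_def nrm_def power2_norm_eq_inner)

lemma nrm_add: "nrm (p + q) = nrm p + nrm q + 2 * ip p q"
proof -
  have "nrm (p + q) = ip (p + q) p + ip (p + q) q" by (simp only: ip_self[symmetric] ip_add_right)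
  also have "\<dots> = ip p (p + q) + ip q (p + q)" by (simp only: ip_commute[of "p + q"])
  also have "\<dots> = (ip p p + ip p q) + (ip q p + ip q q)" by (simp only: ip_add_right)
  finally show ?thesis by (simp add: ip_self ip_commute[of q p])
qed

text \<open>A polynomial vanishing almost everywhere for the spectral measure does so for Lebesgue
  measure, and Parseval's identity forces its coefficients to be 0. This keeps the divisors of the
  Gram-Schmidt process nonzero and all finite-step prediction errors positive.\<close>

lemma nrm_pos:
  assumes "p \<noteq> 0"
  shows "0 < nrm p"
proof -
  have "nrm p \<noteq> 0"
  proof
    assume "nrm p = 0"
    then have "AE z in \<nu>. (norm (ev p z))\<^sup>2 = 0"
      unfolding nrm_def
      by (subst (asm) integral_nonneg_eq_0_iff_AE[OF sq_integrable_integrable[OF sq_integrable_ev]]) auto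
    then have "AE z in circle_lebesgue. (norm (ev p z))\<^sup>2 = 0" by (simp only: AE_\<nu>)
    then have "(\<integral>z. (norm (ev p z))\<^sup>2 \<partial>circle_lebesgue) = 0" by (rule integral_eq_zero_AE)
    then show False using integral_circle_norm_ev_eq_0 assms by blast
  qed
  then show ?thesis using nrm_nonneg[of p] by simp
qed

text \<open>Gram-Schmidt on \<open>1, z, z^2, ...\<close> without normalization: the monic
  orthogonal polynomials of the measure on the circle, known as Szego polynomials. On the process,
  \<open>lin (orth_poly k)\<close> is the error in predicting \<open>X_k\<close> from
  \<open>X_0, ..., X_(k-1)\<close>.\<close>

fun orth_poly :: "nat \<Rightarrow> real poly" where
  "orth_poly k = monom 1 k - (\<Sum>i<k. smult (ip (orth_poly i) (monom 1 k) / nrm (orth_poly i)) (orth_poly i))"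

declare orth_poly.simps [simp del]

lemma coeff_orth_poly: "k \<le> j \<Longrightarrow> coeff (orth_poly k) j = (if j = k then 1 else 0)"
proof (induction k arbitrary: j rule: less_induct)
  case (less k)
  have "coeff (smult (ip (orth_poly i) (monom 1 k) / nrm (orth_poly i)) (orth_poly i)) j = 0" if "i < k" for i
    using less.IH[OF that, of j] less.prems that by simp
  then show ?case by (subst orth_poly.simps) (simp add: coeff_sum del: coeff_smult)
qed

lemma orth_poly_nonzero: "orth_poly k \<noteq> 0"
  using coeff_orth_poly[of k k] by auto

lemma orth_poly_orthogonal:
  assumes "i < k" shows "ip (orth_poly i) (orth_poly k) = 0"
  using assms
proof (induction k arbitrary: i rule: less_induct)
  case (less k)
  let ?a = "\<lambda>j. ip (orth_poly j) (monom 1 k) / nrm (orth_poly j)"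
  have "ip (orth_poly i) (orth_poly k) = ip (orth_poly i) (monom 1 k) - (\<Sum>j<k. ?a j * ip (orth_poly i) (orth_poly j))"
    by (subst (2) orth_poly.simps) (simp add: ip_diff_right ip_sum_right ip_smult_right)
  also have "(\<Sum>j<k. ?a j * ip (orth_poly i) (orth_poly j)) = (\<Sum>j<k. if j = i then ip (orth_poly i) (monom 1 k) else 0)"
  proof (intro sum.cong refl)
    fix j assume j: "j \<in> {..<k}"
    consider "j = i" | "j < i" | "i < j" by linarith
    then show "?a j * ip (orth_poly i) (orth_poly j) = (if j = i then ip (orth_poly i) (monom 1 k) else 0)"
    proof cases
      case 1
      then show ?thesis using nrm_pos[OF orth_poly_nonzero[of i]] by (simp add: ip_self)
    next
      case 2
      then show ?thesis using less.IH[OF less.prems 2] ip_commute by simp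
    next
      case 3
      then show ?thesis using less.IH[of j i] j by simp
    qed
  qed
  also have "\<dots> = ip (orth_poly i) (monom 1 k)" using less.prems by simp
  finally show ?case by simp
qed

lemma monom_orth_poly:
  "monom 1 k = orth_poly k + (\<Sum>i<k. smult (ip (orth_poly i) (monom 1 k) / nrm (orth_poly i)) (orth_poly i))"
  by (subst orth_poly.simps) simp

lemma ip_orth_poly_low_degree:
  assumes "\<And>j. k \<le> j \<Longrightarrow> coeff p j = 0"
  shows "ip (orth_poly k) p = 0"
proof -
  have mon: "ip (orth_poly k) (monom 1 i) = 0" if "i < k" for i
    by (subst monom_orth_poly)
       (use that orth_poly_orthogonal ip_commute in \<open>simp add: ip_add_right ip_sum_right ip_smult_right\<close>)
  have "p = (\<Sum>i<k. smult (coeff p i) (monom 1 i))"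
    by (rule poly_eqI) (use assms in \<open>auto simp: coeff_sum if_distrib cong: if_cong\<close>)
  then have "ip (orth_poly k) p = (\<Sum>i<k. coeff p i * ip (orth_poly k) (monom 1 i))"
    by (metis (no_types, lifting) ip_smult_right ip_sum_right sum.cong)
  then show ?thesis using mon by simp
qed

text \<open>On the circle this is \<open>z ^ n * cnj (ev p z)\<close> when \<open>p\<close> has
  degree at most \<open>n\<close>. Reversal exchanges the constant and the top coefficient, so
  prediction of the last coordinate from earlier ones becomes prediction of \<open>X_0\<close> from
  later ones.\<close>

definition rev_poly :: "nat \<Rightarrow> real poly \<Rightarrow> real poly" where
  "rev_poly n p = (\<Sum>i\<le>n. monom (coeff p i) (n - i))"

lemma coeff_rev_poly: "coeff (rev_poly n p) j = (if j \<le> n then coeff p (n - j) else 0)"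
proof -
  have "coeff (rev_poly n p) j = (\<Sum>i\<le>n. if n - i = j then coeff p i else 0)"
    by (simp add: rev_poly_def coeff_sum)
  also have "\<dots> = (\<Sum>i\<le>n. if i = n - j \<and> j \<le> n then coeff p i else 0)"
    by (intro sum.cong refl) auto
  also have "\<dots> = (if j \<le> n then coeff p (n - j) else 0)" by (auto simp: sum.delta)
  finally show ?thesis .
qed

lemma nrm_rev_poly:
  assumes "\<And>j. n < j \<Longrightarrow> coeff p j = 0"
  shows "nrm (rev_poly n p) = nrm p"
  unfolding nrm_def
proof (rule Bochner_Integration.integral_cong)
  fix z assume "z \<in> space \<nu>"
  then have z: "z \<in> sphere 0 1" by (simp add: space_\<nu>)
  have "degree p \<le> n" using assms by (intro degree_le) simp
  then have ev: "ev p w = (\<Sum>i\<le>n. complex_of_real (coeff p i) * w ^ i)" for w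
    unfolding ev_eq_sum by (intro sum.mono_neutral_left) (auto simp: coeff_eq_0)
  have "ev (rev_poly n p) z = (\<Sum>i\<le>n. complex_of_real (coeff p i) * z ^ (n - i))"
    by (simp add: rev_poly_def)
  also have "\<dots> = (\<Sum>i\<le>n. z ^ n * (complex_of_real (coeff p i) * cnj z ^ i))"
  proof (intro sum.cong refl)
    fix i assume "i \<in> {..n}"
    then have "z ^ n * cnj z ^ i = z ^ (n - i) * (z ^ i * cnj z ^ i)" by (simp flip: power_add mult.assoc)
    also have "z ^ i * cnj z ^ i = 1" using circle_mult_cnj(1)[OF z] by (simp flip: power_mult_distrib)
    finally show "complex_of_real (coeff p i) * z ^ (n - i) = z ^ n * (complex_of_real (coeff p i) * cnj z ^ i)"
      by (simp add: mult_ac)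
  qed
  also have "\<dots> = z ^ n * cnj (ev p z)"
    unfolding cnj_ev ev[of "cnj z"] by (simp add: sum_distrib_left)
  finally show "(norm (ev (rev_poly n p) z))\<^sup>2 = (norm (ev p z))\<^sup>2"
    using z by (simp add: norm_mult norm_power)
qed simp

text \<open>The reversal of \<open>p\<close> has coefficient 1 at \<open>z ^ k\<close>, so it
  differs from \<open>orth_poly k\<close> by a polynomial of lower degree. That difference is
  orthogonal to \<open>orth_poly k\<close>, and Pythagoras applies.\<close>

lemma nrm_orth_poly_le:
  assumes "poly p 0 = 1" "degree p \<le> k"
  shows "nrm (orth_poly k) \<le> nrm p"
proof -
  let ?r = "rev_poly k p"
  have nr: "nrm ?r = nrm p" by (rule nrm_rev_poly) (use assms in \<open>auto intro: coeff_eq_0\<close>)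
  let ?t = "?r - orth_poly k"
  have t: "ip (orth_poly k) ?t = 0"
    by (rule ip_orth_poly_low_degree)
       (use assms in \<open>auto simp: coeff_rev_poly coeff_orth_poly poly_0_coeff_0\<close>)
  have "nrm ?r = nrm (orth_poly k + ?t)" by simp
  also have "\<dots> = nrm (orth_poly k) + nrm ?t" using t by (simp only: nrm_add)
  finally show ?thesis using nr nrm_nonneg[of ?t] by simp
qed

definition pred_error :: real where
  "pred_error = (INF p\<in>{p. poly p 0 = 1}. nrm p)"

lemma pred_error_le: "poly p 0 = 1 \<Longrightarrow> pred_error \<le> nrm p"
  unfolding pred_error_def by (rule cINF_lower) (auto intro!: bdd_belowI2[of _ 0] nrm_nonneg)

lemma unpredictable_iff_pred_error: "unpredictable \<longleftrightarrow> 0 < pred_error"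
proof
  assume unpredictable
  then obtain d where d: "d > 0" "\<And>p. poly p 0 = 1 \<Longrightarrow> d \<le> nrm p" unfolding unpredictable_def by metis
  have "d \<le> pred_error" unfolding pred_error_def
    by (rule cINF_greatest) (use d(2) in \<open>auto intro: exI[of _ 1]\<close>)
  then show "0 < pred_error" using d by simp
next
  assume "0 < pred_error"
  then show unpredictable unfolding unpredictable_def using pred_error_le by blast
qed

text \<open>By reversal, \<open>nrm (orth_poly k)\<close> is the least norm among polynomials of
  degree at most \<open>k\<close> with constant term 1. Every competitor for the infimum is reached
  once \<open>k\<close> exceeds its degree.\<close>

lemma nrm_orth_poly_tendsto: "(\<lambda>k. nrm (orth_poly k)) \<longlonglongrightarrow> pred_error"
proof (rule order_tendstoI)
  fix y assume "y < pred_error"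
  moreover have "pred_error \<le> nrm (orth_poly k)" for k
  proof -
    have "pred_error \<le> nrm (rev_poly k (orth_poly k))"
      by (rule pred_error_le) (simp add: poly_0_coeff_0 coeff_rev_poly coeff_orth_poly)
    also have "\<dots> = nrm (orth_poly k)" by (rule nrm_rev_poly) (simp add: coeff_orth_poly)
    finally show ?thesis .
  qed
  ultimately show "\<forall>\<^sub>F k in sequentially. y < nrm (orth_poly k)"
    by (intro always_eventually allI) (rule less_le_trans)
next
  fix y assume "pred_error < y"
  then obtain p where p: "poly p 0 = 1" "nrm p < y"
    unfolding pred_error_def by (subst (asm) cINF_less_iff) (auto intro!: bdd_belowI2[of _ 0] nrm_nonneg exI[of _ 1])
  show "\<forall>\<^sub>F k in sequentially. nrm (orth_poly k) < y"
    using eventually_ge_at_top[of "degree p"]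
    by eventually_elim (use nrm_orth_poly_le[OF p(1)] p(2) in \<open>fastforce intro: le_less_trans\<close>)
qed

lemma nrm_orth_sum: "nrm (\<Sum>k<n. smult (c k) (orth_poly k)) = (\<Sum>k<n. (c k)\<^sup>2 * nrm (orth_poly k))"
proof -
  have orth: "ip (orth_poly i) (orth_poly j) = (if i = j then nrm (orth_poly i) else 0)" for i j
    using orth_poly_orthogonal[of i j] orth_poly_orthogonal[of j i] ip_commute[of "orth_poly i" "orth_poly j"]
    by (cases i j rule: linorder_cases) (auto simp: ip_self)
  have "nrm (\<Sum>k<n. smult (c k) (orth_poly k))
      = (\<Sum>j<n. c j * ip (\<Sum>k<n. smult (c k) (orth_poly k)) (orth_poly j))"
    by (simp add: ip_sum_right ip_smult_right flip: ip_self)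
  also have "\<dots> = (\<Sum>j<n. c j * (\<Sum>k<n. c k * ip (orth_poly j) (orth_poly k)))"
    by (simp only: ip_commute[of "sum _ _"] ip_sum_right ip_smult_right)
  also have "\<dots> = (\<Sum>j<n. (c j)\<^sup>2 * nrm (orth_poly j))"
    by (intro sum.cong refl) (simp add: orth if_distrib power2_eq_square mult.assoc cong: if_cong)
  finally show ?thesis .
qed

end

section \<open>The entropy and isomorphism criteria for the Gaussian process\<close>

context gaussian_sequence begin

text \<open>The Gram-Schmidt relation writes each coordinate as its own prediction error plus a
  combination of the earlier errors. This is the unitriangular form for which the entropy of the
  marginals was computed, and orthogonality makes the errors independent.\<close>

theorem entropy_finite_iff: "\<bar>shannon_entropy M\<bar> \<noteq> \<infinity> \<longleftrightarrow> unpredictable"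
proof -
  define s where "s k = nrm (orth_poly k)" for k
  have s: "0 < s k" for k by (simp add: s_def nrm_pos orth_poly_nonzero)
  have "- (\<integral>x. marginal_density M n x * ln (marginal_density M n x) \<partial>(\<Pi>\<^sub>M i\<in>{..<n}. lborel))
     = (\<Sum>k<n. (ln (2 * pi * s k) + 1) / 2)" for n
  proof (rule marginal_entropy[OF sets_M s])
    show "lin (orth_poly k) \<in> borel_measurable M" for k by (rule lin_measurable_M)
    show "x k = lin (orth_poly k) x + (\<Sum>i<k. ip (orth_poly i) (monom 1 k) / nrm (orth_poly i) * lin (orth_poly i) x)" for x k
      using arg_cong[OF monom_orth_poly[of k], of "\<lambda>p. lin p x"] by simp
    show "prob_space M" by (rule M.prob_space_axioms)
    show "integrable M (\<lambda>x. (lin (orth_poly k) x)\<^sup>2)" for k by (rule lin_integrable_sq)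
    show "(\<integral>x. (lin (orth_poly k) x)\<^sup>2 \<partial>M) = s k" for k by (simp add: s_def lin_sq_integral)
    show "distr M seq_borel (\<lambda>x k. lin (orth_poly k) x)
       = (\<Pi>\<^sub>M k\<in>UNIV. density lborel (\<lambda>x. ennreal (normal_density 0 (sqrt (s k)) x)))"
    proof (rule M.char_product_imp_distr_PiM[OF _ lin_measurable_M])
      show "real_distribution (density lborel (\<lambda>x. ennreal (normal_density 0 (sqrt (s k)) x)))" for k
        unfolding real_distribution_def real_distribution_axioms_def
        using prob_space_normal_density[of "sqrt (s k)" 0] s[of k] by simp
      fix n and c :: "nat \<Rightarrow> real"
      have "(\<integral>x. iexp (\<Sum>k<n. c k * lin (orth_poly k) x) \<partial>M) = complex_of_real (exp (- (\<Sum>k<n. (c k)\<^sup>2 * s k) / 2))"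
        using lin_char[of "\<Sum>k<n. smult (c k) (orth_poly k)"] by (simp add: nrm_orth_sum s_def)
      also have "exp (- (\<Sum>k<n. (c k)\<^sup>2 * s k) / 2) = (\<Prod>k<n. exp (- (sqrt (s k) * c k)\<^sup>2 / 2))"
        using s by (subst exp_sum[symmetric])
          (simp_all add: sum_negf sum_divide_distrib power_mult_distrib mult.commute less_imp_le)
      also have "complex_of_real \<dots> = (\<Prod>k<n. char (density lborel (\<lambda>x. ennreal (normal_density 0 (sqrt (s k)) x))) (c k))"
        using s by (simp add: char_normal_density)
      finally show "(\<integral>x. iexp (\<Sum>k<n. c k * lin (orth_poly k) x) \<partial>M)
        = (\<Prod>k<n. char (density lborel (\<lambda>x. ennreal (normal_density 0 (sqrt (s k)) x))) (c k))" .
    qed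
  qed
  then have "shannon_entropy M = lim (\<lambda>n. ereal (1 / real n * (\<Sum>k<n. (ln (2 * pi * s k) + 1) / 2)))"
    unfolding shannon_entropy_def by simp
  then show ?thesis
    using lim_mean_finite_iff[OF s nrm_orth_poly_tendsto[folded s_def]] unpredictable_iff_pred_error
    by (simp only:)
qed

theorem isomorphic_iff:
  assumes "is_gaussian_measure circle_lebesgue N"
  shows "mpt_isomorphic M unilateral_shift N unilateral_shift \<longleftrightarrow> unpredictable"
  using isomorphic_if_unpredictable not_isomorphic_if_predictable white_noise_eq_PiM[OF assms] by blast

end

theorem theorem6p6:
  fixes \<nu> :: "complex measure" and f :: "complex \<Rightarrow> real"
    and M_nu M_lam :: "(nat \<Rightarrow> real) measure"
  assumes "prob_space \<nu>" and "sets \<nu> = sets circle_borel"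
    and conj_invariant: "distr \<nu> circle_borel cnj = \<nu>"
    and equivalent: "absolutely_continuous circle_lebesgue \<nu>"
      "absolutely_continuous \<nu> circle_lebesgue"
    and f_density: "f \<in> borel_measurable circle_lebesgue" "AE z in circle_lebesgue. 0 \<le> f z"
      "\<nu> = density circle_lebesgue (\<lambda>z. ennreal (f z))"
    and "is_gaussian_measure \<nu> M_nu"
    and "is_gaussian_measure circle_lebesgue M_lam"
  shows "(mpt_isomorphic M_nu unilateral_shift M_lam unilateral_shift
            \<longleftrightarrow> \<bar>shannon_entropy M_nu\<bar> \<noteq> \<infinity>) \<and>
         (mpt_isomorphic M_nu unilateral_shift M_lam unilateral_shift
            \<longleftrightarrow> integrable circle_lebesgue (\<lambda>z. ln (f z)))"
proof -
  \<comment> \<open>The spectral measure gives no mass to the set where \<open>f\<close> is at most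
    0, and Lebesgue measure is absolutely continuous with respect to it.\<close>
  have f_pos: "AE z in circle_lebesgue. 0 < f z"
  proof -
    let ?Z = "{z \<in> space circle_lebesgue. f z \<le> 0}"
    have Z: "?Z \<in> sets circle_lebesgue" using f_density(1) by measurable
    have "?Z \<in> null_sets (density circle_lebesgue (\<lambda>z. ennreal (f z)))"
      using Z f_density(1) by (subst null_sets_density_iff) (auto simp: ennreal_eq_0_iff)
    then have "?Z \<in> null_sets circle_lebesgue"
      using equivalent(2) f_density(3) by (auto simp: absolutely_continuous_def)
    from AE_not_in[OF this] AE_space show ?thesis
      by eventually_elim auto
  qed
  have S: "spectral_density \<nu> f"
    by (intro spectral_density.intro spectral_density_axioms.intro)
       (fact assms(1) assms(2) conj_invariant f_density(1) f_pos f_density(3))+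
  then have G: "gaussian_sequence \<nu> f M_nu"
    by (rule gaussian_sequence.intro) (rule gaussian_sequence_axioms.intro, rule assms(9))
  show ?thesis
    using gaussian_sequence.isomorphic_iff[OF G assms(10)] gaussian_sequence.entropy_finite_iff[OF G]
      spectral_density.unpredictable_iff_ln_integrable[OF S] by simp
qed

end
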